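(* Let $n\ge 1$ and let $f\colon(\mathbb C\setminus\mathbb R)^n\to\mathbb C$ be a holomorphic function such that, for every index $j\in\{1,\ldots,n\}$ (and every choice of the remaining components of $\boldsymbol z$ in $\mathbb C\setminus\mathbb R$), $$\lim_{z_j\xrightarrow{\vee}\infty}\frac{f(\boldsymbol z)}{z_j}=\lim_{z_j\xrightarrow{\wedge}\infty}\frac{f(\boldsymbol z)}{z_j}=0 .$$ Then $f=h_{\mathrm{sym}}$ for some Herglotz-Nevanlinna function $h\colon(\mathbb C^+)^n\to\mathbb C$ if and only if the following three conditions hold: (i) $\operatorname{Im}[f(\boldsymbol z)]\ge 0$ for all $\boldsymbol z\in(\mathbb C^+)^n$; (ii) $f$ satisfies the symmetry formula $$f(\boldsymbol z)=\sum_{\substack{B\subseteq\{1,\ldots,n\}\\ B\neq\emptyset}}(-1)^{|B|+1}\,\overline{f(\Psi_B(i\,\boldsymbol 1,\boldsymbol z))}\qquad\text{for all }\boldsymbol z\in(\mathbb C\setminus\mathbb R)^n;$$ (iii) $f$ satisfies the variable non-dependence property.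
   Context: Notation: $\mathbb C^{\pm}=\{z\in\mathbb C:\pm\operatorname{Im} z>0\}$; $\boldsymbol 1=(1,\ldots,1)$; $i$ is the imaginary unit. Non-tangential limits: for $\theta\in(0,\pi/2]$, the upper Stoltz domain with centre $0$ and angle $\theta$ is $\{z\in\mathbb C^+:\theta\le\arg z\le\pi-\theta\}$; $z\xrightarrow{\vee}\infty$ denotes the limit $|z|\to\infty$ within any upper Stoltz domain with centre $0$. Lower Stoltz domains (the analogous sectors in $\mathbb C^-$) and $z\xrightarrow{\wedge}\infty$ are defined analogously. The map $\Psi_B$: for $B\subseteq\{1,\ldots,n\}$ and $\boldsymbol z,\boldsymbol w\in\mathbb C^n$, $\Psi_B(\boldsymbol z,\boldsymbol w):=\boldsymbol\zeta$ with $\zeta_j:=z_j$ if $j\notin B$ and $\zeta_j:=\overline{w_j}$ if $j\in B$. Variable non-dependence property: a function $f\colon(\mathbb C\setminus\mathbb R)^n\to\mathbb C$ has this property if for every $\boldsymbol z\in(\mathbb C\setminus\mathbb R)^n$ with $z_j\in\mathbb C^-$ for some $j$, the value $f(\boldsymbol z)$ does not depend on the components of $\boldsymbol z$ lying in $\mathbb C^+$; that is, $f(\boldsymbol z)=f(\boldsymbol w)$ whenever $\boldsymbol z,\boldsymbol w\in(\mathbb C\setminus\mathbb R)^n$ have the same nonempty set of indices $j$ with $j$-th component in $\mathbb C^-$ and $z_j=w_j$ for all those $j$. Herglotz-Nevanlinna function: a holomorphic function $h\colon(\mathbb C^+)^n\to\mathbb C$ with non-negative imaginary part. Kernel: for $\boldsymbol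 z\in(\mathbb C\setminus\mathbb R)^n$, $\boldsymbol t\in\mathbb R^n$, $$K_n(\boldsymbol z,\boldsymbol t):=i\left(\frac{2}{(2i)^n}\prod_{\ell=1}^n\Big(\frac1{t_\ell-z_\ell}-\frac1{t_\ell+i}\Big)-\frac1{(2i)^n}\prod_{\ell=1}^n\Big(\frac1{t_\ell-i}-\frac1{t_\ell+i}\Big)\right).$$ Known integral representation (needed to define $h_{\mathrm{sym}}$): a function $h\colon(\mathbb C^+)^n\to\mathbb C$ is a Herglotz-Nevanlinna function if and only if $$h(\boldsymbol z)=a+\sum_{j=1}^n b_jz_j+\frac1{\pi^n}\int_{\mathbb R^n}K_n(\boldsymbol z,\boldsymbol t)\,d\mu(\boldsymbol t)\qquad(\boldsymbol z\in(\mathbb C^+)^n),$$ where $a\in\mathbb R$, $\boldsymbol b\in[0,\infty)^n$ and $\mu$ is a positive Borel measure on $\mathbb R^n$ with $\int_{\mathbb R^n}\prod_{\ell=1}^n\frac1{1+t_\ell^2}\,d\mu(\boldsymbol t)<\infty$ and $$\sum_{\substack{\boldsymbol\rho\in\{-1,0,1\}^n\\ -1\in\boldsymbol\rho\ \wedge\ 1\in\boldsymbol\rho}}\int_{\mathbb R^n}\prod_{j=1}^nN_{\rho_j}(z_j,t_j)\,d\mu(\boldsymbol t)=0\quad\text{for all }\boldsymbol z\in(\mathbb C^+)^n,$$ where the sum runs over those $\boldsymbol\rho$ having at least one entry $-1$ and at least one entry $1$, and $N_{-1}(z,t)=\frac1{2i}\big(\frac1{t-z}-\frac1{t-i}\big)$,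 $N_0(z,t)=\frac1{2i}\big(\frac1{t-i}-\frac1{t+i}\big)$, $N_1(z,t)=\frac1{2i}\big(\frac1{t+i}-\frac1{t-\bar z}\big)$. The triple $(a,\boldsymbol b,\mu)$ is unique for given $h$. Symmetric extension: for a Herglotz-Nevanlinna function $h$ with triple $(a,\boldsymbol b,\mu)$, $h_{\mathrm{sym}}\colon(\mathbb C\setminus\mathbb R)^n\to\mathbb C$ is given by $$h_{\mathrm{sym}}(\boldsymbol z):=a+\sum_{j=1}^n b_jz_j+\frac1{\pi^n}\int_{\mathbb R^n}K_n(\boldsymbol z,\boldsymbol t)\,d\mu(\boldsymbol t),$$ taken for all $\boldsymbol z\in(\mathbb C\setminus\mathbb R)^n$ (where it is well defined). *)

theory Defs
  imports "HOL-Analysis.Analysis"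
begin

definition upper_poly :: "(complex ^ 'n) set" where
  "upper_poly = {z. \<forall>j. Im (z $ j) > 0}"

definition off_real :: "(complex ^ 'n) set" where
  "off_real = {z. \<forall>j. z $ j \<notin> \<real>}"

text \<open>Holomorphy in several variables: the real Frechet derivative exists and is complex-linear.
  Only used for open sets.\<close>
definition holomorphic_sv :: "(complex ^ 'n \<Rightarrow> complex) \<Rightarrow> (complex ^ 'n) set \<Rightarrow> bool" where
  "holomorphic_sv f S \<longleftrightarrow>
     (\<forall>z\<in>S. \<exists>D. (f has_derivative D) (at z) \<and> (\<forall>c v. D (c *s v) = c * D v))"

text \<open>Here and below, functions on a proper subset of the space are total functions whose values
  outside that subset are irrelevant.\<close>
definition herglotz_nevanlinna :: "(complex ^ 'n \<Rightarrow> complex) \<Rightarrow> bool" where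
  "herglotz_nevanlinna h \<longleftrightarrow>
     holomorphic_sv h upper_poly \<and> (\<forall>z\<in>upper_poly. Im (h z) \<ge> 0)"

text \<open>The principal argument takes values in the interval from \<open>-pi\<close> (excluded) to \<open>pi\<close>, so it is
  negative on the lower half-plane.\<close>
definition stoltz_upper :: "real \<Rightarrow> complex set" where
  "stoltz_upper \<theta> = {w. Im w > 0 \<and> \<theta> \<le> Arg w \<and> Arg w \<le> pi - \<theta>}"

definition stoltz_lower :: "real \<Rightarrow> complex set" where
  "stoltz_lower \<theta> = {w. Im w < 0 \<and> - (pi - \<theta>) \<le> Arg w \<and> Arg w \<le> - \<theta>}"

definition nontangential_upper :: "(complex \<Rightarrow> complex) \<Rightarrow> complex \<Rightarrow> bool" where
  "nontangential_upper g l \<longleftrightarrow>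
     (\<forall>\<theta>. 0 < \<theta> \<and> \<theta> \<le> pi / 2 \<longrightarrow> (g \<longlongrightarrow> l) (inf at_infinity (principal (stoltz_upper \<theta>))))"

definition nontangential_lower :: "(complex \<Rightarrow> complex) \<Rightarrow> complex \<Rightarrow> bool" where
  "nontangential_lower g l \<longleftrightarrow>
     (\<forall>\<theta>. 0 < \<theta> \<and> \<theta> \<le> pi / 2 \<longrightarrow> (g \<longlongrightarrow> l) (inf at_infinity (principal (stoltz_lower \<theta>))))"

definition upd_comp :: "complex ^ 'n \<Rightarrow> 'n \<Rightarrow> complex \<Rightarrow> complex ^ 'n" where
  "upd_comp z j w = (\<chi> k. if k = j then w else z $ k)"

definition Psi :: "'n set \<Rightarrow> complex ^ 'n \<Rightarrow> complex ^ 'n \<Rightarrow> complex ^ 'n" where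
  "Psi B z w = (\<chi> j. if j \<in> B then cnj (w $ j) else z $ j)"

definition variable_non_dependence :: "(complex ^ 'n \<Rightarrow> complex) \<Rightarrow> bool" where
  "variable_non_dependence f \<longleftrightarrow>
     (\<forall>z\<in>off_real. \<forall>w\<in>off_real.
        {j. Im (z $ j) < 0} = {j. Im (w $ j) < 0} \<longrightarrow> {j. Im (z $ j) < 0} \<noteq> {} \<longrightarrow>
        (\<forall>j. Im (z $ j) < 0 \<longrightarrow> z $ j = w $ j) \<longrightarrow> f z = f w)"

definition kernel_K :: "complex ^ 'n \<Rightarrow> real ^ 'n \<Rightarrow> complex" where
  "kernel_K z t =
     \<i> * (2 / (2 * \<i>) ^ CARD('n) *
            (\<Prod>l\<in>UNIV. 1 / (of_real (t $ l) - z $ l) - 1 / (of_real (t $ l) + \<i>))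
          - 1 / (2 * \<i>) ^ CARD('n) *
            (\<Prod>l\<in>UNIV. 1 / (of_real (t $ l) - \<i>) - 1 / (of_real (t $ l) + \<i>)))"

text \<open>The index \<open>r\<close> is one of \<open>-1, 0, 1\<close>; the last branch is only used for \<open>r = 1\<close>.\<close>
definition nev_N :: "int \<Rightarrow> complex \<Rightarrow> real \<Rightarrow> complex" where
  "nev_N r z t =
     (if r = -1 then 1 / (2 * \<i>) * (1 / (of_real t - z) - 1 / (of_real t - \<i>))
      else if r = 0 then 1 / (2 * \<i>) * (1 / (of_real t - \<i>) - 1 / (of_real t + \<i>))
      else 1 / (2 * \<i>) * (1 / (of_real t + \<i>) - 1 / (of_real t - cnj z)))"

definition mixed_signs :: "('n \<Rightarrow> int) set" where
  "mixed_signs = {\<rho>. (\<forall>j. \<rho> j \<in> {-1, 0, 1}) \<and> (\<exists>j. \<rho> j = -1) \<and> (\<exists>j. \<rho> j = 1)}"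

definition growth_condition :: "(real ^ 'n) measure \<Rightarrow> bool" where
  "growth_condition \<mu> \<longleftrightarrow> (\<integral>\<^sup>+ t. ennreal (\<Prod>l\<in>UNIV. 1 / (1 + (t $ l)\<^sup>2)) \<partial>\<mu>) < \<infinity>"

definition nevanlinna_condition :: "(real ^ 'n) measure \<Rightarrow> bool" where
  "nevanlinna_condition \<mu> \<longleftrightarrow>
     (\<forall>z\<in>upper_poly. (\<Sum>\<rho>\<in>mixed_signs. \<integral>t. (\<Prod>j\<in>UNIV. nev_N (\<rho> j) (z $ j) (t $ j)) \<partial>\<mu>) = 0)"

text \<open>Under the growth condition all integrands here and in the previous condition are
  integrable (for off-real \<open>z\<close>), so the Bochner integral has its usual meaning.\<close>
definition nev_formula ::
  "real \<Rightarrow> real ^ 'n \<Rightarrow> (real ^ 'n) measure \<Rightarrow> complex ^ 'n \<Rightarrow> complex" where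
  "nev_formula a b \<mu> z =
     of_real a + (\<Sum>j\<in>UNIV. of_real (b $ j) * z $ j)
       + 1 / of_real pi ^ CARD('n) * (\<integral>t. kernel_K z t \<partial>\<mu>)"

text \<open>\<open>(a, b, \<mu>)\<close> is the representing triple of \<open>h\<close>.\<close>
definition has_triple ::
  "(complex ^ 'n \<Rightarrow> complex) \<Rightarrow> real \<Rightarrow> real ^ 'n \<Rightarrow> (real ^ 'n) measure \<Rightarrow> bool" where
  "has_triple h a b \<mu> \<longleftrightarrow>
     (\<forall>j. 0 \<le> b $ j) \<and> sets \<mu> = sets borel \<and>
     growth_condition \<mu> \<and> nevanlinna_condition \<mu> \<and>
     (\<forall>z\<in>upper_poly. h z = nev_formula a b \<mu> z)"

text \<open>\<open>F\<close> is the symmetric extension of \<open>h\<close>: it is given off the real axis by the formula for the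
  triple of \<open>h\<close>. A relation is used because existence and uniqueness of the triple of a
  Herglotz-Nevanlinna function, which make \<open>F\<close> on \<open>off_real\<close> a function of \<open>h\<close>, are theorems.\<close>
definition is_symmetric_extension ::
  "(complex ^ 'n \<Rightarrow> complex) \<Rightarrow> (complex ^ 'n \<Rightarrow> complex) \<Rightarrow> bool" where
  "is_symmetric_extension h F \<longleftrightarrow>
     (\<exists>a b \<mu>. has_triple h a b \<mu> \<and> (\<forall>z\<in>off_real. F z = nev_formula a b \<mu> z))"

end

theory Submission
  imports Defs "HOL-Complex_Analysis.Complex_Analysis" "HOL-Probability.Probability"
begin

text \<open>In disc coordinates the integral representation becomes the Koranyi--Pukanszky formula
  \<open>f = a + \<i> \<integral> (2 \<Prod> 1 / (1 - w\<^sub>l * cnj e\<^sub>l) - 1) d\<nu>\<close> with a finite measure \<open>\<nu>\<close> on the torus.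
  The growth hypothesis says that the linear coefficients vanish, or equivalently that \<open>\<nu>\<close> does not
  charge the points at infinity \<open>e\<^sub>j = 1\<close>.

  For a symmetric extension, reflecting a variable replaces the kernel \<open>c\<close> by \<open>1 - cnj c\<close>; so the
  symmetry formula is the expansion of \<open>\<Prod> c\<^sub>j = \<Prod> (1 - (1 - c\<^sub>j))\<close>. The Nevanlinna condition, polarized
  in \<open>z\<close> and its conjugate, gives the non-dependence property.

  Conversely, \<open>f\<close> restricted to the upper poly-half-plane has a representing measure, obtained as a weak
  limit of boundary densities. Both \<open>f\<close> and the symmetric extension of its restriction satisfy (ii) and
  (iii), and these two conditions determine a function from its values on the upper poly-half-plane.\<close>

section \<open>Weak compactness of measures on the torus\<close>

text \<open>The sum over mixed signs is a product of Poisson kernels \<open>c + cnj c - 1\<close>,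
  minus twice the real part of the product of the Cauchy kernels \<open>c\<close>, plus 1. For the
  measure built from f the condition therefore only compares two representations by one measure:
  Poisson products yield Im f(z), Cauchy products yield (f(z) - cnj f(i1)) / (2i). This is why all
  kernels are treated together, as functionals that evaluate boundary values of holomorphic
  functions at a point, and why a kernel and its conjugate may evaluate at different points.

  Two obstacles shape the argument. The condition on the measure ties each z to its own conjugate,
  whereas non-dependence concerns independent points of the two half-planes. And a weak limit exists
  on the compact torus only, where mass may collect on coordinates that correspond to t = infinity
  and are invisible to a measure on R^n. In the formula such mass would look like a linear term; for
  n >= 2 a term b z_j with b > 0 violates both (ii) and (iii).\<close>

definition binary_digit :: "nat \<Rightarrow> real \<Rightarrow> real" where
  "binary_digit k u = of_int (\<lfloor>2 ^ Suc k * u\<rfloor> - 2 * \<lfloor>2 ^ k * u\<rfloor>)"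

lemma binary_digit_range: "binary_digit k u \<in> {0, 1}"
proof -
  have "2 * \<lfloor>2 ^ k * u\<rfloor> \<le> \<lfloor>2 ^ Suc k * u\<rfloor>" "\<lfloor>2 ^ Suc k * u\<rfloor> < 2 * \<lfloor>2 ^ k * u\<rfloor> + 2"
    unfolding power_Suc mult.assoc by linarith+
  then have "\<lfloor>2 ^ Suc k * u\<rfloor> - 2 * \<lfloor>2 ^ k * u\<rfloor> \<in> {0, 1}"
    by auto
  then show ?thesis
    unfolding binary_digit_def by auto
qed

lemma binary_digit_measurable [measurable]: "binary_digit k \<in> borel_measurable borel"
  unfolding binary_digit_def by measurable

text \<open>The partial sums telescope to
  \<open>\<lfloor>2 ^ K * u\<rfloor> / 2 ^ K - \<lfloor>u\<rfloor>\<close>, whose first term is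
  within \<open>1 / 2 ^ K\<close> of \<open>u\<close>. Because digits are differences of floors,
  negative \<open>u\<close> is covered as well.\<close>

lemma binary_digits_sums: "(\<lambda>k. binary_digit k u / 2 ^ Suc k) sums frac u"
proof -
  have part: "(\<Sum>k<K. binary_digit k u / 2 ^ Suc k) = of_int \<lfloor>2 ^ K * u\<rfloor> / 2 ^ K - of_int \<lfloor>u\<rfloor>" for K
    by (induction K) (auto simp: binary_digit_def field_simps)
  have inv0: "(\<lambda>K. 1 / 2 ^ K :: real) \<longlonglongrightarrow> 0"
    using LIMSEQ_inverse_realpow_zero[of 2] by (simp add: inverse_eq_divide)
  have "(\<lambda>K. of_int \<lfloor>2 ^ K * u\<rfloor> / 2 ^ K :: real) \<longlonglongrightarrow> u"
  proof (rule tendsto_sandwich)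
    show "(\<lambda>K. u - 1 / 2 ^ K) \<longlonglongrightarrow> u"
      using tendsto_diff[OF tendsto_const[of u] inv0] by simp
    show "\<forall>\<^sub>F K in sequentially. u - 1 / 2 ^ K \<le> of_int \<lfloor>2 ^ K * u\<rfloor> / 2 ^ K"
    proof (rule always_eventually, rule allI)
      fix K :: nat
      have "(2 ^ K * u - 1) / 2 ^ K \<le> of_int \<lfloor>2 ^ K * u\<rfloor> / 2 ^ K"
        by (rule divide_right_mono) (linarith, simp)
      then show "u - 1 / 2 ^ K \<le> of_int \<lfloor>2 ^ K * u\<rfloor> / 2 ^ K"
        by (simp add: diff_divide_distrib)
    qed
    show "\<forall>\<^sub>F K in sequentially. of_int \<lfloor>2 ^ K * u\<rfloor> / 2 ^ K \<le> u"
    proof (rule always_eventually, rule allI)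
      fix K :: nat
      have "of_int \<lfloor>2 ^ K * u\<rfloor> \<le> 2 ^ K * u" by linarith
      then show "of_int \<lfloor>2 ^ K * u\<rfloor> / 2 ^ K \<le> u"
        by (simp add: field_simps)
    qed
  qed auto
  then show ?thesis
    unfolding sums_def part frac_def by (intro tendsto_intros)
qed

text \<open>For digits 0 and 1 this is a point of the Cantor set: its ternary digits are 0 and 2.
  The missing digit 1 leaves the gaps that make every digit a continuous function of the
  point.\<close>

definition ternary_sum :: "(nat \<Rightarrow> real) \<Rightarrow> real" where
  "ternary_sum d = (\<Sum>m. 2 * d m / 3 ^ Suc m)"

lemma ternary_summable:
  fixes d :: "nat \<Rightarrow> real"
  assumes "\<And>m. d m \<in> {0, 1}"
  shows "summable (\<lambda>m. 2 * d m / 3 ^ Suc m)"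
proof (rule summable_comparison_test')
  show "summable (\<lambda>m. (1/3::real) ^ m)"
    by (rule summable_geometric) simp
  show "norm (2 * d m / 3 ^ Suc m) \<le> (1/3) ^ m" for m
    using assms[of m] by (auto simp: power_one_over field_simps)
qed

lemma ternary_sum_step:
  assumes "\<And>m. d m \<in> {0, 1}"
  shows "ternary_sum d = 2 * d 0 / 3 + ternary_sum (\<lambda>m. d (Suc m)) / 3"
proof -
  have "ternary_sum d = 2 * d 0 / 3 + (\<Sum>m. 2 * d (Suc m) / 3 ^ Suc m / 3)"
    unfolding ternary_sum_def using suminf_split_head[OF ternary_summable[of d]] assms
    by (simp add: field_simps)
  also have "(\<Sum>m. 2 * d (Suc m) / 3 ^ Suc m / 3) = ternary_sum (\<lambda>m. d (Suc m)) / 3"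
    unfolding ternary_sum_def using assms by (rule suminf_divide[OF ternary_summable])
  finally show ?thesis .
qed

lemma ternary_sum_range:
  assumes "\<And>m. d m \<in> {0, 1}"
  shows "ternary_sum d \<in> {0..1}"
proof -
  have "0 \<le> 2 * d m / 3 ^ Suc m" for m
    using assms[of m] by auto
  then have "ternary_sum d \<ge> 0"
    unfolding ternary_sum_def using ternary_summable[OF assms] by (intro suminf_nonneg)
  moreover have "ternary_sum d \<le> (\<Sum>m. 2 / 3 * (1 / 3) ^ m)"
    unfolding ternary_sum_def
  proof (intro suminf_le ternary_summable assms)
    show "2 * d m / 3 ^ Suc m \<le> 2 / 3 * (1 / 3) ^ m" for m
      using assms[of m] by (auto simp: power_one_over field_simps)
    show "summable (\<lambda>m. 2 / 3 * (1 / 3 :: real) ^ m)"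
      by (intro summable_mult summable_geometric) simp
  qed
  moreover have "(\<Sum>m. 2 / 3 * (1 / 3 :: real) ^ m) = 1"
    by (subst suminf_mult) (auto simp: suminf_geometric)
  ultimately show ?thesis by auto
qed

text \<open>Multiplication by \<open>3 ^ k\<close> shifts the ternary digits. The integer part that
  splits off is even, because all digits are 0 or 2, and \<open>cos (pi * t)\<close> has period
  2.\<close>

lemma cos_ternary_sum_shift:
  assumes "\<And>m. d m \<in> {0, 1}"
  shows "cos (pi * (3 ^ k * ternary_sum d)) = cos (pi * ternary_sum (\<lambda>m. d (m + k)))"
  using assms
proof (induction k arbitrary: d)
  case (Suc k)
  obtain j :: nat where j: "d 0 = of_nat j"
    using Suc.prems[of 0] by (metis insertE of_nat_0 of_nat_1 singletonD)
  have cos_2pi_nat: "cos (2 * pi * of_nat n) = 1" and sin_2pi_nat: "sin (2 * pi * of_nat n) = 0" for n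
    using cos_2npi[of n] sin_2npi[of n] by (simp_all only: mult.commute mult.left_commute)
  have "pi * (3 ^ Suc k * ternary_sum d)
      = pi * (3 ^ k * ternary_sum (\<lambda>m. d (Suc m))) + 2 * pi * of_nat (3 ^ k * j)"
    by (subst ternary_sum_step[OF Suc.prems]) (simp add: j algebra_simps)
  then have "cos (pi * (3 ^ Suc k * ternary_sum d)) = cos (pi * (3 ^ k * ternary_sum (\<lambda>m. d (Suc m))))"
    by (simp only: cos_add cos_2pi_nat sin_2pi_nat mult_1_right mult_zero_right diff_zero)
  also have "\<dots> = cos (pi * ternary_sum (\<lambda>m. d (Suc (m + k))))"
    using Suc.IH[of "\<lambda>m. d (Suc m)"] Suc.prems by simp
  finally show ?case by simp
qed simp

text \<open>A clipped cosine in place of Schoenberg's piecewise linear function. On [0, 1/3] the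
  cosine is at least 1/2 and the value is 0; on [2/3, 1] it is at most -1/2 and the value is 1. So
  it reads off the leading ternary digit.\<close>

definition ternary_readout :: "real \<Rightarrow> real" where
  "ternary_readout t = max 0 (min 1 (1 / 2 - cos (pi * t)))"

lemma ternary_readout_bounds: "0 \<le> ternary_readout t" "ternary_readout t \<le> 1"
  unfolding ternary_readout_def by auto

lemma ternary_readout_sum:
  assumes d: "\<And>m. d m \<in> {0, 1}"
  shows "ternary_readout (3 ^ k * ternary_sum d) = d k"
proof -
  define t where "t = ternary_sum (\<lambda>m. d (m + k))"
  have r: "ternary_sum (\<lambda>m. d (Suc m + k)) \<in> {0..1}"
    using d by (intro ternary_sum_range)
  have t: "t = 2 * d k / 3 + ternary_sum (\<lambda>m. d (Suc m + k)) / 3"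
    unfolding t_def by (subst ternary_sum_step) (use d in auto)
  have eq: "ternary_readout (3 ^ k * ternary_sum d) = max 0 (min 1 (1 / 2 - cos (pi * t)))"
    unfolding ternary_readout_def cos_ternary_sum_shift[OF d] t_def ..
  consider "d k = 0" | "d k = 1" using d[of k] by auto
  then show ?thesis
  proof cases
    case 1
    then have "0 \<le> t" "t \<le> 1/3" using t r by auto
    then have "cos (pi / 3) \<le> cos (pi * t)"
      by (intro cos_monotone_0_pi_le) auto
    then show ?thesis using 1 eq by (simp add: cos_60)
  next
    case 2
    then have "2/3 \<le> t" "t \<le> 1" using t r by auto
    then have "cos (pi * t) \<le> cos (pi * (2/3))"
      by (intro cos_monotone_0_pi_le) auto
    moreover have "cos (pi * (2/3)) = - (1/2)"
    proof -
      have "pi * (2/3) = 2 * pi / 3" by simp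
      then show ?thesis using cos_120 by (simp only:)
    qed
    ultimately show ?thesis using 2 eq by simp
  qed
qed

text \<open>Schoenberg's space-filling curve: every \<open>n\<close>-th ternary digit of the parameter gives the
  binary digits of one coordinate. It comes with a measurable section, which reduces
  compactness for measures on the torus to Helly's theorem on the line.\<close>

theorem torus_weak_compactness:
  fixes P :: "nat \<Rightarrow> ('i::finite \<Rightarrow> real) measure"
  assumes P: "\<And>k. prob_space (P k)" "\<And>k. sets (P k) = sets borel"
  obtains r Q where "strict_mono (r :: nat \<Rightarrow> nat)" "prob_space Q" "sets Q = sets borel"
    "\<And>g :: ('i \<Rightarrow> real) \<Rightarrow> complex. continuous_on UNIV g \<Longrightarrow> bounded (range g) \<Longrightarrow>
       (\<And>x. g (\<lambda>i. frac (x i)) = g x) \<Longrightarrow>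
       (\<lambda>k. integral\<^sup>L (P (r k)) g) \<longlonglongrightarrow> integral\<^sup>L Q g"
proof -
  define N where "N = CARD('i)"
  have N: "N > 0" unfolding N_def by simp
  obtain idx :: "'i \<Rightarrow> nat" where "bij_betw idx UNIV {0..<N}"
    unfolding N_def using ex_bij_betw_finite_nat[of "UNIV :: 'i set"] by auto
  then have idx: "inj idx" "\<And>i. idx i < N"
    by (auto simp: bij_betw_def)
  define d where "d x m = binary_digit (m div N) (x (inv idx (m mod N)))" for x :: "'i \<Rightarrow> real" and m
  have d: "d x m \<in> {0, 1}" for x m
    unfolding d_def by (rule binary_digit_range)
  have d_idx: "d x (k * N + idx i) = binary_digit k (x i)" for x k i
    unfolding d_def using idx N by (simp add: div_mult_self3)
  define s where "s x = ternary_sum (d x)" for x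
  define p where "p y i = (\<Sum>k. ternary_readout (3 ^ (k * N + idx i) * y) / 2 ^ Suc k)" for y i
  have readout: "ternary_readout (3 ^ m * ternary_sum (d x)) = d x m" for x m
    by (rule ternary_readout_sum) (rule d)
  \<comment> \<open>\<open>p\<close> is continuous, while \<open>s\<close> is only measurable. That
    is enough: \<open>s\<close> pushes measures to the line, \<open>p\<close> pulls continuous test
    functions back, and modulo 1 the composition is the identity.\<close>
  have ps: "p (s x) = (\<lambda>i. frac (x i))" for x
    unfolding p_def s_def readout d_idx
    by (rule ext) (rule sums_unique[OF binary_digits_sums, symmetric])
  have coord [measurable]: "(\<lambda>x :: 'i \<Rightarrow> real. x i) \<in> borel_measurable borel" for i
    by (intro borel_measurable_continuous_onI continuous_on_product_coordinates)
  have s_meas [measurable]: "s \<in> borel_measurable borel"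
    unfolding s_def ternary_sum_def d_def by measurable
  have s_meas' [measurable]: "s \<in> borel_measurable (P k)" for k
    using s_meas measurable_cong_sets[OF P(2)[of k] refl] by blast
  have p_cont: "continuous_on UNIV p"
  proof (rule continuous_on_coordinatewise_then_product)
    fix i
    have "uniform_limit UNIV (\<lambda>n y. \<Sum>k<n. ternary_readout (3 ^ (k * N + idx i) * y) / 2 ^ Suc k)
        (\<lambda>y. \<Sum>k. ternary_readout (3 ^ (k * N + idx i) * y) / 2 ^ Suc k) sequentially"
    proof (rule Weierstrass_m_test)
      show "summable (\<lambda>k. (1/2::real) ^ k)"
        by (rule summable_geometric) simp
      fix k :: nat and y :: real
      have "ternary_readout (3 ^ (k * N + idx i) * y) / 2 ^ Suc k \<le> 1 / 2 ^ Suc k"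
        using ternary_readout_bounds by (intro divide_right_mono) auto
      then show "norm (ternary_readout (3 ^ (k * N + idx i) * y) / 2 ^ Suc k) \<le> (1/2) ^ k"
        using ternary_readout_bounds(1) by (simp add: power_one_over field_simps)
    qed
    moreover have "continuous_on UNIV (\<lambda>y. \<Sum>k<n. ternary_readout (3 ^ (k * N + idx i) * y) / 2 ^ Suc k)" for n
      unfolding ternary_readout_def by (intro continuous_intros) auto
    ultimately show "continuous_on UNIV (\<lambda>y. p y i)"
      unfolding p_def by (intro uniform_limit_theorem) auto
  qed
  have p_meas [measurable]: "p \<in> borel_measurable borel"
    by (rule borel_measurable_continuous_onI[OF p_cont])
  define L where "L k = distr (P k) borel s" for k
  have L: "real_distribution (L k)" for k
    unfolding L_def using prob_space.real_distribution_distr[OF P(1) s_meas'] .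
  have "tight L"
    unfolding tight_def
  proof (intro conjI allI impI exI)
    show "real_distribution (L k)" for k by (rule L)
    show "(-1::real) < 1" by simp
    fix \<epsilon> :: real and k assume "\<epsilon> > 0"
    \<comment> \<open>All push-forwards live on [0, 1], so tightness is immediate; the left end -1
      makes the half-open interval contain 0.\<close>
    have "s x \<in> {-1<..1}" for x
      using ternary_sum_range[of "d x"] d unfolding s_def by auto
    then have "measure (L k) {-1<..1} = measure (P k) (space (P k))"
      unfolding L_def by (subst measure_distr) (auto intro!: arg_cong[where f="measure (P k)"])
    then show "1 - \<epsilon> < measure (L k) {-1<..1}"
      using prob_space.prob_space[OF P(1)] \<open>\<epsilon> > 0\<close> by simp
  qed
  then obtain r M where r: "strict_mono r" and M: "real_distribution M"
    and conv: "weak_conv_m (L \<circ> id \<circ> r) M"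
    using tight_imp_convergent_subsubsequence[of L id] by (auto simp: strict_mono_def)
  interpret M: real_distribution M by (rule M)
  define Q where "Q = distr M borel p"
  have pM [measurable]: "p \<in> borel_measurable M"
    using p_meas measurable_cong_sets[OF M.events_eq_borel refl] by blast
  show thesis
  proof
    show "strict_mono r" by (rule r)
    show "prob_space Q" unfolding Q_def by (rule M.prob_space_distr) simp
    show "sets Q = sets borel" unfolding Q_def by simp
    fix g :: "('i \<Rightarrow> real) \<Rightarrow> complex"
    assume g: "continuous_on UNIV g" and bdd: "bounded (range g)"
      and per: "\<And>x. g (\<lambda>i. frac (x i)) = g x"
    have [measurable]: "g \<in> borel_measurable borel"
      by (rule borel_measurable_continuous_onI[OF g])
    obtain B where B: "\<And>x. norm (g x) \<le> B"
      using bdd by (auto simp: bounded_iff)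
    have "continuous_on UNIV (\<lambda>y. g (p y))"
      by (rule continuous_on_compose2[OF g p_cont]) auto
    then have "(\<lambda>k. integral\<^sup>L ((L \<circ> id \<circ> r) k) (\<lambda>y. g (p y))) \<longlonglongrightarrow> integral\<^sup>L M (\<lambda>y. g (p y))"
      using L M conv B
      by (intro weak_conv_imp_integral_bdd_continuous_conv) (auto simp: continuous_on_eq_continuous_at comp_def)
    \<comment> \<open>Here periodicity enters: \<open>p (s x)\<close> is the vector of fractional
      parts of \<open>x\<close>, on which \<open>g\<close> takes the same value as at
      \<open>x\<close>.\<close>
    moreover have "integral\<^sup>L (L k) (\<lambda>y. g (p y)) = integral\<^sup>L (P k) g" for k
      unfolding L_def by (subst integral_distr) (auto simp: ps per)
    moreover have "integral\<^sup>L M (\<lambda>y. g (p y)) = integral\<^sup>L Q g"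
      unfolding Q_def by (subst integral_distr) auto
    ultimately show "(\<lambda>k. integral\<^sup>L (P (r k)) g) \<longlonglongrightarrow> integral\<^sup>L Q g"
      by simp
  qed
qed

section \<open>The kernels in disc coordinates\<close>

text \<open>In the disc coordinates \<open>w = (z - \<i>) / (z + \<i>)\<close> and \<open>e = (t - \<i>) / (t + \<i>)\<close> this is the Cauchy
  kernel \<open>1 / (1 - w * cnj e)\<close>. Up to the weight \<open>1 / (1 + t\<^sup>2)\<close>, the functions \<open>N\<close> of the Nevanlinna
  condition are \<open>szego - 1\<close>, \<open>1\<close> and \<open>cnj (szego - 1)\<close>.\<close>

definition szego :: "complex \<Rightarrow> real \<Rightarrow> complex" where
  "szego z t = (z + \<i>) * (of_real t - \<i>) / (2 * \<i> * (of_real t - z))"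

definition cauchy_weight :: "real ^ 'n \<Rightarrow> real" where
  "cauchy_weight t = (\<Prod>l\<in>UNIV. 1 / (1 + (t $ l)\<^sup>2))"

definition weighted :: "(real ^ 'n) measure \<Rightarrow> (real ^ 'n) measure" where
  "weighted \<mu> = density \<mu> (\<lambda>t. ennreal (cauchy_weight t))"

lemma of_real_neq_complex: "Im z \<noteq> 0 \<Longrightarrow> of_real t \<noteq> z"
  by (auto simp: complex_eq_iff)

lemma one_plus_square: "(1 + (of_real t)\<^sup>2 :: complex) = (of_real t - \<i>) * (of_real t + \<i>)"
  by (simp add: algebra_simps power2_eq_square)

lemma real_pm_i_neq: "of_real t - \<i> \<noteq> 0" "of_real t + \<i> \<noteq> 0"
  by (auto simp: complex_eq_iff)

text \<open>Splits off the weight \<open>1 / (1 + t\<^sup>2)\<close> from one factor of the kernel.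
  What remains is bounded in \<open>t\<close> for fixed \<open>z\<close>, so the growth condition
  turns every integral into one of a bounded function against a finite measure.\<close>

lemma kernel_factor:
  assumes "Im z \<noteq> 0"
  shows "1 / (of_real t - z) - 1 / (of_real t + \<i>) = 2 * \<i> * (szego z t / (1 + (of_real t)\<^sup>2))"
  unfolding szego_def one_plus_square
  using of_real_neq_complex[OF assms, of t] real_pm_i_neq[of t]
  by (simp add: divide_simps)

text \<open>The points i and -i have disc coordinates 0 and infinity. Placing a variable at one of
  them switches its kernel to 1 or to 0, which later isolates the factors of chosen
  variables.\<close>

lemma szego_i: "szego \<i> t = 1"
  unfolding szego_def using real_pm_i_neq[of t] by simp

lemma szego_minus_i: "szego (- \<i>) t = 0"
  unfolding szego_def by simp

lemma szego_cnj:
  assumes "Im z \<noteq> 0"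
  shows "szego (cnj z) t = 1 - cnj (szego z t)"
proof -
  have "of_real t \<noteq> cnj z" using assms by (intro of_real_neq_complex) simp
  then show ?thesis
    unfolding szego_def by (simp add: divide_simps) (simp add: algebra_simps)
qed

lemma nev_N_minus_one:
  assumes "Im z \<noteq> 0"
  shows "nev_N (-1) z t = (szego z t - 1) / (1 + (of_real t)\<^sup>2)"
proof -
  have "1 / (of_real t - z) - 1 / (of_real t - \<i>)
      = 2 * \<i> * (szego z t / (1 + (of_real t)\<^sup>2)) - 2 * \<i> * (szego \<i> t / (1 + (of_real t)\<^sup>2))"
    using kernel_factor[OF assms, of t] kernel_factor[of \<i> t] by (simp add: algebra_simps)
  then show ?thesis
    unfolding nev_N_def by (simp add: szego_i diff_divide_distrib right_diff_distrib)
qed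

lemma nev_N_zero: "nev_N 0 z t = 1 / (1 + (of_real t)\<^sup>2)"
  unfolding nev_N_def using kernel_factor[of \<i> t] by (simp add: szego_i)

lemma nev_N_one:
  assumes "Im z \<noteq> 0"
  shows "nev_N 1 z t = cnj (szego z t - 1) / (1 + (of_real t)\<^sup>2)"
proof -
  have "nev_N 1 z t = cnj (nev_N (-1) z t)"
    unfolding nev_N_def by (simp add: right_diff_distrib)
  then show ?thesis
    using nev_N_minus_one[OF assms, of t] by simp
qed

lemma of_real_cauchy_weight:
  "complex_of_real (cauchy_weight t) = (\<Prod>l\<in>UNIV. 1 / (1 + (of_real (t $ l))\<^sup>2))"
  unfolding cauchy_weight_def by simp

lemma kernel_K_szego:
  fixes z :: "complex ^ 'n"
  assumes "z \<in> off_real"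
  shows "kernel_K z t = of_real (cauchy_weight t) * (\<i> * (2 * (\<Prod>l\<in>UNIV. szego (z $ l) (t $ l)) - 1))"
proof -
  have z: "Im (z $ l) \<noteq> 0" for l
    using assms by (auto simp: off_real_def complex_is_Real_iff)
  have 1: "(\<Prod>l\<in>UNIV. 1 / (of_real (t $ l) - z $ l) - 1 / (of_real (t $ l) + \<i>))
      = (2 * \<i>) ^ CARD('n) * of_real (cauchy_weight t) * (\<Prod>l\<in>UNIV. szego (z $ l) (t $ l))"
    unfolding of_real_cauchy_weight
    by (simp only: kernel_factor[OF z] prod.distrib prod_dividef prod_constant prod.neutral_const power_one)
      (simp add: power_mult_distrib)
  have 2: "(\<Prod>l\<in>UNIV. 1 / (of_real (t $ l) - \<i>) - 1 / (of_real (t $ l) + \<i>))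
      = (2 * \<i>) ^ CARD('n) * of_real (cauchy_weight t)"
    unfolding of_real_cauchy_weight
    by (simp only: kernel_factor[of \<i>, simplified] szego_i prod.distrib prod_dividef prod_constant prod.neutral_const power_one)
      (simp add: power_mult_distrib)
  have "(2 * \<i>) ^ CARD('n) \<noteq> 0" by simp
  then show ?thesis
    unfolding kernel_K_def 1 2 by (simp add: algebra_simps)
qed

text \<open>All integrands are polynomials in kernels and their conjugates. This class is closed
  under these operations and integrable for every finite Borel measure, which settles all
  integrability questions at once.\<close>

definition bounded_borel :: "('a::topological_space \<Rightarrow> complex) \<Rightarrow> bool" where
  "bounded_borel g \<longleftrightarrow> g \<in> borel_measurable borel \<and> (\<exists>B. \<forall>t. norm (g t) \<le> B)"

lemma bounded_borel_const [intro]: "bounded_borel (\<lambda>t. c)"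
  unfolding bounded_borel_def by auto

lemma bounded_borel_add [intro]:
  assumes "bounded_borel f" "bounded_borel g"
  shows "bounded_borel (\<lambda>t. f t + g t)"
proof -
  from assms obtain A B where "\<And>t. norm (f t) \<le> A" "\<And>t. norm (g t) \<le> B"
    unfolding bounded_borel_def by blast
  then have "norm (f t + g t) \<le> A + B" for t
    by (intro norm_triangle_mono)
  moreover have "(\<lambda>t. f t + g t) \<in> borel_measurable borel"
    using assms by (simp add: bounded_borel_def borel_measurable_add)
  ultimately show ?thesis unfolding bounded_borel_def by blast
qed

lemma bounded_borel_mult [intro]:
  assumes "bounded_borel f" "bounded_borel g"
  shows "bounded_borel (\<lambda>t. f t * g t)"
proof -
  from assms obtain A B where "\<And>t. norm (f t) \<le> A" "\<And>t. norm (g t) \<le> B"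
    unfolding bounded_borel_def by blast
  then have "norm (f t * g t) \<le> A * B" for t
    unfolding norm_mult by (intro mult_mono) (auto intro: order_trans[OF norm_ge_zero])
  moreover have "(\<lambda>t. f t * g t) \<in> borel_measurable borel"
    using assms by (simp add: bounded_borel_def borel_measurable_times)
  ultimately show ?thesis unfolding bounded_borel_def by blast
qed

lemma bounded_borel_diff [intro]:
  assumes "bounded_borel f" "bounded_borel g"
  shows "bounded_borel (\<lambda>t. f t - g t)"
  using bounded_borel_add[OF assms(1) bounded_borel_mult[OF bounded_borel_const[of "-1"] assms(2)]]
  by simp

lemma bounded_borel_cnj [intro]:
  assumes "bounded_borel f"
  shows "bounded_borel (\<lambda>t. cnj (f t))"
proof -
  have "cnj \<in> borel_measurable borel"
    by (intro borel_measurable_continuous_onI continuous_intros)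
  then show ?thesis
    using assms measurable_compose[of f borel borel cnj borel] unfolding bounded_borel_def by auto
qed

lemma bounded_borel_prod [intro]:
  assumes "\<And>l. l \<in> S \<Longrightarrow> bounded_borel (f l)"
  shows "bounded_borel (\<lambda>t. \<Prod>l\<in>S. f l t)"
  using assms by (induction S rule: infinite_finite_induct) auto

lemma bounded_borel_integrable:
  assumes "finite_measure M" "sets M = sets borel" "bounded_borel g"
  shows "integrable M g"
proof -
  interpret finite_measure M by fact
  obtain B where "\<And>t. norm (g t) \<le> B" "g \<in> borel_measurable borel"
    using assms(3) unfolding bounded_borel_def by blast
  then show ?thesis
    using measurable_cong_sets[OF assms(2) refl]
    by (intro integrable_const_bound[of _ B]) auto
qed

lemma norm_linear_ratio_le:
  assumes "Im z \<noteq> 0"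
  shows "norm ((of_real t - a) / (of_real t - z)) \<le> 1 + norm (z - a) / \<bar>Im z\<bar>"
proof -
  have ne: "of_real t - z \<noteq> 0" using of_real_neq_complex[OF assms] by simp
  have im: "\<bar>Im z\<bar> \<le> norm (of_real t - z)"
    using abs_Im_le_cmod[of "of_real t - z"] by simp
  have "(of_real t - a) / (of_real t - z) = 1 + (z - a) / (of_real t - z)"
    using ne by (simp add: field_simps)
  then have "norm ((of_real t - a) / (of_real t - z)) \<le> 1 + norm (z - a) / norm (of_real t - z)"
    by (metis norm_divide norm_one norm_triangle_ineq)
  also have "\<dots> \<le> 1 + norm (z - a) / \<bar>Im z\<bar>"
    using im assms ne by (intro add_left_mono divide_left_mono) auto
  finally show ?thesis .
qed

lemma norm_szego_le:
  assumes "Im z \<noteq> 0"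
  shows "norm (szego z t) \<le> norm (z + \<i>) / 2 * (1 + norm (z - \<i>) / \<bar>Im z\<bar>)"
proof -
  have "szego z t = (z + \<i>) / (2 * \<i>) * ((of_real t - \<i>) / (of_real t - z))"
    unfolding szego_def by (simp only: times_divide_times_eq)
  then have "norm (szego z t) = norm (z + \<i>) / 2 * norm ((of_real t - \<i>) / (of_real t - z))"
    by (simp only: norm_mult norm_divide) simp
  then show ?thesis
    using norm_linear_ratio_le[OF assms, of t \<i>] by (simp add: mult_left_mono)
qed

lemma bounded_borel_szego [intro]:
  fixes j :: "'n::finite"
  assumes "Im z \<noteq> 0"
  shows "bounded_borel (\<lambda>t. szego z (t $ j))"
proof -
  have "(\<lambda>t. t $ j) \<in> borel_measurable (borel :: (real ^ 'n) measure)"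
    by (intro borel_measurable_continuous_onI continuous_intros)
  then have "(\<lambda>t. szego z (t $ j)) \<in> borel_measurable (borel :: (real ^ 'n) measure)"
    unfolding szego_def by measurable
  then show ?thesis
    using norm_szego_le[OF assms] unfolding bounded_borel_def by blast
qed

lemma cauchy_weight_nonneg: "0 \<le> cauchy_weight t"
  unfolding cauchy_weight_def by (intro prod_nonneg) auto

lemma cauchy_weight_measurable [measurable]: "cauchy_weight \<in> borel_measurable borel"
proof -
  have [measurable]: "(\<lambda>t. t $ j) \<in> borel_measurable (borel :: (real ^ 'n) measure)" for j
    by (intro borel_measurable_continuous_onI continuous_intros)
  show ?thesis unfolding cauchy_weight_def by measurable
qed

lemma sets_weighted [simp]: "sets (weighted \<mu>) = sets \<mu>"
  unfolding weighted_def by simp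

lemma finite_measure_weighted:
  assumes "sets \<mu> = sets borel" "growth_condition \<mu>"
  shows "finite_measure (weighted \<mu>)"
proof
  have "(\<lambda>t. ennreal (cauchy_weight t)) \<in> borel_measurable \<mu>"
    using measurable_compose[OF cauchy_weight_measurable measurable_ennreal]
      measurable_cong_sets[OF assms(1) refl] by blast
  then have "emeasure (weighted \<mu>) (space (weighted \<mu>)) = (\<integral>\<^sup>+ t. ennreal (cauchy_weight t) \<partial>\<mu>)"
    unfolding weighted_def by (subst emeasure_density) (auto intro!: nn_integral_cong)
  then show "emeasure (weighted \<mu>) (space (weighted \<mu>)) \<noteq> \<infinity>"
    using assms(2) unfolding growth_condition_def cauchy_weight_def by simp
qed

lemma integral_weighted:
  fixes g :: "real ^ 'n \<Rightarrow> complex"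
  assumes "sets \<mu> = sets borel" "g \<in> borel_measurable borel"
  shows "(\<integral>t. of_real (cauchy_weight t) * g t \<partial>\<mu>) = (\<integral>t. g t \<partial>weighted \<mu>)"
proof -
  have "cauchy_weight \<in> borel_measurable \<mu>" "g \<in> borel_measurable \<mu>"
    using measurable_cong_sets[OF assms(1) refl] cauchy_weight_measurable assms(2) by blast+
  then show ?thesis
    unfolding weighted_def
    by (subst integral_density) (auto simp: cauchy_weight_nonneg scaleR_conv_of_real)
qed

lemma off_real_Im: "z \<in> off_real \<longleftrightarrow> (\<forall>j. Im (z $ j) \<noteq> 0)"
  by (auto simp: off_real_def complex_is_Real_iff)

lemma upper_poly_subset_off_real: "upper_poly \<subseteq> off_real"
  unfolding upper_poly_def off_real_Im subset_iff by (auto simp: less_le)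

lemma nev_formula_szego:
  fixes z :: "complex ^ 'n"
  assumes "sets \<mu> = sets borel" "growth_condition \<mu>" "z \<in> off_real"
  shows "nev_formula a b \<mu> z = of_real a + (\<Sum>j\<in>UNIV. of_real (b $ j) * z $ j)
    + \<i> / of_real pi ^ CARD('n) * (2 * (\<integral>t. (\<Prod>l\<in>UNIV. szego (z $ l) (t $ l)) \<partial>weighted \<mu>)
        - of_real (measure (weighted \<mu>) UNIV))"
proof -
  interpret finite_measure "weighted \<mu>" using assms by (intro finite_measure_weighted)
  have z: "Im (z $ l) \<noteq> 0" for l using assms(3) by (simp add: off_real_Im)
  have bb: "bounded_borel (\<lambda>t. \<Prod>l\<in>UNIV. szego (z $ l) (t $ l))"
    using z by (intro bounded_borel_prod bounded_borel_szego)
  have sp: "space (weighted \<mu>) = UNIV"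
    using sets_eq_imp_space_eq[of "weighted \<mu>" borel] assms(1) by simp
  have "(\<integral>t. kernel_K z t \<partial>\<mu>)
      = (\<integral>t. \<i> * (2 * (\<Prod>l\<in>UNIV. szego (z $ l) (t $ l)) - 1) \<partial>weighted \<mu>)"
    unfolding kernel_K_szego[OF assms(3)]
    using bb by (intro integral_weighted assms) (auto simp: bounded_borel_def)
  also have "\<dots> = \<i> * (2 * (\<integral>t. (\<Prod>l\<in>UNIV. szego (z $ l) (t $ l)) \<partial>weighted \<mu>)
        - of_real (measure (weighted \<mu>) UNIV))"
    using bounded_borel_integrable[OF finite_measure_axioms _ bb] assms(1) sp
    by (simp add: of_real_def)
  finally show ?thesis unfolding nev_formula_def by simp
qed

text \<open>Expanding \<open>\<Prod>(N\<^sub>-\<^sub>1 + N\<^sub>0 + N\<^sub>1)\<close> and removing the terms without an index of one of the two signs.\<close>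

lemma sum_mixed_signs:
  fixes N :: "int \<Rightarrow> 'n::finite \<Rightarrow> complex"
  shows "(\<Sum>\<rho>\<in>mixed_signs. \<Prod>j\<in>UNIV. N (\<rho> j) j)
    = (\<Prod>j\<in>UNIV. N (-1) j + N 0 j + N 1 j) - (\<Prod>j\<in>UNIV. N (-1) j + N 0 j)
      - (\<Prod>j\<in>UNIV. N 0 j + N 1 j) + (\<Prod>j\<in>UNIV. N 0 j)"
proof -
  define E where "E T = (PiE UNIV (\<lambda>_. T) :: ('n \<Rightarrow> int) set)" for T
  have fin: "finite (E T)" if "finite T" for T
    unfolding E_def using that by (intro finite_PiE) auto
  have expand: "(\<Sum>\<rho>\<in>E T. \<Prod>j\<in>UNIV. N (\<rho> j) j) = (\<Prod>j\<in>UNIV. \<Sum>r\<in>T. N r j)" if "finite T" for T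
    unfolding E_def using that by (subst prod_sum_PiE) auto
  have eqm: "mixed_signs = E {-1, 0, 1} - (E {-1, 0} \<union> E {0, 1})"
    unfolding mixed_signs_def E_def PiE_UNIV_domain by (auto simp: Pi_def) (smt (verit))+
  have sub: "E {-1, 0} \<union> E {0, 1} \<subseteq> E {-1, 0, 1}" and int: "E {-1, 0} \<inter> E {0, 1} = E {0}"
    unfolding E_def PiE_UNIV_domain by (auto simp: Pi_def) (smt (verit))+
  have "(\<Sum>\<rho>\<in>mixed_signs. \<Prod>j\<in>UNIV. N (\<rho> j) j)
      = (\<Sum>\<rho>\<in>E {-1, 0, 1}. \<Prod>j\<in>UNIV. N (\<rho> j) j)
        - ((\<Sum>\<rho>\<in>E {-1, 0}. \<Prod>j\<in>UNIV. N (\<rho> j) j) + (\<Sum>\<rho>\<in>E {0, 1}. \<Prod>j\<in>UNIV. N (\<rho> j) j)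
           - (\<Sum>\<rho>\<in>E {0}. \<Prod>j\<in>UNIV. N (\<rho> j) j))"
    unfolding eqm by (subst sum_diff[OF _ sub]) (auto simp: fin sum_Un int)
  then show ?thesis
    by (simp add: expand algebra_simps)
qed

text \<open>After removal of the weight the three functions are \<open>c - 1\<close>,
  \<open>1\<close> and \<open>cnj c - 1\<close> with \<open>c\<close> the Szego kernel. Summing over
  all three values, over {-1, 0}, over {0, 1} and over {0} gives \<open>c + cnj c - 1\<close>,
  \<open>c\<close>, \<open>cnj c\<close> and \<open>1\<close> in each variable, whence the four
  products.\<close>

lemma nevanlinna_condition_iff:
  fixes \<mu> :: "(real ^ 'n) measure"
  assumes "sets \<mu> = sets borel" "growth_condition \<mu>"
  shows "nevanlinna_condition \<mu> \<longleftrightarrow> (\<forall>z\<in>upper_poly.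
    (\<integral>t. (\<Prod>j\<in>UNIV. szego (z $ j) (t $ j) + cnj (szego (z $ j) (t $ j)) - 1)
       - (\<Prod>j\<in>UNIV. szego (z $ j) (t $ j)) - (\<Prod>j\<in>UNIV. cnj (szego (z $ j) (t $ j))) + 1
     \<partial>weighted \<mu>) = 0)"
  unfolding nevanlinna_condition_def
proof (rule ball_cong[OF refl])
  fix z :: "complex ^ 'n" assume "z \<in> upper_poly"
  then have z: "Im (z $ l) \<noteq> 0" for l
    using upper_poly_subset_off_real by (auto simp: off_real_Im)
  define M where "M r s = (if r = -1 then s - 1 else if r = 0 then 1 else cnj (s - 1))"
    for r :: int and s :: complex
  have M: "(\<Prod>j\<in>UNIV. nev_N (\<rho> j) (z $ j) (t $ j))
      = of_real (cauchy_weight t) * (\<Prod>j\<in>UNIV. M (\<rho> j) (szego (z $ j) (t $ j)))"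
    if "\<rho> \<in> mixed_signs" for \<rho> t
  proof -
    have "nev_N (\<rho> j) (z $ j) (t $ j) = 1 / (1 + (of_real (t $ j))\<^sup>2) * M (\<rho> j) (szego (z $ j) (t $ j))" for j
    proof -
      have "\<rho> j \<in> {-1, 0, 1}" using that unfolding mixed_signs_def by auto
      then show ?thesis
        using nev_N_minus_one[OF z] nev_N_zero nev_N_one[OF z] by (auto simp: M_def)
    qed
    then show ?thesis unfolding of_real_cauchy_weight by (simp add: prod.distrib[symmetric])
  qed
  have bb: "bounded_borel (\<lambda>t. \<Prod>j\<in>UNIV. M (\<rho> j) (szego (z $ j) (t $ j)))" for \<rho>
  proof (rule bounded_borel_prod)
    fix j
    have "bounded_borel (\<lambda>t. szego (z $ j) (t $ j) - 1)"
      using z by (intro bounded_borel_diff bounded_borel_const bounded_borel_szego)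
    from this bounded_borel_cnj[OF this] show "bounded_borel (\<lambda>t. M (\<rho> j) (szego (z $ j) (t $ j)))"
      unfolding M_def by (cases "\<rho> j = -1"; cases "\<rho> j = 0") auto
  qed
  have int: "integrable (weighted \<mu>) (\<lambda>t. \<Prod>j\<in>UNIV. M (\<rho> j) (szego (z $ j) (t $ j)))" for \<rho>
    using assms by (intro bounded_borel_integrable bb finite_measure_weighted) auto
  have "(\<Sum>\<rho>\<in>mixed_signs. \<integral>t. (\<Prod>j\<in>UNIV. nev_N (\<rho> j) (z $ j) (t $ j)) \<partial>\<mu>)
     = (\<Sum>\<rho>\<in>mixed_signs. \<integral>t. (\<Prod>j\<in>UNIV. M (\<rho> j) (szego (z $ j) (t $ j))) \<partial>weighted \<mu>)"
  proof (rule sum.cong[OF refl])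
    fix \<rho> :: "'n \<Rightarrow> int" assume "\<rho> \<in> mixed_signs"
    show "(\<integral>t. (\<Prod>j\<in>UNIV. nev_N (\<rho> j) (z $ j) (t $ j)) \<partial>\<mu>)
        = (\<integral>t. (\<Prod>j\<in>UNIV. M (\<rho> j) (szego (z $ j) (t $ j))) \<partial>weighted \<mu>)"
      unfolding M[OF \<open>\<rho> \<in> mixed_signs\<close>]
      using bb[of \<rho>] by (intro integral_weighted assms) (auto simp: bounded_borel_def)
  qed
  also have "\<dots> = (\<integral>t. (\<Sum>\<rho>\<in>mixed_signs. \<Prod>j\<in>UNIV. M (\<rho> j) (szego (z $ j) (t $ j))) \<partial>weighted \<mu>)"
    using int by simp
  also have "\<dots> = (\<integral>t. (\<Prod>j\<in>UNIV. szego (z $ j) (t $ j) + cnj (szego (z $ j) (t $ j)) - 1)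
       - (\<Prod>j\<in>UNIV. szego (z $ j) (t $ j)) - (\<Prod>j\<in>UNIV. cnj (szego (z $ j) (t $ j))) + 1 \<partial>weighted \<mu>)"
    unfolding sum_mixed_signs[of "\<lambda>r j. M r (szego (z $ j) (t $ j))" for t]
    by (simp add: M_def algebra_simps)
  finally show "((\<Sum>\<rho>\<in>mixed_signs. \<integral>t. (\<Prod>j\<in>UNIV. nev_N (\<rho> j) (z $ j) (t $ j)) \<partial>\<mu>) = 0) \<longleftrightarrow>
    ((\<integral>t. (\<Prod>j\<in>UNIV. szego (z $ j) (t $ j) + cnj (szego (z $ j) (t $ j)) - 1)
       - (\<Prod>j\<in>UNIV. szego (z $ j) (t $ j)) - (\<Prod>j\<in>UNIV. cnj (szego (z $ j) (t $ j))) + 1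
     \<partial>weighted \<mu>) = 0)" by simp
qed

section \<open>Differentiation under the integral; separating holomorphic and antiholomorphic
  parts\<close>

lemma szego_diff_quotient:
  assumes "Im y \<noteq> 0" "Im z \<noteq> 0" "y \<noteq> z"
  shows "(szego y t - szego z t) / (y - z)
    = (of_real t - \<i>) / (of_real t - z) * ((of_real t + \<i>) / (of_real t - y)) / (2 * \<i>)"
proof -
  have ne: "of_real t - y \<noteq> 0" "of_real t - z \<noteq> 0"
    using of_real_neq_complex assms by auto
  have "(y + \<i>) / (of_real t - y) - (z + \<i>) / (of_real t - z)
      = ((y - z) * (of_real t + \<i>)) / ((of_real t - y) * (of_real t - z))"
    unfolding diff_frac_eq[OF ne] by (rule arg_cong2[where f="(/)"]) (simp_all add: algebra_simps)
  moreover have "szego y t - szego z t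
    = (of_real t - \<i>) / (2 * \<i>) * ((y + \<i>) / (of_real t - y) - (z + \<i>) / (of_real t - z))"
  proof -
    have "szego x t = (of_real t - \<i>) / (2 * \<i>) * ((x + \<i>) / (of_real t - x))" for x
      unfolding szego_def times_divide_times_eq by (simp only: mult.commute)
    then show ?thesis by (simp only: right_diff_distrib)
  qed
  ultimately show ?thesis using assms(3) by simp
qed

text \<open>The difference quotient of the kernel is a product of two ratios of linear functions of
  \<open>t\<close>. Each is bounded uniformly in \<open>t\<close> while \<open>y\<close> stays away
  from the real axis, so dominated convergence applies to the quotients directly.\<close>

lemma szego_integral_differentiable:
  fixes j :: "'n::finite"
  assumes fin: "finite_measure M" and sets: "sets M = sets borel" and A: "bounded_borel A"
    and z: "Im z \<noteq> 0"
  shows "(\<lambda>y. \<integral>t. A t * szego y (t $ j) \<partial>M) field_differentiable (at z)"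
proof -
  interpret finite_measure M by fact
  define D where "D y t = (of_real t - \<i>) / (of_real t - z) * ((of_real t + \<i>) / (of_real t - y)) / (2 * \<i>)"
    for y t
  \<comment> \<open>The radius keeps \<open>\<bar>Im y\<bar>\<close> above
    \<open>\<bar>Im z\<bar> / 2\<close>, so one bound serves all \<open>y\<close> in
    \<open>U\<close>.\<close>
  define U where "U = ball z (\<bar>Im z\<bar> / 2)"
  have U: "Im y \<noteq> 0" "\<bar>Im z\<bar> / 2 \<le> \<bar>Im y\<bar>" "norm (y - z) \<le> \<bar>Im z\<bar>" if "y \<in> U" for y
  proof -
    have "norm (y - z) < \<bar>Im z\<bar> / 2"
      using that unfolding U_def by (simp add: dist_norm norm_minus_commute)
    then show "\<bar>Im z\<bar> / 2 \<le> \<bar>Im y\<bar>" "norm (y - z) \<le> \<bar>Im z\<bar>"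
      using abs_Im_le_cmod[of "y - z"] by auto
    then show "Im y \<noteq> 0" using z by auto
  qed
  have zU: "z \<in> U" "open U" unfolding U_def using z by auto
  obtain B where B: "\<And>t. norm (A t) \<le> B" and Am: "A \<in> borel_measurable borel"
    using A unfolding bounded_borel_def by blast
  have B0: "B \<ge> 0" using B[of 0] norm_ge_zero order_trans by blast
  have [measurable]: "A \<in> borel_measurable M" "(\<lambda>t. t $ j) \<in> borel_measurable M"
    unfolding measurable_cong_sets[OF sets refl]
    by (auto intro!: Am borel_measurable_continuous_onI continuous_intros)
  have Dm [measurable]: "(\<lambda>t. A t * D y (t $ j)) \<in> borel_measurable M" for y
    unfolding D_def by measurable
  \<comment> \<open>The product of the bounds for \<open>A\<close>, for the ratio with pole
    \<open>z\<close> and for the ratio with pole \<open>y\<close> in \<open>U\<close>; the final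
    division by 2 comes from the factor \<open>1 / (2 * \<i>)\<close>.\<close>
  define K where "K = B * ((1 + norm (z - \<i>) / \<bar>Im z\<bar>) * (1 + (norm (z + \<i>) + \<bar>Im z\<bar>) / (\<bar>Im z\<bar> / 2)) / 2)"
  have bound: "norm (A t * D y (t $ j)) \<le> K" if "y \<in> U" for y t
  proof -
    have "norm ((of_real (t $ j) + \<i>) / (of_real (t $ j) - y)) \<le> 1 + norm (y + \<i>) / \<bar>Im y\<bar>"
      using norm_linear_ratio_le[OF U(1)[OF that], of "t $ j" "-\<i>"] by simp
    also have "\<dots> \<le> 1 + (norm (z + \<i>) + \<bar>Im z\<bar>) / (\<bar>Im z\<bar> / 2)"
    proof (intro add_left_mono frac_le)
      have "norm ((z + \<i>) + (y - z)) \<le> norm (z + \<i>) + \<bar>Im z\<bar>"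
        by (rule norm_triangle_le) (use U(3)[OF that] in simp)
      then show "norm (y + \<i>) \<le> norm (z + \<i>) + \<bar>Im z\<bar>" by (simp add: algebra_simps)
    qed (use U(2)[OF that] z in auto)
    finally show ?thesis
    proof -
      assume r2: "norm ((of_real (t $ j) + \<i>) / (of_real (t $ j) - y)) \<le> 1 + (norm (z + \<i>) + \<bar>Im z\<bar>) / (\<bar>Im z\<bar> / 2)"
      have "norm (A t * D y (t $ j)) = norm (A t) * (norm ((of_real (t $ j) - \<i>) / (of_real (t $ j) - z))
          * norm ((of_real (t $ j) + \<i>) / (of_real (t $ j) - y)) / 2)"
        unfolding D_def norm_mult norm_divide[of _ "2 * \<i>"] by simp
      also have "\<dots> \<le> K"
        unfolding K_def
        by (intro mult_mono divide_right_mono B norm_linear_ratio_le z r2 B0) auto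
      finally show ?thesis .
    qed
  qed
  have int_szego: "integrable M (\<lambda>t. A t * szego y (t $ j))" if "Im y \<noteq> 0" for y
    using that by (intro bounded_borel_integrable fin sets bounded_borel_mult A bounded_borel_szego)
  have "((\<lambda>y. ((\<integral>t. A t * szego y (t $ j) \<partial>M) - (\<integral>t. A t * szego z (t $ j) \<partial>M)) / (y - z))
      \<longlongrightarrow> (\<integral>t. A t * D z (t $ j) \<partial>M)) (at z within U)"
    unfolding tendsto_at_iff_sequentially
  proof (intro allI impI)
    fix X assume X: "\<forall>i. X i \<in> U - {z}" and lim: "X \<longlonglongrightarrow> z"
    have "((\<integral>t. A t * szego (X i) (t $ j) \<partial>M) - (\<integral>t. A t * szego z (t $ j) \<partial>M)) / (X i - z)
        = (\<integral>t. A t * D (X i) (t $ j) \<partial>M)" for i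
    proof -
      have y: "Im (X i) \<noteq> 0" "X i \<noteq> z" using X U(1) by auto
      have "(\<integral>t. A t * szego (X i) (t $ j) \<partial>M) - (\<integral>t. A t * szego z (t $ j) \<partial>M)
          = (\<integral>t. (X i - z) * (A t * D (X i) (t $ j)) \<partial>M)"
      proof (subst Bochner_Integration.integral_diff[symmetric])
        have "szego (X i) (t $ j) - szego z (t $ j) = (X i - z) * D (X i) (t $ j)" for t :: "real ^ 'n"
          unfolding D_def szego_diff_quotient[OF y(1) z y(2), symmetric] using y(2) by simp
        then show "(\<integral>t. A t * szego (X i) (t $ j) - A t * szego z (t $ j) \<partial>M)
           = (\<integral>t. (X i - z) * (A t * D (X i) (t $ j)) \<partial>M)"
          by (simp only: right_diff_distrib[symmetric] mult.left_commute[of "X i - z"])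
      qed (intro int_szego y z)+
      then show ?thesis using y by simp
    qed
    moreover have "(\<lambda>i. \<integral>t. A t * D (X i) (t $ j) \<partial>M) \<longlonglongrightarrow> (\<integral>t. A t * D z (t $ j) \<partial>M)"
    proof (rule integral_dominated_convergence[where w = "\<lambda>_. K"])
      show "AE t in M. (\<lambda>i. A t * D (X i) (t $ j)) \<longlonglongrightarrow> A t * D z (t $ j)"
        unfolding D_def using of_real_neq_complex[OF z] lim by (intro AE_I2 tendsto_intros) auto
      show "AE t in M. norm (A t * D (X i) (t $ j)) \<le> K" for i
        using bound X by auto
    qed auto
    ultimately show "((\<lambda>y. ((\<integral>t. A t * szego y (t $ j) \<partial>M) - (\<integral>t. A t * szego z (t $ j) \<partial>M)) / (y - z)) \<circ> X)
        \<longlonglongrightarrow> (\<integral>t. A t * D z (t $ j) \<partial>M)"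
      by (simp add: comp_def)
  qed
  then show ?thesis
    unfolding field_differentiable_def has_field_derivative_iff using at_within_open[OF zU] by auto
qed

text \<open>On the upper half-plane \<open>\<alpha>\<close> equals minus an antiholomorphic
  function. With derivatives \<open>D\<close> of \<open>\<alpha>\<close> and \<open>E\<close> of
  \<open>\<beta>\<close>, the directions 1 and i give \<open>D + E = 0\<close> and
  \<open>D - E = 0\<close>. So \<open>\<alpha>\<close> is constant, and its argument can be moved
  independently of that of \<open>\<beta>\<close>.\<close>

lemma holomorphic_antiholomorphic_separation:
  assumes \<alpha>: "\<And>z. Im z > 0 \<Longrightarrow> \<alpha> field_differentiable (at z)"
    and \<beta>: "\<And>z. Im z < 0 \<Longrightarrow> \<beta> field_differentiable (at z)"
    and sum: "\<And>z. Im z > 0 \<Longrightarrow> \<alpha> z + \<beta> (cnj z) = 0"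
    and zv: "Im z > 0" "Im v < 0"
  shows "\<alpha> z + \<beta> v = 0"
proof -
  let ?H = "{z. Im z > 0}"
  have "(\<alpha> has_field_derivative 0) (at x within ?H)" if "x \<in> ?H" for x
  proof -
    have x: "Im x > 0" "Im (cnj x) < 0" using that by auto
    obtain D where D: "(\<alpha> has_field_derivative D) (at x)"
      using \<alpha>[OF x(1)] unfolding field_differentiable_def by blast
    obtain E where E: "(\<beta> has_field_derivative E) (at (cnj x))"
      using \<beta>[OF x(2)] unfolding field_differentiable_def by blast
    have "((\<lambda>y. \<beta> (cnj y)) has_derivative (\<lambda>h. E * cnj h)) (at x)"
      using has_derivative_compose[OF bounded_linear.has_derivative[OF bounded_linear_cnj has_derivative_ident]
         E[unfolded has_field_derivative_def]] .
    from has_derivative_add[OF D[unfolded has_field_derivative_def] this]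
    have d1: "((\<lambda>y. \<alpha> y + \<beta> (cnj y)) has_derivative (\<lambda>h. D * h + E * cnj h)) (at x)" .
    have d2: "((\<lambda>y. \<alpha> y + \<beta> (cnj y)) has_derivative (\<lambda>h. 0)) (at x)"
      by (rule has_derivative_transform_within_open[of "\<lambda>_. 0" _ _ _ ?H])
        (use that sum in \<open>auto simp: open_halfspace_Im_gt\<close>)
    have eq: "(\<lambda>h. D * h + E * cnj h) = (\<lambda>h. 0)"
      by (rule has_derivative_unique[OF d1 d2])
    have "D + E = 0" "D * \<i> - E * \<i> = 0"
      using fun_cong[OF eq, of 1] fun_cong[OF eq, of \<i>] by (simp_all del: add_eq_0_iff)
    then have "D + E = 0" "D = E"
      by (simp_all add: left_diff_distrib[symmetric])
    then have "D = 0" by simp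
    then show ?thesis using D has_field_derivative_at_within by blast
  qed
  then obtain c where "\<And>x. x \<in> ?H \<Longrightarrow> \<alpha> x = c"
    using has_field_derivative_zero_constant[OF convex_halfspace_Im_gt[of 0]] by blast
  then have "\<alpha> z = \<alpha> (cnj v)" using zv by simp
  then show ?thesis using sum[of "cnj v"] zv by simp
qed

section \<open>Polarization of the Nevanlinna condition\<close>

text \<open>The integrand of the Nevanlinna condition with every \<open>cnj (szego (z j) t)\<close>
  rewritten as \<open>1 - szego (\<zeta> j) t\<close>. By the reflection rule nothing changes at
  \<open>\<zeta> j = cnj (z j)\<close>, but the conjugations have disappeared and
  \<open>\<zeta>\<close> may be treated as a separate holomorphic variable.\<close>

definition nevanlinna_defect ::
  "(real ^ 'n) measure \<Rightarrow> ('n \<Rightarrow> complex) \<Rightarrow> ('n \<Rightarrow> complex) \<Rightarrow> complex" where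
  "nevanlinna_defect M z \<zeta> =
     (\<integral>t. (\<Prod>j\<in>UNIV. szego (z j) (t $ j) - szego (\<zeta> j) (t $ j))
       - (\<Prod>j\<in>UNIV. szego (z j) (t $ j)) - (\<Prod>j\<in>UNIV. 1 - szego (\<zeta> j) (t $ j)) + 1 \<partial>M)"

lemma nevanlinna_condition_defect:
  fixes \<mu> :: "(real ^ 'n) measure"
  assumes "sets \<mu> = sets borel" "growth_condition \<mu>"
  shows "nevanlinna_condition \<mu> \<longleftrightarrow>
    (\<forall>z. (\<forall>j. Im (z j) > 0) \<longrightarrow> nevanlinna_defect (weighted \<mu>) z (\<lambda>j. cnj (z j)) = 0)"
proof -
  have "(\<integral>t. (\<Prod>j\<in>UNIV. szego (z $ j) (t $ j) + cnj (szego (z $ j) (t $ j)) - 1)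
       - (\<Prod>j\<in>UNIV. szego (z $ j) (t $ j)) - (\<Prod>j\<in>UNIV. cnj (szego (z $ j) (t $ j))) + 1
     \<partial>weighted \<mu>) = nevanlinna_defect (weighted \<mu>) (\<lambda>j. z $ j) (\<lambda>j. cnj (z $ j))"
    if "z \<in> upper_poly" for z :: "complex ^ 'n"
  proof -
    have "Im (z $ j) \<noteq> 0" for j
      using that upper_poly_subset_off_real by (auto simp: off_real_Im)
    then show ?thesis
      unfolding nevanlinna_defect_def by (simp add: szego_cnj algebra_simps)
  qed
  then have "nevanlinna_condition \<mu> \<longleftrightarrow>
      (\<forall>z\<in>upper_poly. nevanlinna_defect (weighted \<mu>) (\<lambda>j. z $ j) (\<lambda>j. cnj (z $ j)) = 0)"
    unfolding nevanlinna_condition_iff[OF assms] by (intro ball_cong refl) simp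
  also have "\<dots> \<longleftrightarrow> (\<forall>z. (\<forall>j. Im (z j) > 0) \<longrightarrow> nevanlinna_defect (weighted \<mu>) z (\<lambda>j. cnj (z j)) = 0)"
  proof safe
    fix z :: "'n \<Rightarrow> complex"
    assume *: "\<forall>z\<in>upper_poly. nevanlinna_defect (weighted \<mu>) (\<lambda>j. z $ j) (\<lambda>j. cnj (z $ j)) = 0"
      and "\<forall>j. Im (z j) > 0"
    then have "(\<chi> j. z j) \<in> upper_poly" unfolding upper_poly_def by simp
    from bspec[OF * this] show "nevanlinna_defect (weighted \<mu>) z (\<lambda>j. cnj (z j)) = 0" by simp
  qed (auto simp: upper_poly_def)
  finally show ?thesis .
qed

text \<open>Polarization: in each variable the defect is a function holomorphic in \<open>z\<^sub>j\<close> plus one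
  holomorphic in \<open>\<zeta>\<^sub>j\<close>, so it vanishes identically as soon as it does so on \<open>\<zeta>\<^sub>j = cnj z\<^sub>j\<close>.\<close>

lemma nevanlinna_defect_polarized:
  fixes M :: "(real ^ 'n) measure"
  assumes fin: "finite_measure M" and sets: "sets M = sets borel"
    and diag: "\<And>z. (\<And>j. Im (z j) > 0) \<Longrightarrow> nevanlinna_defect M z (\<lambda>j. cnj (z j)) = 0"
    and z: "\<And>j. Im (z j) > 0" and \<zeta>: "\<And>j. Im (\<zeta> j) < 0"
  shows "nevanlinna_defect M z \<zeta> = 0"
proof -
  \<comment> \<open>Induction on the set \<open>J\<close> of indices at which \<open>\<zeta>\<close>
    is already detached from \<open>cnj z\<close>.\<close>
  have "nevanlinna_defect M z \<zeta> = 0"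
    if "finite J" "\<And>j. Im (z j) > 0" "\<And>j. Im (\<zeta> j) < 0" "\<And>j. j \<notin> J \<Longrightarrow> \<zeta> j = cnj (z j)" for J z \<zeta>
    using that
  proof (induction J arbitrary: z \<zeta>)
    case empty
    then have "\<zeta> = (\<lambda>j. cnj (z j))" by auto
    then show ?case using diag empty by simp
  next
    case (insert j J)
    have ne: "Im (z l) \<noteq> 0" "Im (\<zeta> l) \<noteq> 0" for l
      using insert.prems(1)[of l] insert.prems(2)[of l] by auto
    \<comment> \<open>With the factor of index \<open>j\<close> taken out, the integrand is affine
      in \<open>szego u\<close> and \<open>szego v\<close> and has no mixed term, because the two
      occur together only as a difference. This yields the splitting into \<open>\<alpha>\<close>
      and \<open>\<beta>\<close>; the constant part is put into \<open>\<beta>\<close>.\<close>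
    define R where "R t = (\<Prod>l\<in>UNIV-{j}. szego (z l) (t $ l) - szego (\<zeta> l) (t $ l))" for t :: "real ^ 'n"
    define R1 where "R1 t = (\<Prod>l\<in>UNIV-{j}. szego (z l) (t $ l))" for t :: "real ^ 'n"
    define R2 where "R2 t = (\<Prod>l\<in>UNIV-{j}. 1 - szego (\<zeta> l) (t $ l))" for t :: "real ^ 'n"
    have bR: "bounded_borel R" "bounded_borel R1" "bounded_borel R2"
      unfolding R_def R1_def R2_def
      by (intro bounded_borel_prod bounded_borel_diff bounded_borel_szego bounded_borel_const ne)+
    define \<alpha> where "\<alpha> u = (\<integral>t. (R t - R1 t) * szego u (t $ j) \<partial>M)" for u
    define \<beta> where "\<beta> v = (\<integral>t. (R2 t - R t) * szego v (t $ j) \<partial>M) + (\<integral>t. 1 - R2 t \<partial>M)" for v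
    have split: "nevanlinna_defect M (z(j := u)) (\<zeta>(j := v)) = \<alpha> u + \<beta> v"
      if "Im u \<noteq> 0" "Im v \<noteq> 0" for u v
    proof -
      have int: "integrable M (\<lambda>t. (R t - R1 t) * szego u (t $ j))"
        "integrable M (\<lambda>t. (R2 t - R t) * szego v (t $ j))" "integrable M (\<lambda>t. 1 - R2 t)"
        by (intro bounded_borel_integrable[OF fin sets] bounded_borel_mult bounded_borel_diff
             bounded_borel_szego bounded_borel_const bR that)+
      have rem: "(\<Prod>l\<in>UNIV. g l) = g j * (\<Prod>l\<in>UNIV-{j}. g l)" for g :: "'n \<Rightarrow> complex"
        by (rule prod.remove) auto
      have cong: "(\<Prod>l\<in>UNIV-{j}. g ((z(j := u)) l) ((\<zeta>(j := v)) l) l) = (\<Prod>l\<in>UNIV-{j}. g (z l) (\<zeta> l) l)"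
        for g :: "complex \<Rightarrow> complex \<Rightarrow> 'n \<Rightarrow> complex"
        by (rule prod.cong) auto
      have "nevanlinna_defect M (z(j := u)) (\<zeta>(j := v))
          = (\<integral>t. (szego u (t $ j) - szego v (t $ j)) * R t - szego u (t $ j) * R1 t
               - (1 - szego v (t $ j)) * R2 t + 1 \<partial>M)"
        unfolding nevanlinna_defect_def rem R_def R1_def R2_def
        using cong[of "\<lambda>p q l. szego p (t $ l) - szego q (t $ l)" for t :: "real ^ 'n"]
          cong[of "\<lambda>p q l. szego p (t $ l)" for t :: "real ^ 'n"] cong[of "\<lambda>p q l. 1 - szego q (t $ l)" for t :: "real ^ 'n"]
        by simp
      also have "\<dots> = (\<integral>t. (R t - R1 t) * szego u (t $ j) + ((R2 t - R t) * szego v (t $ j) + (1 - R2 t)) \<partial>M)"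
        by (rule Bochner_Integration.integral_cong) (simp_all add: algebra_simps)
      also have "\<dots> = \<alpha> u + \<beta> v"
        unfolding \<alpha>_def \<beta>_def using int by (subst Bochner_Integration.integral_add) auto
      finally show ?thesis .
    qed
    have "\<alpha> (z j) + \<beta> (\<zeta> j) = 0"
    proof (rule holomorphic_antiholomorphic_separation[of \<alpha> \<beta>])
      show "\<alpha> field_differentiable (at u)" if "Im u > 0" for u
        unfolding \<alpha>_def using that
        by (intro szego_integral_differentiable fin sets bounded_borel_diff bR) simp
      show "\<beta> field_differentiable (at v)" if "Im v < 0" for v
        unfolding \<beta>_def using that
        by (intro field_differentiable_add field_differentiable_const szego_integral_differentiable
            fin sets bounded_borel_diff bR) simp
      show "\<alpha> u + \<beta> (cnj u) = 0" if "Im u > 0" for u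
      proof (subst split[symmetric])
        show "nevanlinna_defect M (z(j := u)) (\<zeta>(j := cnj u)) = 0"
          using insert.prems that by (intro insert.IH) auto
      qed (use that in auto)
    qed (use insert.prems in auto)
    then show ?case using split[of "z j" "\<zeta> j"] ne by simp
  qed
  from this[of UNIV] show ?thesis using z \<zeta> by auto
qed

lemma alternating_sum_Pow:
  assumes "finite B" "B \<noteq> {}"
  shows "(\<Sum>D\<in>Pow B. (-1) ^ card D :: complex) = 0"
proof -
  have "(0 :: complex) ^ card B = 0"
    using assms by (intro zero_power) (simp add: card_gt_0_iff)
  then show ?thesis
    using prod_diff_conv_sum[OF assms(1), of "\<lambda>_. 1 :: complex" "\<lambda>_. 1"]
    by (simp only: diff_self prod_constant prod.neutral_const power_one mult_1_right)
qed

lemma prod_alternating_sum: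
  fixes c :: "'a \<Rightarrow> complex"
  assumes "finite B"
  shows "(\<Prod>j\<in>B. c j) = (\<Sum>D\<in>Pow B. (-1) ^ card D * (\<Prod>j\<in>D. 1 - c j))"
  using prod_diff_conv_sum[OF assms, of "\<lambda>_. 1" "\<lambda>j. 1 - c j"] by simp

text \<open>Let \<open>X\<close> be the product over the upper variables and \<open>Y D\<close> that
  of \<open>1 - c\<^sub>j\<close> over a set \<open>D\<close> of lower ones. The polarized
  condition, taken at suitable points, says that the integral of \<open>(Y D - 1) * (X - 1)\<close>
  is 0, so the integral of \<open>Y D * (X - 1)\<close> is the same for all \<open>D\<close>. The
  product over the lower variables is the alternating sum of the \<open>Y D\<close>, and alternating
  signs over the subsets of a nonempty set add up to 0. Hence \<open>X\<close> can be replaced by 1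
  under the integral.\<close>

lemma szego_product_nondependence:
  fixes M :: "(real ^ 'n) measure" and z :: "'n \<Rightarrow> complex"
  assumes fin: "finite_measure M" and sets: "sets M = sets borel"
    and diag: "\<And>z. (\<And>j. Im (z j) > 0) \<Longrightarrow> nevanlinna_defect M z (\<lambda>j. cnj (z j)) = 0"
    and z: "\<And>j. Im (z j) \<noteq> 0" and B: "{j. Im (z j) < 0} \<noteq> {}"
  shows "(\<integral>t. (\<Prod>j\<in>UNIV. szego (z j) (t $ j)) \<partial>M)
    = (\<integral>t. (\<Prod>j\<in>{j. Im (z j) < 0}. szego (z j) (t $ j)) \<partial>M)"
proof -
  define B where "B = {j. Im (z j) < 0}"
  define X where "X t = (\<Prod>j\<in>-B. szego (z j) (t $ j))" for t :: "real ^ 'n"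
  define Y where "Y D t = (\<Prod>j\<in>D. 1 - szego (z j) (t $ j))" for D and t :: "real ^ 'n"
  have bb: "bounded_borel X" "bounded_borel (Y D)" for D
    unfolding X_def Y_def
    by (intro bounded_borel_prod bounded_borel_diff bounded_borel_szego bounded_borel_const z)+
  note int = bounded_borel_integrable[OF fin sets]
  have Y: "(\<integral>t. Y D t * (X t - 1) \<partial>M) = (\<integral>t. X t - 1 \<partial>M)" if D: "D \<subseteq> B" for D
  proof -
    \<comment> \<open>The values i on \<open>B\<close> and -i off \<open>D\<close> make the unwanted
      kernels 1 and 0. The differences are then \<open>1 - c\<^sub>j\<close> on \<open>D\<close>, 1
      on the rest of \<open>B\<close>, and \<open>c\<^sub>j\<close> off \<open>B\<close>, so their
      product is \<open>Y D * X\<close>.\<close>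
    let ?z = "\<lambda>j. if j \<in> B then \<i> else z j" and ?\<zeta> = "\<lambda>j. if j \<in> D then z j else - \<i>"
    have "nevanlinna_defect M ?z ?\<zeta> = 0"
    proof (rule nevanlinna_defect_polarized[OF fin sets diag])
      show "Im (?z j) > 0" for j
        using z[of j] by (auto simp: B_def)
      show "Im (?\<zeta> j) < 0" for j
        using D by (auto simp: B_def)
    qed
    moreover have "(\<Prod>j\<in>UNIV. szego (?z j) (t $ j)) = X t" for t
      unfolding X_def by (rule prod.mono_neutral_cong_right) (auto simp: szego_i)
    moreover have "(\<Prod>j\<in>UNIV. 1 - szego (?\<zeta> j) (t $ j)) = Y D t" for t
      unfolding Y_def by (rule prod.mono_neutral_cong_right) (auto simp: szego_minus_i)
    moreover have "(\<Prod>j\<in>UNIV. szego (?z j) (t $ j) - szego (?\<zeta> j) (t $ j)) = Y D t * X t" for t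
    proof -
      have "(\<Prod>j\<in>UNIV. szego (?z j) (t $ j) - szego (?\<zeta> j) (t $ j))
        = (\<Prod>j\<in>B \<union> -B. szego (?z j) (t $ j) - szego (?\<zeta> j) (t $ j))" by simp
      also have "\<dots> = (\<Prod>j\<in>B. szego (?z j) (t $ j) - szego (?\<zeta> j) (t $ j)) * (\<Prod>j\<in>-B. szego (?z j) (t $ j) - szego (?\<zeta> j) (t $ j))"
        by (rule prod.union_disjoint) auto
      also have "(\<Prod>j\<in>B. szego (?z j) (t $ j) - szego (?\<zeta> j) (t $ j)) = Y D t"
        unfolding Y_def using D by (intro prod.mono_neutral_cong_right) (auto simp: szego_i szego_minus_i)
      also have "(\<Prod>j\<in>-B. szego (?z j) (t $ j) - szego (?\<zeta> j) (t $ j)) = X t"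
        unfolding X_def using D by (intro prod.cong) (auto simp: szego_minus_i)
      finally show ?thesis .
    qed
    ultimately have "(\<integral>t. Y D t * X t - X t - Y D t + 1 \<partial>M) = 0"
      unfolding nevanlinna_defect_def by simp
    moreover have "(\<integral>t. Y D t * X t - X t - Y D t + 1 \<partial>M)
        = (\<integral>t. Y D t * (X t - 1) - (X t - 1) \<partial>M)"
      by (simp add: algebra_simps)
    moreover have "\<dots> = (\<integral>t. Y D t * (X t - 1) \<partial>M) - (\<integral>t. X t - 1 \<partial>M)"
      by (intro Bochner_Integration.integral_diff int bounded_borel_mult bounded_borel_diff bb bounded_borel_const)
    ultimately show ?thesis by simp
  qed
  have prodB: "(\<Prod>j\<in>B. szego (z j) (t $ j)) = (\<Sum>D\<in>Pow B. (-1) ^ card D * Y D t)" for t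
    unfolding Y_def by (rule prod_alternating_sum) simp
  have bB: "bounded_borel (\<lambda>t. \<Prod>j\<in>B. szego (z j) (t $ j))"
    by (intro bounded_borel_prod bounded_borel_szego z)
  have "(\<integral>t. (\<Prod>j\<in>B. szego (z j) (t $ j)) * (X t - 1) \<partial>M)
      = (\<integral>t. (\<Sum>D\<in>Pow B. (-1) ^ card D * (Y D t * (X t - 1))) \<partial>M)"
    unfolding prodB by (simp only: sum_distrib_right mult.assoc)
  also have "\<dots> = (\<Sum>D\<in>Pow B. (-1) ^ card D * (\<integral>t. Y D t * (X t - 1) \<partial>M))"
    by (subst Bochner_Integration.integral_sum)
      (auto intro!: int bounded_borel_mult bounded_borel_diff bb bounded_borel_const)
  also have "\<dots> = (\<Sum>D\<in>Pow B. (-1) ^ card D * (\<integral>t. X t - 1 \<partial>M))"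
    using Y by (intro sum.cong) auto
  also have "\<dots> = 0"
    using alternating_sum_Pow[of B] B unfolding sum_distrib_right[symmetric] B_def by simp
  finally have "(\<integral>t. (\<Prod>j\<in>B. szego (z j) (t $ j)) * (X t - 1) \<partial>M) = 0" .
  moreover have "(\<integral>t. (\<Prod>j\<in>B. szego (z j) (t $ j)) * (X t - 1) \<partial>M)
      = (\<integral>t. (\<Prod>j\<in>B. szego (z j) (t $ j)) * X t \<partial>M) - (\<integral>t. (\<Prod>j\<in>B. szego (z j) (t $ j)) \<partial>M)"
    unfolding right_diff_distrib mult_1_right
    by (intro Bochner_Integration.integral_diff int bounded_borel_mult bb bB)
  moreover have "(\<Prod>j\<in>UNIV. szego (z j) (t $ j)) = (\<Prod>j\<in>B. szego (z j) (t $ j)) * X t" for t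
    unfolding X_def by (subst prod.union_disjoint[symmetric]) auto
  ultimately show ?thesis unfolding B_def by simp
qed

section \<open>The symmetry formula, and uniqueness of its non-dependent solutions\<close>

definition symmetry_formula :: "(complex ^ 'n \<Rightarrow> complex) \<Rightarrow> bool" where
  "symmetry_formula f \<longleftrightarrow> (\<forall>z\<in>off_real.
     f z = (\<Sum>B | B \<noteq> {}. (-1) ^ (card B + 1) * cnj (f (Psi B (vec \<i>) z))))"

lemma Psi_off_real: "z \<in> off_real \<Longrightarrow> Psi B (vec \<i>) z \<in> off_real"
  by (auto simp: off_real_Im Psi_def)

lemma sum_nonempty_sets:
  fixes g :: "'n::finite set \<Rightarrow> complex"
  shows "(\<Sum>B | B \<noteq> {}. (-1) ^ (card B + 1) * g B) = g {} - (\<Sum>B\<in>UNIV. (-1) ^ card B * g B)"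
proof -
  have "(UNIV :: 'n set set) = insert {} {B. B \<noteq> {}}" by auto
  then have "(\<Sum>B\<in>UNIV. (-1) ^ card B * g B) = g {} + (\<Sum>B | B \<noteq> {}. (-1) ^ card B * g B)"
    by (subst \<open>UNIV = _\<close>, subst sum.insert) auto
  then show ?thesis by (simp add: sum_negf)
qed

text \<open>\<open>Psi B\<close> with base point i makes the kernels outside \<open>B\<close> equal
  to 1 and, after conjugation, those in \<open>B\<close> equal to \<open>1 - c\<^sub>j\<close>. The
  alternating sum over all \<open>B\<close> is therefore the expansion of the full product, while
  constants cancel in it; they survive only through the omitted term of the empty set.\<close>

lemma nev_formula_symmetry:
  fixes \<mu> :: "(real ^ 'n) measure"
  assumes "sets \<mu> = sets borel" "growth_condition \<mu>"
  shows "symmetry_formula (nev_formula a 0 \<mu>)"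
  unfolding symmetry_formula_def
proof
  fix z :: "complex ^ 'n" assume zo: "z \<in> off_real"
  then have z: "Im (z $ l) \<noteq> 0" for l by (simp add: off_real_Im)
  have fin: "finite_measure (weighted \<mu>)" by (rule finite_measure_weighted[OF assms])
  have sets: "sets (weighted \<mu>) = sets borel" using assms by simp
  have sp: "space (weighted \<mu>) = UNIV"
    using sets_eq_imp_space_eq[of "weighted \<mu>" borel] sets by simp
  define S where "S z = (\<integral>t. (\<Prod>l\<in>UNIV. szego (z $ l) (t $ l)) \<partial>weighted \<mu>)" for z
  define c where "c = complex_of_real (measure (weighted \<mu>) UNIV)"
  define \<kappa> where "\<kappa> = \<i> / of_real pi ^ CARD('n)"
  have nev: "nev_formula a 0 \<mu> z = of_real a + \<kappa> * (2 * S z - c)" if "z \<in> off_real" for z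
    unfolding nev_formula_szego[OF assms that] S_def c_def \<kappa>_def by simp
  have c: "c = (\<integral>t. 1 \<partial>weighted \<mu>)"
    unfolding c_def by (simp add: sp of_real_def)
  have cS: "cnj (S (Psi B (vec \<i>) z)) = (\<integral>t. (\<Prod>l\<in>B. 1 - szego (z $ l) (t $ l)) \<partial>weighted \<mu>)" for B
  proof -
    have "cnj (\<Prod>l\<in>UNIV. szego (Psi B (vec \<i>) z $ l) (t $ l)) = (\<Prod>l\<in>B. 1 - szego (z $ l) (t $ l))" for t
      unfolding cnj_prod
      by (rule prod.mono_neutral_cong_right) (auto simp: Psi_def szego_i szego_cnj[OF z])
    then show ?thesis
      unfolding S_def Bochner_Integration.integral_cnj[symmetric] by (simp only:)
  qed
  have "(\<Sum>B\<in>UNIV. (-1) ^ card B * cnj (S (Psi B (vec \<i>) z)))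
      = (\<integral>t. (\<Sum>B\<in>Pow UNIV. (-1) ^ card B * (\<Prod>l\<in>B. 1 - szego (z $ l) (t $ l))) \<partial>weighted \<mu>)"
    unfolding cS
    by (subst Bochner_Integration.integral_sum)
      (auto intro!: bounded_borel_integrable[OF fin sets] bounded_borel_mult bounded_borel_prod
        bounded_borel_diff bounded_borel_szego z)
  also have "\<dots> = S z"
    unfolding S_def prod_alternating_sum[OF finite, symmetric] ..
  finally have sumS: "(\<Sum>B\<in>UNIV. (-1) ^ card B * cnj (S (Psi B (vec \<i>) z))) = S z" .
  have sum1: "(\<Sum>B\<in>(UNIV :: 'n set set). (-1) ^ card B :: complex) = 0"
    using alternating_sum_Pow[of "UNIV :: 'n set"] by simp
  \<comment> \<open>\<open>\<kappa>\<close> is purely imaginary and \<open>a\<close>,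
    \<open>c\<close> are real, so conjugation changes the sign of \<open>\<kappa>\<close> only. For
    empty \<open>B\<close> the integral of the product is the total mass \<open>c\<close>, which
    gives the separate term in the next step.\<close>
  have "(\<Sum>B | B \<noteq> {}. (-1) ^ (card B + 1) * cnj (nev_formula a 0 \<mu> (Psi B (vec \<i>) z)))
      = (\<Sum>B | B \<noteq> {}. (-1) ^ (card B + 1) * (of_real a + \<kappa> * c - 2 * \<kappa> * cnj (S (Psi B (vec \<i>) z))))"
    unfolding nev[OF Psi_off_real[OF zo]] by (simp add: c_def \<kappa>_def algebra_simps)
  also have "\<dots> = of_real a + \<kappa> * c - 2 * \<kappa> * c
      - (\<Sum>B\<in>UNIV. (-1) ^ card B * (of_real a + \<kappa> * c - 2 * \<kappa> * cnj (S (Psi B (vec \<i>) z))))"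
    unfolding sum_nonempty_sets cS c by simp
  also have "(\<Sum>B\<in>UNIV. (-1) ^ card B * (of_real a + \<kappa> * c - 2 * \<kappa> * cnj (S (Psi B (vec \<i>) z))))
      = (\<Sum>B\<in>(UNIV :: 'n set set). (-1) ^ card B) * (of_real a + \<kappa> * c)
        - 2 * \<kappa> * (\<Sum>B\<in>UNIV. (-1) ^ card B * cnj (S (Psi B (vec \<i>) z)))"
    unfolding right_diff_distrib[of "(-1) ^ card B" for B] sum_subtractf sum_distrib_right sum_distrib_left
    by (simp add: mult_ac)
  also have "of_real a + \<kappa> * c - 2 * \<kappa> * c - \<dots> = nev_formula a 0 \<mu> z"
    unfolding sumS sum1 nev[OF zo] by (simp add: algebra_simps)
  finally show "nev_formula a 0 \<mu> z
      = (\<Sum>B | B \<noteq> {}. (-1) ^ (card B + 1) * cnj (nev_formula a 0 \<mu> (Psi B (vec \<i>) z)))" ..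
qed

lemma nev_formula_nondependence:
  fixes \<mu> :: "(real ^ 'n) measure"
  assumes "sets \<mu> = sets borel" "growth_condition \<mu>" "nevanlinna_condition \<mu>"
  shows "variable_non_dependence (nev_formula a 0 \<mu>)"
  unfolding variable_non_dependence_def
proof (intro ballI impI)
  fix z w :: "complex ^ 'n"
  assume zw: "z \<in> off_real" "w \<in> off_real"
    and eq: "{j. Im (z $ j) < 0} = {j. Im (w $ j) < 0}" and ne: "{j. Im (z $ j) < 0} \<noteq> {}"
    and low: "\<forall>j. Im (z $ j) < 0 \<longrightarrow> z $ j = w $ j"
  have fin: "finite_measure (weighted \<mu>)" by (rule finite_measure_weighted[OF assms(1,2)])
  have sets: "sets (weighted \<mu>) = sets borel" using assms by simp
  have diag: "nevanlinna_defect (weighted \<mu>) z (\<lambda>j. cnj (z j)) = 0" if "\<And>j. Im (z j) > 0" for z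
    using assms(3) that unfolding nevanlinna_condition_defect[OF assms(1,2)] by blast
  have red: "(\<integral>t. (\<Prod>j\<in>UNIV. szego (u $ j) (t $ j)) \<partial>weighted \<mu>)
    = (\<integral>t. (\<Prod>j\<in>{j. Im (u $ j) < 0}. szego (u $ j) (t $ j)) \<partial>weighted \<mu>)"
    if "u \<in> off_real" "{j. Im (u $ j) < 0} \<noteq> {}" for u :: "complex ^ 'n"
    using that by (intro szego_product_nondependence[OF fin sets diag]) (auto simp: off_real_Im)
  have "(\<integral>t. (\<Prod>j\<in>{j. Im (z $ j) < 0}. szego (z $ j) (t $ j)) \<partial>weighted \<mu>)
    = (\<integral>t. (\<Prod>j\<in>{j. Im (w $ j) < 0}. szego (w $ j) (t $ j)) \<partial>weighted \<mu>)"
    unfolding eq[symmetric] using low by (intro Bochner_Integration.integral_cong prod.cong refl) auto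
  then show "nev_formula a 0 \<mu> z = nev_formula a 0 \<mu> w"
    using red[OF zw(1) ne] red[OF zw(2)] ne eq nev_formula_szego[OF assms(1,2)] zw by simp
qed

text \<open>If \<open>z\<^sub>k\<close> is in the lower half-plane, then the terms of the symmetry formula for \<open>B\<close> and for the
  symmetric difference of \<open>B\<close> with \<open>{k}\<close> cancel: either both arguments lie in the upper poly-half-plane,
  or they agree in all of their components from the lower half-plane.\<close>

lemma symmetric_nondependent_eq:
  fixes f g :: "complex ^ 'n \<Rightarrow> complex"
  assumes "symmetry_formula f" "symmetry_formula g"
    and "variable_non_dependence f" "variable_non_dependence g"
    and eq: "\<And>z. z \<in> upper_poly \<Longrightarrow> f z = g z" and zo: "z \<in> off_real"
  shows "f z = g z"
proof (cases "z \<in> upper_poly")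
  case False
  have z: "Im (z $ j) \<noteq> 0" for j using zo by (simp add: off_real_Im)
  obtain k where k: "Im (z $ k) < 0"
    using False z unfolding upper_poly_def by (auto simp: not_less) (metis linorder_cases not_less)
  define T where "T B = (-1) ^ card B * (cnj (f (Psi B (vec \<i>) z)) - cnj (g (Psi B (vec \<i>) z)))" for B
  define \<sigma> where "\<sigma> B = (if k \<in> B then B - {k} else insert k B)" for B
  have up: "u \<in> upper_poly" if "u \<in> off_real" "{j. Im (u $ j) < 0} = {}" for u :: "complex ^ 'n"
  proof -
    have "0 < Im (u $ j)" for j
      using that(1) that(2)[unfolded set_eq_iff, simplified, rule_format, of j]
      unfolding off_real_Im by (meson linorder_cases)
    then show ?thesis unfolding upper_poly_def by simp
  qed
  have step: "T (insert k B) = - T B" if "k \<notin> B" for B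
  proof -
    let ?p = "Psi B (vec \<i>) z" and ?q = "Psi (insert k B) (vec \<i>) z"
    have off: "?p \<in> off_real" "?q \<in> off_real" using Psi_off_real[OF zo] by auto
    have low: "{j. Im (?p $ j) < 0} = {j. Im (?q $ j) < 0}" "\<forall>j. Im (?p $ j) < 0 \<longrightarrow> ?p $ j = ?q $ j"
      using k that by (auto simp: Psi_def)
    have "f ?p - g ?p = f ?q - g ?q"
    proof (cases "{j. Im (?p $ j) < 0} = {}")
      case True
      then have "?p \<in> upper_poly" "?q \<in> upper_poly"
        using up off low(1) by auto
      then show ?thesis using eq by simp
    next
      case False
      then show ?thesis
        using assms(3,4) off low unfolding variable_non_dependence_def by metis
    qed
    then have "cnj (f ?p) - cnj (g ?p) = cnj (f ?q) - cnj (g ?q)"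
      by (metis complex_cnj_diff)
    then show ?thesis unfolding T_def using that by simp
  qed
  have neg: "T (\<sigma> B) = - T B" for B
    using step[of B] step[of "B - {k}"] unfolding \<sigma>_def by (auto simp: insert_absorb)
  have "bij \<sigma>"
    by (rule involuntory_imp_bij) (auto simp: \<sigma>_def)
  then have "(\<Sum>B\<in>UNIV. T B) = (\<Sum>B\<in>UNIV. T (\<sigma> B))"
    by (rule sum.reindex_bij_betw[symmetric])
  also have "\<dots> = - (\<Sum>B\<in>UNIV. T B)" unfolding neg by (rule sum_negf)
  finally have "(\<Sum>B\<in>UNIV. T B) = 0" by simp
  \<comment> \<open>The symmetry formula omits the empty set. Its term is the difference of
    \<open>f\<close> and \<open>g\<close> at the point with all components i, so it vanishes too and
    the complete sum may be used.\<close>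
  moreover have "(vec \<i> :: complex ^ 'n) \<in> upper_poly" "Psi {} (vec \<i>) z = vec \<i>"
    by (auto simp: upper_poly_def Psi_def vec_eq_iff)
  moreover have "f z - g z = (\<Sum>B | B \<noteq> {}. (-1) ^ (card B + 1)
      * (cnj (f (Psi B (vec \<i>) z)) - cnj (g (Psi B (vec \<i>) z))))"
    using assms(1,2) zo unfolding symmetry_formula_def right_diff_distrib sum_subtractf by simp
  ultimately show ?thesis
    unfolding sum_nonempty_sets T_def using eq by simp
qed (use eq in auto)

section \<open>The linear term\<close>

text \<open>For the angle pi/2 the Stoltz domain is exactly the positive imaginary axis. Counting
  from 1 keeps the sequence off 0.\<close>

lemma nontangential_upper_imaginary_axis:
  assumes "nontangential_upper g l"
  shows "(\<lambda>n. g (\<i> * of_nat (Suc n))) \<longlonglongrightarrow> l"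
proof -
  have Arg: "Arg (\<i> * of_nat (Suc n)) = pi / 2" for n
    using Arg_times_of_real[of "real (Suc n)" \<i>] by (simp add: mult.commute)
  have "filterlim (\<lambda>n. \<i> * of_nat (Suc n) :: complex) at_infinity sequentially"
    unfolding filterlim_at_infinity_conv_norm_at_top
    by (simp add: norm_mult del: of_nat_Suc)
      (intro filterlim_compose[OF filterlim_real_sequentially] filterlim_Suc)
  then have "filterlim (\<lambda>n. \<i> * of_nat (Suc n)) (inf at_infinity (principal (stoltz_upper (pi / 2)))) sequentially"
    unfolding filterlim_inf filterlim_principal stoltz_upper_def using Arg
    by (simp del: of_nat_Suc)
  moreover have "(g \<longlongrightarrow> l) (inf at_infinity (principal (stoltz_upper (pi / 2))))"
    using assms unfolding nontangential_upper_def by (auto simp: pi_gt_zero)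
  ultimately show ?thesis by (rule filterlim_compose[rotated])
qed

lemma szego_imaginary_axis_bound:
  "norm (szego (\<i> * of_nat (Suc n)) t) \<le> norm (of_real t - \<i>)"
proof -
  define y where "y = real (Suc n)"
  have y: "y \<ge> 1" and Y: "of_nat (Suc n) = complex_of_real y" unfolding y_def by auto
  have den: "y \<le> norm (of_real t - \<i> * of_real y)"
    using abs_Im_le_cmod[of "of_real t - \<i> * of_real y"] y by simp
  have "norm (\<i> * of_real y + \<i>) = norm (\<i> * of_real (y + 1))" by (simp add: algebra_simps)
  then have num: "norm (\<i> * of_real y + \<i>) = y + 1" using y by (simp only: norm_mult norm_of_real) simp
  have "norm (szego (\<i> * of_real y) t) = (y + 1) * norm (of_real t - \<i>) / (2 * norm (of_real t - \<i> * of_real y))"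
    unfolding szego_def norm_divide norm_mult num by simp
  also have "\<dots> \<le> (y + 1) * norm (of_real t - \<i>) / (2 * y)"
    using den y by (intro divide_left_mono mult_left_mono) auto
  also have "\<dots> \<le> (2 * y) * norm (of_real t - \<i>) / (2 * y)"
    using y by (intro divide_right_mono mult_right_mono) auto
  finally show ?thesis using y unfolding Y by simp
qed

text \<open>Two bounds work together. For fixed \<open>t\<close> the kernel is bounded in
  \<open>n\<close>, which gives the pointwise limit 0 after division. Uniformly in \<open>t\<close>
  it is at most \<open>2 * Suc n\<close>, which gives the dominating constant 2.\<close>

lemma szego_imaginary_axis_limit:
  fixes j :: "'n::finite" and M :: "(real ^ 'n) measure"
  assumes fin: "finite_measure M" and sets: "sets M = sets borel"
  shows "(\<lambda>n. (\<integral>t. szego (\<i> * of_nat (Suc n)) (t $ j) \<partial>M) / (\<i> * of_nat (Suc n))) \<longlonglongrightarrow> 0"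
proof -
  interpret finite_measure M by fact
  have tj: "(\<lambda>t. t $ j) \<in> borel_measurable M"
    unfolding measurable_cong_sets[OF sets refl]
    by (intro borel_measurable_continuous_onI continuous_intros)
  have "(\<lambda>n. \<integral>t. szego (\<i> * of_nat (Suc n)) (t $ j) / (\<i> * of_nat (Suc n)) \<partial>M) \<longlonglongrightarrow> (\<integral>t. 0 \<partial>M)"
  proof (rule integral_dominated_convergence[where w = "\<lambda>_. 2"])
    show "(\<lambda>t. szego (\<i> * of_nat (Suc n)) (t $ j) / (\<i> * of_nat (Suc n))) \<in> borel_measurable M" for n
      unfolding szego_def using tj by measurable
    show "AE t in M. (\<lambda>n. szego (\<i> * of_nat (Suc n)) (t $ j) / (\<i> * of_nat (Suc n))) \<longlonglongrightarrow> 0"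
    proof (rule AE_I2)
      fix t :: "real ^ 'n"
      show "(\<lambda>n. szego (\<i> * of_nat (Suc n)) (t $ j) / (\<i> * of_nat (Suc n))) \<longlonglongrightarrow> 0"
      proof (rule tendsto_norm_zero_cancel, rule tendsto_sandwich[where f = "\<lambda>_. 0"
            and h = "\<lambda>n. norm (of_real (t $ j) - \<i>) * inverse (real (Suc n))"])
      show "(\<lambda>n. norm (of_real (t $ j) - \<i>) * inverse (real (Suc n))) \<longlonglongrightarrow> 0"
        using tendsto_mult[OF tendsto_const LIMSEQ_inverse_real_of_nat] by simp
      show "\<forall>\<^sub>F n in sequentially. norm (szego (\<i> * of_nat (Suc n)) (t $ j) / (\<i> * of_nat (Suc n)))
          \<le> norm (of_real (t $ j) - \<i>) * inverse (real (Suc n))"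
      proof (rule always_eventually, rule allI)
        fix n
        have "norm (szego (\<i> * of_nat (Suc n)) (t $ j) / (\<i> * of_nat (Suc n)))
            = norm (szego (\<i> * of_nat (Suc n)) (t $ j)) * inverse (real (Suc n))"
          by (simp add: norm_divide norm_mult norm_inverse divide_inverse del: of_nat_Suc)
        then show "norm (szego (\<i> * of_nat (Suc n)) (t $ j) / (\<i> * of_nat (Suc n)))
            \<le> norm (of_real (t $ j) - \<i>) * inverse (real (Suc n))"
          using mult_right_mono[OF szego_imaginary_axis_bound[of n "t $ j"], of "inverse (real (Suc n))"]
          by simp
      qed
      qed auto
    qed
    show "AE t in M. norm (szego (\<i> * of_nat (Suc n)) (t $ j) / (\<i> * of_nat (Suc n))) \<le> 2" for n
    proof (rule AE_I2)
      fix t :: "real ^ 'n"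
      let ?y = "real (Suc n)"
      have eq: "norm (\<i> * of_nat (Suc n) + \<i>) = ?y + 1" "norm (\<i> * of_nat (Suc n) - \<i>) \<le> ?y"
      proof -
        have "\<i> * of_nat (Suc n) + \<i> = \<i> * of_nat (Suc (Suc n))" "\<i> * of_nat (Suc n) - \<i> = \<i> * of_nat n"
          by (simp_all add: algebra_simps)
        then show "norm (\<i> * of_nat (Suc n) + \<i>) = ?y + 1" "norm (\<i> * of_nat (Suc n) - \<i>) \<le> ?y"
          by (simp_all only: norm_mult norm_ii norm_of_nat) simp_all
      qed
      have "norm (szego (\<i> * of_nat (Suc n)) (t $ j)) \<le> (?y + 1) / 2 * (1 + norm (\<i> * of_nat (Suc n) - \<i>) / ?y)"
        using norm_szego_le[of "\<i> * of_nat (Suc n)" "t $ j"] unfolding eq(1) by simp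
      also have "\<dots> \<le> ?y * 2"
        using eq(2) by (intro mult_mono) (auto simp: divide_le_eq)
      finally show "norm (szego (\<i> * of_nat (Suc n)) (t $ j) / (\<i> * of_nat (Suc n))) \<le> 2"
        unfolding norm_divide norm_mult norm_ii norm_of_nat mult_1 by (simp add: divide_le_eq)
    qed
  qed auto
  then show ?thesis by simp
qed

text \<open>With all other variables at i their kernels are 1, so along
  \<open>z\<^sub>j = \<i> * y\<close> only one kernel is left and its integral is o(y). Dividing by
  \<open>\<i> * y\<close> leaves the limit \<open>b $ j\<close>, which growth forces to be
  0.\<close>

lemma nev_formula_linear_coefficient:
  fixes \<mu> :: "(real ^ 'n) measure" and b :: "real ^ 'n"
  assumes \<mu>: "sets \<mu> = sets borel" "growth_condition \<mu>"
    and f: "\<And>z. z \<in> off_real \<Longrightarrow> f z = nev_formula a b \<mu> z"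
    and growth: "nontangential_upper (\<lambda>w. f (upd_comp (vec \<i>) j w) / w) 0"
  shows "b $ j = 0"
proof -
  define M where "M = weighted \<mu>"
  have fin: "finite_measure M" and sets: "sets M = sets borel"
    unfolding M_def using \<mu> finite_measure_weighted by auto
  define \<kappa> where "\<kappa> = \<i> / of_real pi ^ CARD('n)"
  define c where "c = complex_of_real (measure M UNIV)"
  define A where "A = of_real a + (\<Sum>l\<in>UNIV-{j}. of_real (b $ l) * \<i>) - \<kappa> * c"
  define w where "w n = \<i> * of_nat (Suc n)" for n
  have w: "w n \<noteq> 0" "Im (w n) \<noteq> 0" for n
    unfolding w_def by (simp_all del: of_nat_Suc)
  have "f (upd_comp (vec \<i>) j (w n)) / w n
      = of_real (b $ j) + A / w n + 2 * \<kappa> * ((\<integral>t. szego (w n) (t $ j) \<partial>M) / w n)" for n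
  proof -
    let ?z = "upd_comp (vec \<i>) j (w n)"
    have zo: "?z \<in> off_real" using w by (auto simp: off_real_Im upd_comp_def)
    have "(\<Prod>l\<in>UNIV. szego (?z $ l) (t $ l)) = szego (w n) (t $ j)" for t :: "real ^ 'n"
      by (subst prod.remove[of _ j]) (auto simp: upd_comp_def szego_i intro!: prod.neutral)
    moreover have "(\<Sum>l\<in>UNIV. of_real (b $ l) * ?z $ l)
        = of_real (b $ j) * w n + (\<Sum>l\<in>UNIV-{j}. of_real (b $ l) * \<i>)"
      by (subst sum.remove[of _ j]) (auto simp: upd_comp_def intro!: sum.cong)
    ultimately have "f ?z = of_real (b $ j) * w n + A + 2 * \<kappa> * (\<integral>t. szego (w n) (t $ j) \<partial>M)"
      unfolding f[OF zo] nev_formula_szego[OF \<mu> zo] A_def M_def c_def \<kappa>_def by (simp add: algebra_simps)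
    then show ?thesis using w(1)[of n] by (simp add: add_divide_distrib)
  qed
  moreover have "(\<lambda>n. f (upd_comp (vec \<i>) j (w n)) / w n) \<longlonglongrightarrow> 0"
    using nontangential_upper_imaginary_axis[OF growth] unfolding w_def .
  moreover have "(\<lambda>n. of_real (b $ j) + A / w n + 2 * \<kappa> * ((\<integral>t. szego (w n) (t $ j) \<partial>M) / w n))
     \<longlonglongrightarrow> of_real (b $ j) + A / \<i> * 0 + 2 * \<kappa> * 0"
  proof -
    have "(\<lambda>n. inverse (of_nat (Suc n) :: complex)) \<longlonglongrightarrow> 0"
      using tendsto_of_real[OF LIMSEQ_inverse_real_of_nat, where 'a=complex] by simp
    then have "(\<lambda>n. A / \<i> * inverse (of_nat (Suc n))) \<longlonglongrightarrow> A / \<i> * 0"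
      by (rule tendsto_mult_left)
    then have "(\<lambda>n. A / w n) \<longlonglongrightarrow> A / \<i> * 0"
      unfolding w_def by (simp only: divide_inverse inverse_mult_distrib mult.assoc)
    then show ?thesis
      using szego_imaginary_axis_limit[OF fin sets, of j] unfolding w_def by (intro tendsto_intros)
  qed
  ultimately have "complex_of_real (b $ j) = 0"
    using LIMSEQ_unique by fastforce
  then show ?thesis by simp
qed

lemma symmetric_extension_properties:
  fixes f :: "complex ^ 'n \<Rightarrow> complex"
  assumes growth: "\<And>j z. z \<in> off_real \<Longrightarrow> nontangential_upper (\<lambda>w. f (upd_comp z j w) / w) 0"
    and h: "herglotz_nevanlinna h" "is_symmetric_extension h f"
  shows "(\<forall>z\<in>upper_poly. Im (f z) \<ge> 0) \<and> symmetry_formula f \<and> variable_non_dependence f"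
proof -
  obtain a b \<mu> where tr: "has_triple h a b \<mu>" and f: "\<And>z. z \<in> off_real \<Longrightarrow> f z = nev_formula a b \<mu> z"
    using h(2) unfolding is_symmetric_extension_def by blast
  then have \<mu>: "sets \<mu> = sets borel" "growth_condition \<mu>" "nevanlinna_condition \<mu>"
    and hf: "\<And>z. z \<in> upper_poly \<Longrightarrow> h z = nev_formula a b \<mu> z"
    unfolding has_triple_def by auto
  have "(vec \<i> :: complex ^ 'n) \<in> off_real" by (simp add: off_real_Im)
  then have "b $ j = 0" for j
    by (intro nev_formula_linear_coefficient[OF \<mu>(1,2) f] growth)
  then have b: "b = 0" by (simp add: vec_eq_iff)
  have "\<forall>z\<in>upper_poly. Im (f z) \<ge> 0"
    using h(1) f hf upper_poly_subset_off_real unfolding herglotz_nevanlinna_def by force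
  moreover have "symmetry_formula f"
    unfolding symmetry_formula_def
  proof
    fix z :: "complex ^ 'n" assume z: "z \<in> off_real"
    have "f z = nev_formula a 0 \<mu> z" using f[OF z] b by simp
    also have "\<dots> = (\<Sum>B | B \<noteq> {}. (-1) ^ (card B + 1) * cnj (nev_formula a 0 \<mu> (Psi B (vec \<i>) z)))"
      using nev_formula_symmetry[OF \<mu>(1,2), of a] z unfolding symmetry_formula_def by blast
    also have "\<dots> = (\<Sum>B | B \<noteq> {}. (-1) ^ (card B + 1) * cnj (f (Psi B (vec \<i>) z)))"
      by (simp only: f[OF Psi_off_real[OF z]] b)
    finally show "f z = (\<Sum>B | B \<noteq> {}. (-1) ^ (card B + 1) * cnj (f (Psi B (vec \<i>) z)))" .
  qed
  moreover have "variable_non_dependence f"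
    unfolding variable_non_dependence_def
  proof (intro ballI impI)
    fix z w :: "complex ^ 'n"
    assume zw: "z \<in> off_real" "w \<in> off_real" and "{j. Im (z $ j) < 0} = {j. Im (w $ j) < 0}"
      "{j. Im (z $ j) < 0} \<noteq> {}" "\<forall>j. Im (z $ j) < 0 \<longrightarrow> z $ j = w $ j"
    then have "nev_formula a 0 \<mu> z = nev_formula a 0 \<mu> w"
      using nev_formula_nondependence[OF \<mu>, of a] unfolding variable_non_dependence_def by blast
    then show "f z = f w" by (simp only: f[OF zw(1)] f[OF zw(2)] b)
  qed
  ultimately show ?thesis by blast
qed

section \<open>Cauchy integrals over the torus\<close>

definition circle_pt :: "real \<Rightarrow> complex" where
  "circle_pt x = cis (2 * pi * x)"

text \<open>Lebesgue measure of the unit interval, extended by zero to the whole line rather than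
  restricted. Its finite powers then carry the full Borel sigma-algebra, as the compactness theorem
  requires.\<close>

definition unit_measure :: "real measure" where
  "unit_measure = density lborel (\<lambda>x. ennreal (indicator {0..1} x))"

definition cauchy_kernel :: "complex \<Rightarrow> real \<Rightarrow> complex" where
  "cauchy_kernel w x = 1 / (1 - w * cnj (circle_pt x))"

lemma norm_circle_pt [simp]: "norm (circle_pt x) = 1"
  unfolding circle_pt_def by simp

lemma circle_pt_frac: "circle_pt (frac x) = circle_pt x"
proof -
  have "cis (2 * pi * frac x) = cis (2 * pi * x - 2 * pi * of_int \<lfloor>x\<rfloor>)"
    by (simp add: frac_def algebra_simps)
  also have "\<dots> = cis (2 * pi * x) / cis (2 * pi * of_int \<lfloor>x\<rfloor>)"
    by (simp only: cis_divide)
  also have "cis (2 * pi * of_int \<lfloor>x\<rfloor>) = 1"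
    by (rule cis_multiple_2pi) simp
  finally show ?thesis
    unfolding circle_pt_def by simp
qed

lemma continuous_on_circle_pt [continuous_intros]:
  "continuous_on A f \<Longrightarrow> continuous_on A (\<lambda>x. circle_pt (f x))"
  unfolding circle_pt_def cis_conv_exp by (intro continuous_intros)

lemma prob_space_unit_measure: "prob_space unit_measure"
proof
  show "emeasure unit_measure (space unit_measure) = 1"
    unfolding unit_measure_def by (subst emeasure_density) (auto simp: ennreal_indicator)
qed

lemma sets_unit_measure [simp, measurable_cong]: "sets unit_measure = sets borel"
  unfolding unit_measure_def by simp

lemma space_unit_measure [simp]: "space unit_measure = UNIV"
  unfolding unit_measure_def by simp

lemma integral_unit_measure:
  fixes g :: "real \<Rightarrow> complex"
  assumes "continuous_on UNIV g" "(g has_integral I) {0..1}"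
  shows "(\<integral>x. g x \<partial>unit_measure) = I"
proof -
  have "set_integrable lborel {0..1} g"
    using assms(1) continuous_on_subset by (intro borel_integrable_atLeastAtMost') blast
  from set_borel_integral_eq_integral(2)[OF this]
  have "(\<integral>x. indicator {0..1} x *\<^sub>R g x \<partial>lborel) = I"
    using assms(2) unfolding set_lebesgue_integral_def by (simp add: integral_unique)
  moreover have "g \<in> borel_measurable borel"
    by (rule borel_measurable_continuous_onI[OF assms(1)])
  ultimately show ?thesis
    unfolding unit_measure_def by (subst integral_density) auto
qed

lemma one_minus_circle_neq:
  assumes "norm w < 1"
  shows "1 - w * cnj (circle_pt x) \<noteq> 0"
proof
  assume "1 - w * cnj (circle_pt x) = 0"
  then have "norm (w * cnj (circle_pt x)) = 1" by (simp add: eq_commute[of 1])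
  then show False using assms by (simp add: norm_mult)
qed

lemma continuous_cauchy_kernel:
  "norm w < 1 \<Longrightarrow> continuous_on UNIV (cauchy_kernel w)"
  unfolding cauchy_kernel_def using one_minus_circle_neq by (intro continuous_intros) auto

lemma norm_cauchy_kernel_le:
  assumes "norm w < 1"
  shows "norm (cauchy_kernel w x) \<le> 1 / (1 - norm w)"
proof -
  have "1 - norm w \<le> norm (1 - w * cnj (circle_pt x))"
    using norm_triangle_ineq2[of 1 "w * cnj (circle_pt x)"] by (simp add: norm_mult)
  then show ?thesis
    unfolding cauchy_kernel_def norm_divide using assms by (simp add: frac_le)
qed

text \<open>Cauchy's integral formula with the circle parametrized by [0, 1]: the derivative
  contributes \<open>2 * pi * \<i> * circle_pt x\<close>, and since the point times its conjugate is
  1, the quotient of \<open>circle_pt x\<close> by \<open>circle_pt x - w\<close> is the Cauchy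
  kernel.\<close>

lemma cauchy_formula_circle:
  assumes g: "continuous_on (cball 0 1) g" "g holomorphic_on ball 0 1" and w: "norm w < 1"
  shows "(\<integral>x. cauchy_kernel w x * g (circle_pt x) \<partial>unit_measure) = g w"
proof (rule integral_unit_measure)
  show "continuous_on UNIV (\<lambda>x. cauchy_kernel w x * g (circle_pt x))"
  proof (intro continuous_intros continuous_cauchy_kernel w)
    show "continuous_on UNIV (\<lambda>x. g (circle_pt x))"
      by (rule continuous_on_compose2[OF g(1)]) (auto intro!: continuous_intros)
  qed
  have "((\<lambda>u. g u / (u - w)) has_contour_integral 2 * of_real pi * \<i> * g w) (circlepath 0 1)"
    using Cauchy_integral_circlepath[OF g, of w] w by simp
  then have "((\<lambda>x. g (circlepath 0 1 x) / (circlepath 0 1 x - w)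
      * vector_derivative (circlepath 0 1) (at x)) has_integral 2 * of_real pi * \<i> * g w) {0..1}"
    unfolding has_contour_integral .
  then have *: "((\<lambda>x. 1 / (2 * of_real pi * \<i>) * (g (circlepath 0 1 x) / (circlepath 0 1 x - w)
      * vector_derivative (circlepath 0 1) (at x))) has_integral 1 / (2 * of_real pi * \<i>) * (2 * of_real pi * \<i> * g w)) {0..1}"
    by (rule has_integral_mult_right)
  have eq: "1 / (2 * of_real pi * \<i>) * (g (circlepath 0 1 x) / (circlepath 0 1 x - w)
      * vector_derivative (circlepath 0 1) (at x)) = cauchy_kernel w x * g (circle_pt x)" for x
  proof -
    have c: "exp (2 * of_real pi * \<i> * of_real x) = circle_pt x"
      unfolding circle_pt_def cis_conv_exp by (simp add: mult_ac)
    have p: "circlepath 0 1 x = circle_pt x"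
      unfolding circlepath c by simp
    have ne: "circle_pt x \<noteq> 0" "circle_pt x - w \<noteq> 0"
      using norm_circle_pt[of x] w by (auto simp del: norm_circle_pt)
    have "circle_pt x * cnj (circle_pt x) = 1"
      by (simp add: complex_norm_square[symmetric])
    then have eq: "circle_pt x - w = circle_pt x * (1 - w * cnj (circle_pt x))"
      by (simp add: right_diff_distrib mult.left_commute)
    have k: "circle_pt x / (circle_pt x - w) = cauchy_kernel w x"
      unfolding cauchy_kernel_def eq using ne(1) by simp
    have v: "vector_derivative (circlepath 0 1) (at x) = 2 * of_real pi * \<i> * circle_pt x"
      unfolding vector_derivative_circlepath c by simp
    have "1 / K * (a / b * (K * d)) = d / b * a" if "K \<noteq> 0" for K a b d :: complex
      using that by simp
    from this[of "2 * of_real pi * \<i>" "g (circle_pt x)" "circle_pt x - w" "circle_pt x"]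
    show ?thesis
      unfolding v p k by simp
  qed
  show "((\<lambda>x. cauchy_kernel w x * g (circle_pt x)) has_integral g w) {0..1}"
    using * unfolding eq by simp
qed

text \<open>A kernel representing evaluation at \<open>u\<close> on the disc algebra. Such kernels
  are far from unique: the Cauchy and Poisson kernels both evaluate at \<open>w\<close>. Against the
  real part of a holomorphic function one needs this property for the kernel and for its conjugate,
  possibly with two different points.\<close>

definition reproducing :: "(real \<Rightarrow> complex) \<Rightarrow> complex \<Rightarrow> bool" where
  "reproducing q u \<longleftrightarrow> norm u < 1 \<and> continuous_on UNIV q \<and> bounded (range q) \<and>
     (\<forall>g. continuous_on (cball 0 1) g \<longrightarrow> g holomorphic_on ball 0 1 \<longrightarrow>
        (\<integral>x. q x * g (circle_pt x) \<partial>unit_measure) = g u)"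

lemma bounded_cauchy_kernel: "norm w < 1 \<Longrightarrow> bounded (range (cauchy_kernel w))"
  using norm_cauchy_kernel_le unfolding bounded_iff by blast

lemma reproducing_cauchy_kernel: "norm w < 1 \<Longrightarrow> reproducing (cauchy_kernel w) w"
  unfolding reproducing_def
  using cauchy_formula_circle continuous_cauchy_kernel bounded_cauchy_kernel by blast

text \<open>On the circle the conjugate kernel is \<open>1 / (1 - cnj w * u)\<close>, itself the
  boundary value of a function in the disc algebra with value 1 at 0. Multiplying it into
  \<open>g\<close> and applying the mean value property gives evaluation at 0.\<close>

lemma reproducing_cnj_cauchy_kernel:
  assumes w: "norm w < 1"
  shows "reproducing (\<lambda>x. cnj (cauchy_kernel w x)) 0"
  unfolding reproducing_def
proof (intro conjI allI impI)
  show "continuous_on UNIV (\<lambda>x. cnj (cauchy_kernel w x))"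
    by (intro continuous_intros continuous_cauchy_kernel w)
  show "bounded (range (\<lambda>x. cnj (cauchy_kernel w x)))"
    using bounded_cauchy_kernel[OF w] by (simp add: bounded_iff)
  fix g :: "complex \<Rightarrow> complex"
  assume g: "continuous_on (cball 0 1) g" "g holomorphic_on ball 0 1"
  have ne: "1 - cnj w * u \<noteq> 0" if "norm u \<le> 1" for u
  proof
    assume "1 - cnj w * u = 0"
    then have "norm (cnj w * u) = 1" by (simp add: eq_commute[of 1])
    then show False using w that mult_mono[of "norm w" "norm w" "norm u" 1] by (simp add: norm_mult)
  qed
  have "(\<integral>x. cauchy_kernel 0 x * (g (circle_pt x) / (1 - cnj w * circle_pt x)) \<partial>unit_measure)
      = g 0 / (1 - cnj w * 0)"
    by (rule cauchy_formula_circle)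
      (use ne g in \<open>auto intro!: continuous_intros holomorphic_intros\<close>)
  then show "(\<integral>x. cnj (cauchy_kernel w x) * g (circle_pt x) \<partial>unit_measure) = g 0"
    by (simp add: cauchy_kernel_def)
qed simp

definition poisson_kernel :: "complex \<Rightarrow> real \<Rightarrow> complex" where
  "poisson_kernel w x = cauchy_kernel w x + cnj (cauchy_kernel w x) - 1"

lemma continuous_bounded_integrable_unit:
  fixes q :: "real \<Rightarrow> complex"
  assumes "continuous_on UNIV q" "bounded (range q)"
  shows "integrable unit_measure q"
proof -
  interpret prob_space unit_measure by (rule prob_space_unit_measure)
  obtain B where "\<And>x. norm (q x) \<le> B" using assms(2) by (auto simp: bounded_iff)
  then show ?thesis
    using borel_measurable_continuous_onI[OF assms(1)] by (intro integrable_const_bound[of _ B]) auto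
qed

lemma reproducing_integrable:
  assumes "reproducing q u" "continuous_on (cball 0 1) g"
  shows "integrable unit_measure (\<lambda>x. q x * g (circle_pt x))"
proof (rule continuous_bounded_integrable_unit)
  have "continuous_on UNIV (\<lambda>x. g (circle_pt x))"
    by (rule continuous_on_compose2[OF assms(2)]) (auto intro!: continuous_intros)
  then show "continuous_on UNIV (\<lambda>x. q x * g (circle_pt x))"
    using assms(1) unfolding reproducing_def by (intro continuous_intros) auto
  have "bounded (g ` cball 0 1)"
    using assms(2) compact_continuous_image compact_cball compact_imp_bounded by blast
  then have "bounded (range (\<lambda>x. g (circle_pt x)))"
    by (rule bounded_subset) auto
  then obtain A B where A: "\<And>x. norm (g (circle_pt x)) \<le> A" and B: "\<And>x. norm (q x) \<le> B"
    using assms(1) unfolding reproducing_def bounded_iff by auto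
  have "norm (q x * g (circle_pt x)) \<le> B * A" for x
    unfolding norm_mult by (intro mult_mono A B) (auto intro: order_trans[OF norm_ge_zero B])
  then show "bounded (range (\<lambda>x. q x * g (circle_pt x)))"
    unfolding bounded_iff by blast
qed

text \<open>The three summands evaluate at \<open>w\<close>, at 0 and again at 0, and the last two
  cancel. The kernel being real, the same holds for its conjugate, which distinguishes it from the
  Cauchy kernel.\<close>

lemma reproducing_poisson_kernel:
  assumes w: "norm w < 1"
  shows "reproducing (poisson_kernel w) w"
proof -
  note 1 = reproducing_cauchy_kernel[OF w]
  note 2 = reproducing_cnj_cauchy_kernel[OF w]
  have 3: "reproducing (\<lambda>x. 1) 0"
    using reproducing_cauchy_kernel[of 0] by (simp add: cauchy_kernel_def[abs_def])
  show ?thesis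
    unfolding reproducing_def
  proof (intro conjI allI impI)
    show "continuous_on UNIV (poisson_kernel w)"
      unfolding poisson_kernel_def by (intro continuous_intros continuous_cauchy_kernel w)
    have "norm (poisson_kernel w x) \<le> 1 / (1 - norm w) + 1 / (1 - norm w) + 1" for x
      unfolding poisson_kernel_def using norm_cauchy_kernel_le[OF w, of x]
      by (intro norm_triangle_le_diff add_mono norm_triangle_le) auto
    then show "bounded (range (poisson_kernel w))" unfolding bounded_iff by blast
    fix g :: "complex \<Rightarrow> complex"
    assume g: "continuous_on (cball 0 1) g" "g holomorphic_on ball 0 1"
    have "(\<integral>x. poisson_kernel w x * g (circle_pt x) \<partial>unit_measure)
        = (\<integral>x. cauchy_kernel w x * g (circle_pt x) + cnj (cauchy_kernel w x) * g (circle_pt x)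
            - 1 * g (circle_pt x) \<partial>unit_measure)"
      unfolding poisson_kernel_def by (simp add: algebra_simps)
    also have "\<dots> = g w + g 0 - g 0"
      using 1 2 3 g unfolding reproducing_def
      by (subst Bochner_Integration.integral_diff Bochner_Integration.integral_add;
          (intro Bochner_Integration.integrable_add reproducing_integrable[OF 1 g(1)]
             reproducing_integrable[OF 2 g(1)] reproducing_integrable[OF 3 g(1)])?)+ simp
    finally show "(\<integral>x. poisson_kernel w x * g (circle_pt x) \<partial>unit_measure) = g w" by simp
  qed (rule w)
qed

section \<open>The polydisc algebra and Cauchy's formula on the torus\<close>

definition closed_polydisc :: "('n \<Rightarrow> complex) set" where
  "closed_polydisc = {z. \<forall>j. norm (z j) \<le> 1}"

text \<open>Holomorphy is asked for one variable at a time, as iterated integration uses it. The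
  base point runs through the closed polydisc because the coordinates still to be integrated lie on
  the unit circle.\<close>

definition polydisc_algebra :: "(('n \<Rightarrow> complex) \<Rightarrow> complex) \<Rightarrow> bool" where
  "polydisc_algebra G \<longleftrightarrow> continuous_on closed_polydisc G \<and>
     (\<forall>z\<in>closed_polydisc. \<forall>j. (\<lambda>u. G (z(j := u))) holomorphic_on ball 0 1)"

lemma compact_closed_polydisc: "compact (closed_polydisc :: ('n \<Rightarrow> complex) set)"
proof -
  have "closed_polydisc = (PiE UNIV (\<lambda>_. cball 0 1) :: ('n \<Rightarrow> complex) set)"
    unfolding closed_polydisc_def by auto
  moreover have "compactin (product_topology (\<lambda>_::'n. euclidean :: complex topology) UNIV) (PiE UNIV (\<lambda>_. cball 0 1))"
    unfolding compactin_PiE by (auto simp: compactin_euclidean_iff)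
  ultimately show ?thesis
    by (simp add: euclidean_product_topology compactin_euclidean_iff)
qed

lemma continuous_on_fun_upd_coordinate:
  "continuous_on A (\<lambda>u. (z :: 'n \<Rightarrow> complex)(j := u))"
proof (rule continuous_on_coordinatewise_then_product)
  show "continuous_on A (\<lambda>u. (z(j := u)) i)" for i
    by (cases "i = j") (auto intro!: continuous_intros)
qed

theorem cauchy_formula_torus:
  fixes G :: "('n::finite \<Rightarrow> complex) \<Rightarrow> complex"
  assumes G: "polydisc_algebra G" and q: "\<And>l. reproducing (q l) (u l)"
  shows "(\<integral>x. (\<Prod>l\<in>UNIV. q l (x l)) * G (\<lambda>l. circle_pt (x l)) \<partial>PiM UNIV (\<lambda>_. unit_measure)) = G u"
    and "integrable (PiM UNIV (\<lambda>_. unit_measure)) (\<lambda>x. (\<Prod>l\<in>UNIV. q l (x l)) * G (\<lambda>l. circle_pt (x l)))"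
proof -
  interpret U: prob_space unit_measure by (rule prob_space_unit_measure)
  interpret product_prob_space "\<lambda>_ :: 'n. unit_measure" UNIV by unfold_locales
  \<comment> \<open>The interpolating points of the induction: coordinates in \<open>I\<close> are
    still to be integrated and lie on the circle, the others have already been evaluated at
    \<open>u\<close>.\<close>
  define pt where "pt I x = (\<lambda>l. if l \<in> I then circle_pt (x l) else u l)" for I x
  have u: "norm (u l) < 1" for l using q unfolding reproducing_def by blast
  have pt: "pt I x \<in> closed_polydisc" for I x
    unfolding pt_def closed_polydisc_def using u by (auto simp: less_imp_le)
  have "bounded (G ` closed_polydisc)"
    using G unfolding polydisc_algebra_def
    by (intro compact_imp_bounded compact_continuous_image compact_closed_polydisc) blast
  then obtain A where A: "\<And>z. z \<in> closed_polydisc \<Longrightarrow> norm (G z) \<le> A"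
    unfolding bounded_iff by blast
  have "\<exists>B. \<forall>x. norm (q l x) \<le> B" for l
    using q[of l] unfolding reproducing_def bounded_iff by auto
  then obtain B where B: "\<And>l x. norm (q l x) \<le> B l" by metis
  have qm [measurable]: "q l \<in> borel_measurable borel" for l
    using q[of l] unfolding reproducing_def by (intro borel_measurable_continuous_onI) blast
  have cm [measurable]: "circle_pt \<in> borel_measurable borel"
    by (intro borel_measurable_continuous_onI continuous_intros)
  \<comment> \<open>Integrability is needed for every \<open>I\<close>, since each induction step
    applies Fubini to the product over one more coordinate.\<close>
  have int: "integrable (PiM I (\<lambda>_. unit_measure)) (\<lambda>x. (\<Prod>l\<in>I. q l (x l)) * G (pt I x))" for I
  proof -
    interpret PI: prob_space "PiM I (\<lambda>_. unit_measure)"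
      by (rule prob_space_PiM) (rule prob_space_unit_measure)
    have comp: "(\<lambda>x. x l) \<in> borel_measurable (PiM I (\<lambda>_. unit_measure))" if "l \<in> I" for l
      using measurable_component_singleton[OF that, of "\<lambda>_. unit_measure"]
        measurable_cong_sets[OF refl sets_unit_measure] by blast
    have "pt I \<in> measurable (PiM I (\<lambda>_. unit_measure)) (PiM UNIV (\<lambda>_. borel))"
    proof (rule measurable_PiM_single')
      show "(\<lambda>x. pt I x l) \<in> borel_measurable (PiM I (\<lambda>_. unit_measure))" for l
        unfolding pt_def using measurable_compose[OF comp cm] by (cases "l \<in> I") auto
    qed (auto simp: space_PiM)
    then have "pt I \<in> borel_measurable (PiM I (\<lambda>_. unit_measure))"
      using measurable_cong_sets[OF refl sets_PiM_equal_borel] by blast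
    then have ptm: "pt I \<in> measurable (PiM I (\<lambda>_. unit_measure)) (restrict_space borel closed_polydisc)"
      using pt by (intro measurable_restrict_space2) auto
    have "G \<in> borel_measurable (restrict_space borel closed_polydisc)"
      using G unfolding polydisc_algebra_def by (intro borel_measurable_continuous_on_restrict) blast
    from measurable_compose[OF ptm this]
    have Gm: "(\<lambda>x. G (pt I x)) \<in> borel_measurable (PiM I (\<lambda>_. unit_measure))" .
    have qpm: "(\<lambda>x. \<Prod>l\<in>I. q l (x l)) \<in> borel_measurable (PiM I (\<lambda>_. unit_measure))"
      by (intro borel_measurable_prod measurable_compose[OF comp qm])
    have "norm ((\<Prod>l\<in>I. q l (x l)) * G (pt I x)) \<le> (\<Prod>l\<in>I. B l) * A" for x
      unfolding norm_mult prod_norm[symmetric]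
      by (intro mult_mono prod_mono A pt conjI B prod_nonneg)
        (auto intro: order_trans[OF norm_ge_zero B])
    then show ?thesis
      using Gm qpm by (intro PI.integrable_const_bound[of _ "(\<Prod>l\<in>I. B l) * A"]) auto
  qed
  have "(\<integral>x. (\<Prod>l\<in>I. q l (x l)) * G (pt I x) \<partial>PiM I (\<lambda>_. unit_measure)) = G u" for I
  proof -
    have "finite I" by simp
    then show ?thesis
    proof (induction I)
      case empty
      have "pt {} x = u" for x unfolding pt_def by simp
      then show ?case by (simp add: PiM_empty lebesgue_integral_count_space_finite)
    next
      case (insert i I)
      have "(\<integral>x. (\<Prod>l\<in>insert i I. q l (x l)) * G (pt (insert i I) x) \<partial>PiM (insert i I) (\<lambda>_. unit_measure))
          = (\<integral>x. (\<integral>y. (\<Prod>l\<in>insert i I. q l ((x(i := y)) l)) * G (pt (insert i I) (x(i := y)))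
              \<partial>unit_measure) \<partial>PiM I (\<lambda>_. unit_measure))"
        by (rule product_integral_insert[OF insert.hyps int])
      also have "\<dots> = (\<integral>x. (\<Prod>l\<in>I. q l (x l)) * G (pt I x) \<partial>PiM I (\<lambda>_. unit_measure))"
      proof (rule Bochner_Integration.integral_cong[OF refl])
        fix x
        have 1: "(\<Prod>l\<in>insert i I. q l ((x(i := y)) l)) = q i y * (\<Prod>l\<in>I. q l (x l))" for y
          using insert.hyps by (subst prod.insert) (auto intro!: prod.cong)
        have 2: "pt (insert i I) (x(i := y)) = (pt I x)(i := circle_pt y)" for y
          unfolding pt_def using insert.hyps by auto
        have 3: "(pt I x)(i := u i) = pt I x"
          unfolding pt_def using insert.hyps by auto
        have c: "continuous_on (cball 0 1) (\<lambda>v. G ((pt I x)(i := v)))"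
          using G pt[of I x] unfolding polydisc_algebra_def
          by (intro continuous_on_compose2[OF _ continuous_on_fun_upd_coordinate])
            (auto simp: closed_polydisc_def)
        have "(\<integral>y. q i y * G ((pt I x)(i := circle_pt y)) \<partial>unit_measure) = G ((pt I x)(i := u i))"
          using q[of i] c G pt[of I x] unfolding reproducing_def polydisc_algebra_def by blast
        then have inner: "(\<integral>y. q i y * G ((pt I x)(i := circle_pt y)) \<partial>unit_measure) = G (pt I x)"
          by (simp only: 3)
        have "q i y * (\<Prod>l\<in>I. q l (x l)) * G ((pt I x)(i := circle_pt y))
            = (\<Prod>l\<in>I. q l (x l)) * (q i y * G ((pt I x)(i := circle_pt y)))" for y
          by (simp only: mult_ac)
        then show "(\<integral>y. (\<Prod>l\<in>insert i I. q l ((x(i := y)) l)) * G (pt (insert i I) (x(i := y))) \<partial>unit_measure)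
            = (\<Prod>l\<in>I. q l (x l)) * G (pt I x)"
          unfolding 1 2 by (simp only: integral_mult_right_zero inner)
      qed
      finally show ?case using insert.IH by simp
    qed
  qed
  from this[of UNIV] int[of UNIV]
  show "(\<integral>x. (\<Prod>l\<in>UNIV. q l (x l)) * G (\<lambda>l. circle_pt (x l)) \<partial>PiM UNIV (\<lambda>_. unit_measure)) = G u"
    "integrable (PiM UNIV (\<lambda>_. unit_measure)) (\<lambda>x. (\<Prod>l\<in>UNIV. q l (x l)) * G (\<lambda>l. circle_pt (x l)))"
    unfolding pt_def by simp_all
qed

section \<open>The representing measure\<close>

text \<open>The measure is a weak limit of the boundary densities \<open>Re F(r e) + 1/k\<close>; the summand \<open>1/k\<close>
  keeps the total masses positive.\<close>

theorem koranyi_pukanszky: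
  fixes F :: "('n::finite \<Rightarrow> complex) \<Rightarrow> complex"
  assumes cont: "continuous_on {w. \<forall>l. norm (w l) < 1} F"
    and hol: "\<And>w j. (\<And>l. norm (w l) < 1) \<Longrightarrow> (\<lambda>u. F (w(j := u))) holomorphic_on ball 0 1"
    and pos: "\<And>w. (\<And>l. norm (w l) < 1) \<Longrightarrow> 0 \<le> Re (F w)"
  obtains L :: "('n \<Rightarrow> real) measure" where "prob_space L" "sets L = sets borel"
    "\<And>q u v. (\<And>l. reproducing (q l) (u l)) \<Longrightarrow> (\<And>l. reproducing (\<lambda>x. cnj (q l x)) (v l)) \<Longrightarrow>
       (\<And>l x. q l (frac x) = q l x) \<Longrightarrow>
       of_real (Re (F (\<lambda>_. 0))) * (\<integral>x. (\<Prod>l\<in>UNIV. q l (x l)) \<partial>L) = (F u + cnj (F v)) / 2"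
proof -
  let ?D = "{w :: 'n \<Rightarrow> complex. \<forall>l. norm (w l) < 1}"
  let ?F0 = "Re (F (\<lambda>_. 0))"
  define U :: "('n \<Rightarrow> real) measure" where "U = PiM UNIV (\<lambda>_. unit_measure)"
  \<comment> \<open>Dilation by \<open>r k < 1\<close> makes the function continuous up to the
    boundary; the index shift by two keeps \<open>r 0\<close> positive.\<close>
  define r where "r k = 1 - inverse (real (Suc (Suc k)))" for k
  define \<epsilon> where "\<epsilon> k = inverse (real (Suc k))" for k
  have r: "0 < r k" "r k < 1" for k
    unfolding r_def by (simp_all add: field_simps)
  have \<epsilon>: "0 < \<epsilon> k" for k unfolding \<epsilon>_def by simp
  define G where "G k z = F (\<lambda>l. of_real (r k) * z l)" for k and z :: "'n \<Rightarrow> complex"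
  define e where "e x = (\<lambda>l. circle_pt (x l))" for x :: "'n \<Rightarrow> real"
  have scale: "norm (of_real (r k) * z) < 1" if "norm z \<le> 1" for k and z :: complex
  proof -
    have "r k * norm z \<le> r k" using r[of k] that by (intro mult_left_le) auto
    moreover have "norm (of_real (r k) * z) = r k * norm z" using r[of k] by (simp add: norm_mult)
    ultimately show ?thesis using r(2)[of k] by linarith
  qed
  have inD: "(\<lambda>l. of_real (r k) * z l) \<in> ?D" if "z \<in> closed_polydisc" for k z
    using that scale unfolding closed_polydisc_def by auto
  have Galg: "polydisc_algebra (G k)" for k
    unfolding polydisc_algebra_def
  proof (intro conjI ballI allI)
    have "continuous_on closed_polydisc (\<lambda>z :: 'n \<Rightarrow> complex. (\<lambda>l. of_real (r k) * z l))"
      by (intro continuous_on_coordinatewise_then_product continuous_intros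
          continuous_on_subset[OF continuous_on_product_coordinates]) auto
    then show "continuous_on closed_polydisc (G k)"
      unfolding G_def using inD by (intro continuous_on_compose2[OF cont]) auto
    fix z :: "'n \<Rightarrow> complex" and j assume z: "z \<in> closed_polydisc"
    have eq: "(\<lambda>u. G k (z(j := u))) = (\<lambda>u. F ((\<lambda>l. of_real (r k) * z l)(j := u))) \<circ> (\<lambda>u. of_real (r k) * u)"
      unfolding G_def comp_def by (intro ext arg_cong[where f=F]) auto
    show "(\<lambda>u. G k (z(j := u))) holomorphic_on ball 0 1"
      unfolding eq
    proof (rule holomorphic_on_compose_gen)
      show "(\<lambda>u. of_real (r k) * u) holomorphic_on ball 0 1" by (intro holomorphic_intros)
      show "(\<lambda>u. F ((\<lambda>l. of_real (r k) * z l)(j := u))) holomorphic_on ball 0 1"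
        using inD[OF z] by (intro hol) auto
      show "(\<lambda>u :: complex. of_real (r k) * u) ` ball 0 1 \<subseteq> ball 0 1"
        using scale by (auto simp: less_imp_le)
    qed
  qed
  have constalg: "polydisc_algebra (\<lambda>_ :: 'n \<Rightarrow> complex. 1)"
    unfolding polydisc_algebra_def by auto
  have e_polydisc: "e x \<in> closed_polydisc" for x
    unfolding e_def closed_polydisc_def by simp
  define \<rho> where "\<rho> k x = Re (G k (e x)) + \<epsilon> k" for k x
  define m where "m k = ?F0 + \<epsilon> k" for k
  have \<rho>_nonneg: "0 \<le> \<rho> k x" for k x
    unfolding \<rho>_def G_def using pos[of "\<lambda>l. of_real (r k) * e x l"] inD[OF e_polydisc, of k x] \<epsilon>[of k]
    by auto
  have m_pos: "0 < m k" for k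
    unfolding m_def using pos[of "\<lambda>_. 0"] \<epsilon>[of k] by simp
  \<comment> \<open>On the torus \<open>\<rho> k\<close> is half of \<open>G k\<close> plus half of
    its conjugate plus \<open>\<epsilon> k\<close>. The kernel \<open>q\<close> evaluates the first
    part at \<open>u\<close>; the second is the conjugate of an integral against
    \<open>cnj q\<close>, hence evaluated at \<open>v\<close>; the constant function 1 takes care of
    the last.\<close>
  have density_formula:
    "integrable U (\<lambda>x. (\<Prod>l\<in>UNIV. q l (x l)) * of_real (\<rho> k x))"
    "(\<integral>x. (\<Prod>l\<in>UNIV. q l (x l)) * of_real (\<rho> k x) \<partial>U) = (G k u + cnj (G k v)) / 2 + of_real (\<epsilon> k)"
    if q: "\<And>l. reproducing (q l) (u l)" "\<And>l. reproducing (\<lambda>x. cnj (q l x)) (v l)" for q u v k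
  proof -
    let ?Q = "\<lambda>x. \<Prod>l\<in>UNIV. q l (x l)"
    note A = cauchy_formula_torus[where q = q and u = u, OF Galg[of k] q(1), folded U_def e_def]
    note B = cauchy_formula_torus[where q = "\<lambda>l x. cnj (q l x)" and u = v, OF Galg[of k] q(2), folded U_def e_def]
    note C = cauchy_formula_torus[where q = q and u = u, OF constalg q(1), folded U_def e_def]
    have B1: "integrable U (\<lambda>x. cnj ((\<Prod>l\<in>UNIV. cnj (q l (x l))) * G k (e x)))"
      using B(2) by (simp only: integrable_cnj)
    have B2: "(\<integral>x. cnj ((\<Prod>l\<in>UNIV. cnj (q l (x l))) * G k (e x)) \<partial>U) = cnj (G k v)"
      unfolding Bochner_Integration.integral_cnj B(1) ..
    have split: "?Q x * of_real (\<rho> k x) = (?Q x * G k (e x)) / 2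
        + cnj ((\<Prod>l\<in>UNIV. cnj (q l (x l))) * G k (e x)) / 2 + (?Q x * 1) * of_real (\<epsilon> k)" for x
    proof -
      have "complex_of_real (\<rho> k x) = (G k (e x) + cnj (G k (e x))) / 2 + of_real (\<epsilon> k)"
        unfolding \<rho>_def by (simp add: complex_add_cnj)
      then show ?thesis by (simp add: algebra_simps add_divide_distrib)
    qed
    show "integrable U (\<lambda>x. ?Q x * of_real (\<rho> k x))"
      unfolding split using A(2) B1 C(2)
      by (intro Bochner_Integration.integrable_add integrable_divide_zero integrable_mult_left) auto
    show "(\<integral>x. ?Q x * of_real (\<rho> k x) \<partial>U) = (G k u + cnj (G k v)) / 2 + of_real (\<epsilon> k)"
    proof -
      have "(\<integral>x. ?Q x * of_real (\<rho> k x) \<partial>U) = (\<integral>x. (?Q x * G k (e x)) / 2 \<partial>U)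
        + (\<integral>x. cnj ((\<Prod>l\<in>UNIV. cnj (q l (x l))) * G k (e x)) / 2 \<partial>U)
        + (\<integral>x. (?Q x * 1) * of_real (\<epsilon> k) \<partial>U)"
        unfolding split using A(2) B1 C(2)
        by (subst Bochner_Integration.integral_add Bochner_Integration.integral_add;
            (intro Bochner_Integration.integrable_add integrable_divide_zero integrable_mult_left)?)+ auto
      also have "\<dots> = G k u / 2 + cnj (G k v) / 2 + 1 * of_real (\<epsilon> k)"
        unfolding integral_divide_zero integral_mult_left_zero A(1) B2 using C(1) by simp
      finally show ?thesis by (simp add: add_divide_distrib)
    qed
  qed
  have one: "reproducing (\<lambda>x. 1) 0" "reproducing (\<lambda>x. cnj 1) 0"
    using reproducing_cauchy_kernel[of 0] by (simp_all add: cauchy_kernel_def[abs_def])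
  have G0: "G k (\<lambda>_. 0) = F (\<lambda>_. 0)" for k unfolding G_def by simp
  have mass: "integrable U (\<rho> k)" "(\<integral>x. \<rho> k x \<partial>U) = m k" for k
  proof -
    have i: "integrable U (\<lambda>x. complex_of_real (\<rho> k x))"
      using density_formula(1)[of "\<lambda>_ _. 1" "\<lambda>_. 0" "\<lambda>_. 0" k] one by simp
    then show "integrable U (\<rho> k)"
      using Bochner_Integration.integrable_Re[OF i] by simp
    have "(\<integral>x. complex_of_real (\<rho> k x) \<partial>U) = of_real (m k)"
      using density_formula(2)[of "\<lambda>_ _. 1" "\<lambda>_. 0" "\<lambda>_. 0" k] one G0
      by (simp add: m_def complex_add_cnj)
    then show "(\<integral>x. \<rho> k x \<partial>U) = m k"
      by (simp only: integral_complex_of_real of_real_eq_iff)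
  qed
  define P where "P k = density U (\<lambda>x. ennreal (\<rho> k x / m k))" for k
  have \<rho>m [measurable]: "\<rho> k \<in> borel_measurable U" for k
    using mass(1) by (rule borel_measurable_integrable)
  have setsU: "sets U = sets borel"
    unfolding U_def sets_PiM_equal_borel[symmetric] by (intro sets_PiM_cong) auto
  have setsP: "sets (P k) = sets borel" for k unfolding P_def using setsU by simp
  have probP: "prob_space (P k)" for k
  proof
    have "emeasure (P k) (space (P k)) = (\<integral>\<^sup>+ x. ennreal (\<rho> k x / m k) \<partial>U)"
      unfolding P_def by (subst emeasure_density) (auto intro!: nn_integral_cong)
    also have "\<dots> = ennreal (\<integral>x. \<rho> k x / m k \<partial>U)"
      using mass(1)[of k] \<rho>_nonneg m_pos[of k]
      by (intro nn_integral_eq_integral) (auto intro: less_imp_le divide_nonneg_pos)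
    also have "\<dots> = 1" using mass(2)[of k] m_pos[of k] by simp
    finally show "emeasure (P k) (space (P k)) = 1" .
  qed
  obtain s L where s: "strict_mono (s :: nat \<Rightarrow> nat)" and L: "prob_space L" "sets L = sets borel"
    and lim: "\<And>g :: ('n \<Rightarrow> real) \<Rightarrow> complex. continuous_on UNIV g \<Longrightarrow> bounded (range g) \<Longrightarrow>
       (\<And>x. g (\<lambda>i. frac (x i)) = g x) \<Longrightarrow>
       (\<lambda>k. integral\<^sup>L (P (s k)) g) \<longlonglongrightarrow> integral\<^sup>L L g"
  proof (rule torus_weak_compactness[of P, OF probP setsP])
    fix s :: "nat \<Rightarrow> nat" and L :: "('n \<Rightarrow> real) measure"
    assume sL: "strict_mono s" "prob_space L" "sets L = sets borel"
      and g: "\<And>g :: ('n \<Rightarrow> real) \<Rightarrow> complex. continuous_on UNIV g \<Longrightarrow> bounded (range g) \<Longrightarrow>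
       (\<And>x. g (\<lambda>i. frac (x i)) = g x) \<Longrightarrow>
       (\<lambda>k. integral\<^sup>L (P (s k)) g) \<longlonglongrightarrow> integral\<^sup>L L g"
    show thesis by (rule that[OF sL g])
  qed
  have "\<epsilon> \<longlonglongrightarrow> 0" unfolding \<epsilon>_def by (rule LIMSEQ_inverse_real_of_nat)
  then have \<epsilon>_lim: "(\<lambda>k. \<epsilon> (s k)) \<longlonglongrightarrow> 0"
    using LIMSEQ_subseq_LIMSEQ[OF _ s] by (simp add: comp_def)
  have "r \<longlonglongrightarrow> 1 - 0"
    unfolding r_def using LIMSEQ_Suc[OF LIMSEQ_inverse_real_of_nat] by (intro tendsto_intros)
  then have r_lim: "(\<lambda>k. r (s k)) \<longlonglongrightarrow> 1"
    using LIMSEQ_subseq_LIMSEQ[OF _ s] by (simp add: comp_def)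
  have G_lim: "(\<lambda>k. G (s k) w) \<longlonglongrightarrow> F w" if w: "\<And>l. norm (w l) < 1" for w
  proof -
    have "continuous_on {0..1} (\<lambda>t. F (\<lambda>l. of_real t * w l))"
    proof (rule continuous_on_compose2[OF cont])
      show "continuous_on {0..1} (\<lambda>t :: real. (\<lambda>l. of_real t * w l))"
        by (intro continuous_on_coordinatewise_then_product continuous_intros)
      have "norm (of_real t * w l) < 1" if "t \<in> {0..1}" for t l
      proof -
        have "t * norm (w l) \<le> 1 * norm (w l)" using that by (intro mult_right_mono) auto
        moreover have "norm (of_real t * w l) = t * norm (w l)" using that by (simp add: norm_mult)
        ultimately show ?thesis using w[of l] by linarith
      qed
      then show "(\<lambda>t. (\<lambda>l. of_real t * w l)) ` {0..1} \<subseteq> ?D" by auto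
    qed
    from continuous_on_tendsto_compose[OF this r_lim]
    have "(\<lambda>k. F (\<lambda>l. of_real (r (s k)) * w l)) \<longlonglongrightarrow> F (\<lambda>l. of_real 1 * w l)"
      using r by (simp add: less_imp_le)
    then show ?thesis unfolding G_def by simp
  qed
  have "of_real ?F0 * (\<integral>x. (\<Prod>l\<in>UNIV. q l (x l)) \<partial>L) = (F u + cnj (F v)) / 2"
    if q: "\<And>l. reproducing (q l) (u l)" "\<And>l. reproducing (\<lambda>x. cnj (q l x)) (v l)"
      and per: "\<And>l x. q l (frac x) = q l x" for q u v
  proof -
    let ?g = "\<lambda>x. \<Prod>l\<in>UNIV. q l (x l)"
    have qc: "continuous_on UNIV (q l)" and "bounded (range (q l))"
      and uv: "norm (u l) < 1" "norm (v l) < 1" for l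
      using q[of l] unfolding reproducing_def by auto
    then have "\<exists>B. \<forall>x. norm (q l x) \<le> B" for l unfolding bounded_iff by auto
    then obtain B where B: "\<And>l x. norm (q l x) \<le> B l" by metis
    have gc: "continuous_on UNIV ?g"
      by (intro continuous_intros continuous_on_compose2[OF qc continuous_on_product_coordinates]) auto
    have "norm (?g x) \<le> (\<Prod>l\<in>UNIV. B l)" for x
      unfolding prod_norm[symmetric] by (intro prod_mono conjI B) auto
    then have gb: "bounded (range ?g)" unfolding bounded_iff by blast
    \<comment> \<open>The mass is kept as a factor and not divided out, so the limit is meaningful
      also when \<open>Re (F 0)\<close> is 0.\<close>
    have Pint: "of_real (m k) * integral\<^sup>L (P k) ?g = (G k u + cnj (G k v)) / 2 + of_real (\<epsilon> k)" for k
    proof -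
      have "?g \<in> borel_measurable U"
        using borel_measurable_continuous_onI[OF gc] measurable_cong_sets[OF setsU refl] by blast
      then have "integral\<^sup>L (P k) ?g = (\<integral>x. (\<rho> k x / m k) *\<^sub>R ?g x \<partial>U)"
        unfolding P_def using divide_nonneg_pos[OF \<rho>_nonneg m_pos]
        by (intro integral_density) auto
      also have "\<dots> = (\<integral>x. (?g x * of_real (\<rho> k x)) / of_real (m k) \<partial>U)"
        by (simp add: scaleR_conv_of_real mult_ac)
      finally show ?thesis
        using density_formula(2)[where q = q and u = u and v = v and k = k, OF q] m_pos[of k] by simp
    qed
    have "(\<lambda>k. of_real (m (s k)) * integral\<^sup>L (P (s k)) ?g) \<longlonglongrightarrow> of_real (?F0 + 0) * integral\<^sup>L L ?g"
      unfolding m_def using gc gb per by (intro tendsto_intros \<epsilon>_lim lim) auto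
    moreover have "(\<lambda>k. of_real (m (s k)) * integral\<^sup>L (P (s k)) ?g) \<longlonglongrightarrow> (F u + cnj (F v)) / 2 + of_real 0"
      unfolding Pint by (intro tendsto_intros \<epsilon>_lim G_lim uv) auto
    ultimately show ?thesis using LIMSEQ_unique by fastforce
  qed
  with L show thesis by (rule that)
qed

section \<open>The Cayley transform and the representation on the upper poly-half-plane\<close>

definition cayley :: "complex \<Rightarrow> complex" where
  "cayley w = \<i> * ((1 + w) / (1 - w))"

definition cayley_inv :: "complex \<Rightarrow> complex" where
  "cayley_inv z = (z - \<i>) / (z + \<i>)"

lemma one_minus_neq_disc: "norm (w :: complex) < 1 \<Longrightarrow> 1 - w \<noteq> 0"
  by auto

lemma Im_cayley_pos:
  assumes "norm w < 1"
  shows "0 < Im (cayley w)"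
proof -
  have "(norm w)\<^sup>2 < 1" using assms by (simp add: abs_square_less_1)
  then have "0 < Re ((1 + w) * cnj (1 - w))"
    unfolding cmod_power2 by (simp add: algebra_simps power2_eq_square)
  then have "0 < Re ((1 + w) / (1 - w))" by (simp only: Re_complex_div_gt_0)
  then show ?thesis unfolding cayley_def by (simp only: Im_i_times)
qed

lemma norm_cayley_inv_less:
  assumes "0 < Im z"
  shows "norm (cayley_inv z) < 1"
proof -
  have ne: "z + \<i> \<noteq> 0" using assms by (auto simp: complex_eq_iff)
  have "(Re z)\<^sup>2 + (Im z - 1)\<^sup>2 < (Re z)\<^sup>2 + (Im z + 1)\<^sup>2"
    using assms by (simp add: power2_eq_square algebra_simps)
  then have "norm (z - \<i>) < norm (z + \<i>)"
    unfolding cmod_def by (simp add: real_sqrt_less_mono)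
  then show ?thesis unfolding cayley_inv_def norm_divide using ne by simp
qed

lemma cayley_cayley_inv:
  assumes "0 < Im z"
  shows "cayley (cayley_inv z) = z"
proof -
  have ne: "z + \<i> \<noteq> 0" using assms by (auto simp: complex_eq_iff)
  have "1 + cayley_inv z = 2 * z / (z + \<i>)" "1 - cayley_inv z = 2 * \<i> / (z + \<i>)"
    unfolding cayley_inv_def using ne by (simp_all add: field_simps)
  then show ?thesis unfolding cayley_def using ne by simp
qed

text \<open>The chain rule for real derivatives along the embedding of the \<open>j\<close>-th
  coordinate line. Complex linearity of \<open>D\<close> is what makes the resulting derivative
  multiplication by a complex number.\<close>

lemma holomorphic_sv_one_variable:
  fixes f :: "complex ^ 'n \<Rightarrow> complex"
  assumes f: "holomorphic_sv f S" and g: "g holomorphic_on T" and T: "open T"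
    and S: "\<And>u. u \<in> T \<Longrightarrow> upd_comp z j (g u) \<in> S"
  shows "(\<lambda>u. f (upd_comp z j (g u))) holomorphic_on T"
  unfolding holomorphic_on_open[OF T]
proof (intro ballI)
  fix u assume u: "u \<in> T"
  define B where "B a = a *s (axis j 1 :: complex ^ 'n)" for a
  have "linear B"
    unfolding B_def by (intro linearI) (auto simp: vec_eq_iff algebra_simps)
  then have B: "bounded_linear B" by (rule linear_conv_bounded_linear[THEN iffD1])
  have p: "upd_comp z j v = upd_comp z j 0 + B v" for v
    unfolding upd_comp_def B_def by (auto simp: vec_eq_iff axis_def)
  obtain c where c: "(g has_field_derivative c) (at u)"
    using g u unfolding holomorphic_on_open[OF T] by blast
  obtain D where D: "(f has_derivative D) (at (upd_comp z j (g u)))" and lin: "\<And>c v. D (c *s v) = c * D v"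
    using f S[OF u] unfolding holomorphic_sv_def by blast
  have "((\<lambda>v. B (g v)) has_derivative (\<lambda>h. B (c * h))) (at u)"
    using bounded_linear.has_derivative[OF B c[unfolded has_field_derivative_def]] .
  from has_derivative_add[OF has_derivative_const[of "upd_comp z j 0"] this]
  have "((\<lambda>v. upd_comp z j (g v)) has_derivative (\<lambda>h. B (c * h))) (at u)"
    unfolding p[symmetric] by simp
  from has_derivative_compose[OF this D]
  have "((\<lambda>v. f (upd_comp z j (g v))) has_derivative (\<lambda>h. D (B (c * h)))) (at u)" .
  moreover have "(\<lambda>h. D (B (c * h))) = (*) (c * D (axis j 1))"
    unfolding B_def lin by (auto simp: mult_ac)
  ultimately show "\<exists>f'. ((\<lambda>v. f (upd_comp z j (g v))) has_field_derivative f') (at u)"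
    unfolding has_field_derivative_def by auto
qed

lemma holomorphic_sv_continuous_on:
  "holomorphic_sv f S \<Longrightarrow> continuous_on S f"
  unfolding holomorphic_sv_def
  by (intro continuous_at_imp_continuous_on ballI) (blast intro: has_derivative_continuous)

lemma holomorphic_sv_subset: "holomorphic_sv f S \<Longrightarrow> T \<subseteq> S \<Longrightarrow> holomorphic_sv f T"
  unfolding holomorphic_sv_def by blast

lemma cauchy_kernel_frac: "cauchy_kernel w (frac x) = cauchy_kernel w x"
  unfolding cauchy_kernel_def circle_pt_frac ..

text \<open>The function \<open>F = - \<i> * f\<close> in disc coordinates has real part
  \<open>Im f\<close>. Products of Cauchy kernels have the evaluation points \<open>(w, 0)\<close>,
  products of Poisson kernels, being real, have \<open>(w, w)\<close>. That one measure serves both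
  is what later yields the Nevanlinna condition.\<close>

lemma torus_representation:
  fixes f :: "complex ^ 'n \<Rightarrow> complex"
  assumes holo: "holomorphic_sv f upper_poly" and Im: "\<And>z. z \<in> upper_poly \<Longrightarrow> 0 \<le> Im (f z)"
  obtains L :: "('n \<Rightarrow> real) measure" where "prob_space L" "sets L = sets borel"
    "\<And>z. z \<in> upper_poly \<Longrightarrow> of_real (Im (f (vec \<i>))) * (\<integral>x. (\<Prod>l\<in>UNIV. cauchy_kernel (cayley_inv (z $ l)) (x l)) \<partial>L)
       = (f z - cnj (f (vec \<i>))) / (2 * \<i>)"
    "\<And>z. z \<in> upper_poly \<Longrightarrow> of_real (Im (f (vec \<i>))) * (\<integral>x. (\<Prod>l\<in>UNIV. poisson_kernel (cayley_inv (z $ l)) (x l)) \<partial>L)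
       = of_real (Im (f z))"
proof -
  define \<Phi> :: "('n \<Rightarrow> complex) \<Rightarrow> complex ^ 'n" where "\<Phi> w = (\<chi> l. cayley (w l))" for w
  define F where "F w = - \<i> * f (\<Phi> w)" for w
  have \<Phi>: "\<Phi> w \<in> upper_poly" if "\<And>l. norm (w l) < 1" for w
    unfolding \<Phi>_def upper_poly_def using that Im_cayley_pos by simp
  have \<Phi>0: "\<Phi> (\<lambda>_. 0) = vec \<i>" unfolding \<Phi>_def cayley_def by (simp add: vec_eq_iff)
  have cont: "continuous_on {w. \<forall>l. norm (w l) < 1} F"
    unfolding F_def
  proof (intro continuous_intros continuous_on_compose2[OF holomorphic_sv_continuous_on[OF holo]])
    show "continuous_on {w. \<forall>l. norm (w l) < 1} \<Phi>"
      unfolding \<Phi>_def cayley_def using one_minus_neq_disc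
      by (intro continuous_on_vec_lambda continuous_intros
          continuous_on_subset[OF continuous_on_product_coordinates]) auto
  qed (use \<Phi> in auto)
  have hol: "(\<lambda>u. F (w(j := u))) holomorphic_on ball 0 1" if w: "\<And>l. norm (w l) < 1" for w j
  proof -
    have eq: "\<Phi> (w(j := u)) = upd_comp (\<Phi> w) j (cayley u)" for u
      unfolding \<Phi>_def upd_comp_def by (simp add: vec_eq_iff)
    have "(\<lambda>u. f (upd_comp (\<Phi> w) j (cayley u))) holomorphic_on ball 0 1"
    proof (rule holomorphic_sv_one_variable[OF holo])
      show "cayley holomorphic_on ball 0 1"
        unfolding cayley_def using one_minus_neq_disc by (intro holomorphic_intros) auto
      show "upd_comp (\<Phi> w) j (cayley u) \<in> upper_poly" if "u \<in> ball 0 1" for u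
        unfolding eq[symmetric] using w that by (intro \<Phi>) auto
    qed simp
    then show ?thesis unfolding F_def eq by (intro holomorphic_intros)
  qed
  have pos: "0 \<le> Re (F w)" if "\<And>l. norm (w l) < 1" for w
    unfolding F_def using Im[OF \<Phi>[OF that]] by simp
  obtain L where L: "prob_space L" "sets L = sets borel" and rep:
    "\<And>q u v. (\<And>l. reproducing (q l) (u l)) \<Longrightarrow> (\<And>l. reproducing (\<lambda>x. cnj (q l x)) (v l)) \<Longrightarrow>
       (\<And>l x. q l (frac x) = q l x) \<Longrightarrow>
       of_real (Re (F (\<lambda>_. 0))) * (\<integral>x. (\<Prod>l\<in>UNIV. q l (x l)) \<partial>L) = (F u + cnj (F v)) / 2"
  proof (rule koranyi_pukanszky[OF cont hol pos])
    fix L :: "('n \<Rightarrow> real) measure"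
    assume 1: "prob_space L" "sets L = sets borel" and 2: 
      "\<And>q u v. (\<And>l. reproducing (q l) (u l)) \<Longrightarrow> (\<And>l. reproducing (\<lambda>x. cnj (q l x)) (v l)) \<Longrightarrow>
       (\<And>l x. q l (frac x) = q l x) \<Longrightarrow>
       of_real (Re (F (\<lambda>_. 0))) * (\<integral>x. (\<Prod>l\<in>UNIV. q l (x l)) \<partial>L) = (F u + cnj (F v)) / 2"
    show thesis by (rule that[OF 1 2])
  qed
  have F0: "Re (F (\<lambda>_. 0)) = Im (f (vec \<i>))" "cnj (F (\<lambda>_. 0)) = \<i> * cnj (f (vec \<i>))"
    unfolding F_def \<Phi>0 by simp_all
  have z: "norm (cayley_inv (z $ l)) < 1" if "z \<in> upper_poly" for z :: "complex ^ 'n" and l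
    using that norm_cayley_inv_less unfolding upper_poly_def by simp
  have Fz: "F (\<lambda>l. cayley_inv (z $ l)) = - \<i> * f z" if "z \<in> upper_poly" for z
  proof -
    have "\<Phi> (\<lambda>l. cayley_inv (z $ l)) = z"
      unfolding \<Phi>_def using that cayley_cayley_inv by (simp add: vec_eq_iff upper_poly_def)
    then show ?thesis unfolding F_def by simp
  qed
  show thesis
  proof (rule that[OF L])
    fix z :: "complex ^ 'n" assume zu: "z \<in> upper_poly"
    have rot: "(- \<i> * a + \<i> * b) / 2 = (a - b) / (2 * \<i>)" for a b
      by (simp add: eq_divide_eq) (simp add: algebra_simps)
    show "of_real (Im (f (vec \<i>))) * (\<integral>x. (\<Prod>l\<in>UNIV. cauchy_kernel (cayley_inv (z $ l)) (x l)) \<partial>L)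
       = (f z - cnj (f (vec \<i>))) / (2 * \<i>)"
      using rep[of "\<lambda>l. cauchy_kernel (cayley_inv (z $ l))" "\<lambda>l. cayley_inv (z $ l)" "\<lambda>_. 0"]
        reproducing_cauchy_kernel[OF z[OF zu]] reproducing_cnj_cauchy_kernel[OF z[OF zu]]
      unfolding F0 Fz[OF zu] rot by (simp add: cauchy_kernel_frac)
    have real: "cnj (poisson_kernel w x) = poisson_kernel w x" for w x
      unfolding poisson_kernel_def by simp
    have per: "poisson_kernel w (frac x) = poisson_kernel w x" for w x
      unfolding poisson_kernel_def cauchy_kernel_frac ..
    have "of_real (Re (F (\<lambda>_. 0))) * (\<integral>x. (\<Prod>l\<in>UNIV. poisson_kernel (cayley_inv (z $ l)) (x l)) \<partial>L)
        = (F (\<lambda>l. cayley_inv (z $ l)) + cnj (F (\<lambda>l. cayley_inv (z $ l)))) / 2"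
      by (rule rep) (simp_all only: real per reproducing_poisson_kernel[OF z[OF zu]])
    then have "of_real (Im (f (vec \<i>))) * (\<integral>x. (\<Prod>l\<in>UNIV. poisson_kernel (cayley_inv (z $ l)) (x l)) \<partial>L)
       = (- \<i> * f z + cnj (- \<i> * f z)) / 2"
      unfolding F0 Fz[OF zu] .
    also have "\<dots> = of_real (Im (f z))" by (simp add: complex_eq_iff)
    finally show "of_real (Im (f (vec \<i>))) * (\<integral>x. (\<Prod>l\<in>UNIV. poisson_kernel (cayley_inv (z $ l)) (x l)) \<partial>L)
       = of_real (Im (f z))" .
  qed
qed

section \<open>Passage from the torus to Euclidean space\<close>

lemma closed_circle_pt_eq_one: "closed {x :: 'n \<Rightarrow> real. circle_pt (x j) = 1}"
proof -
  have "continuous_on UNIV (\<lambda>x :: 'n \<Rightarrow> real. x j)" by (rule continuous_on_product_coordinates)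
  then show ?thesis
    by (intro closed_Collect_eq continuous_on_const continuous_on_circle_pt)
qed

text \<open>Along \<open>z\<^sub>j = \<i> * y\<close>, with the other variables at i, the Cauchy
  kernel divided by \<open>y\<close> tends boundedly to half the indicator of the set where the
  \<open>j\<close>-th boundary point is 1: there it equals \<open>(1 + y) / (2 * y)\<close>,
  elsewhere the kernel itself stays bounded. The integrals thus tend to half the mass of that set,
  while the representation and the growth of \<open>f\<close> send \<open>c\<close> times them to
  0.\<close>

lemma no_mass_at_infinity:
  fixes f :: "complex ^ 'n \<Rightarrow> complex" and L :: "('n \<Rightarrow> real) measure"
  assumes L: "prob_space L" "sets L = sets borel"
    and rep: "\<And>z. z \<in> upper_poly \<Longrightarrow> of_real c * (\<integral>x. (\<Prod>l\<in>UNIV. cauchy_kernel (cayley_inv (z $ l)) (x l)) \<partial>L)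
       = (f z - b) / (2 * \<i>)"
    and growth: "nontangential_upper (\<lambda>w. f (upd_comp (vec \<i>) j w) / w) 0"
  shows "c * measure L {x. circle_pt (x j) = 1} = 0"
proof -
  interpret L: prob_space L by (rule L(1))
  define y where "y n = complex_of_nat (Suc n)" for n
  \<comment> \<open>The disc coordinate \<open>(y - 1) / (y + 1)\<close> of \<open>\<i> * y\<close>
    for \<open>y = n + 1\<close>.\<close>
  define w where "w n = complex_of_real (1 - 2 * inverse (real (Suc (Suc n))))" for n
  have y: "y n \<noteq> 0" "norm (y n) = real (Suc n)" for n unfolding y_def by (simp_all del: of_nat_Suc)
  have wy: "cayley_inv (\<i> * y n) = w n" for n
  proof -
    have "complex_of_nat (Suc (Suc n)) \<noteq> 0" by (simp del: of_nat_Suc)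
    then have "(of_nat (Suc n) - 1) / (of_nat (Suc n) + 1) = 1 - 2 * inverse (complex_of_nat (Suc (Suc n)))"
      by (simp add: field_simps)
    moreover have "cayley_inv (\<i> * y n) = (\<i> * (of_nat (Suc n) - 1)) / (\<i> * (of_nat (Suc n) + 1))"
      unfolding cayley_inv_def y_def by (simp only: right_diff_distrib distrib_left mult_1_right)
    ultimately show ?thesis unfolding w_def by (simp del: of_nat_Suc)
  qed
  have nw: "norm (w n) < 1" "1 / (1 - norm (w n)) = real (Suc (Suc n)) / 2" for n
  proof -
    have gen: "1 - 2 * inverse r < 1" "1 / (1 - (1 - 2 * inverse r)) = r / 2" if "0 < r" for r :: real
      using that by (simp_all add: field_simps)
    have "2 / real (Suc (Suc n)) \<le> 1" by simp
    then have eq: "norm (w n) = 1 - 2 * inverse (real (Suc (Suc n)))"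
      unfolding w_def norm_of_real divide_inverse by (intro abs_of_nonneg) linarith
    show "norm (w n) < 1" "1 / (1 - norm (w n)) = real (Suc (Suc n)) / 2"
      unfolding eq by (rule gen; simp only: of_nat_0_less_iff zero_less_Suc)+
  qed
  define k where "k n x = cauchy_kernel (w n) (x j) / y n" for n and x :: "'n \<Rightarrow> real"
  define A where "A = {x :: 'n \<Rightarrow> real. circle_pt (x j) = 1}"
  have coord: "continuous_on UNIV (\<lambda>x :: 'n \<Rightarrow> real. x j)" by (rule continuous_on_product_coordinates)
  have "closed A"
    unfolding A_def by (rule closed_circle_pt_eq_one)
  then have A: "A \<in> sets L" using L(2) by simp
  have "(\<lambda>n. \<integral>x. k n x \<partial>L) \<longlonglongrightarrow> (\<integral>x. indicator A x / 2 \<partial>L)"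
  proof (rule integral_dominated_convergence[where w = "\<lambda>_. 1"])
    show "(\<lambda>x. indicator A x / 2 :: complex) \<in> borel_measurable L" using A by measurable
    show "k n \<in> borel_measurable L" for n
    proof -
      have "continuous_on UNIV (\<lambda>x. cauchy_kernel (w n) (x j))"
        by (rule continuous_on_compose2[OF continuous_cauchy_kernel[OF nw(1)] coord]) auto
      then have "continuous_on UNIV (k n)"
        unfolding k_def using y(1) by (intro continuous_intros) auto
      then show ?thesis
        using borel_measurable_continuous_onI measurable_cong_sets[OF L(2) refl] by blast
    qed
    show "AE x in L. norm (k n x) \<le> 1" for n
    proof (rule AE_I2)
      fix x
      have "norm (k n x) \<le> (real (Suc (Suc n)) / 2) / real (Suc n)"
        unfolding k_def norm_divide y(2) nw(2)[symmetric]
        by (intro divide_right_mono norm_cauchy_kernel_le nw(1)) simp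
      also have "\<dots> \<le> 1" by (simp add: field_simps)
      finally show "norm (k n x) \<le> 1" .
    qed
    have inv_lim: "(\<lambda>n. inverse (y n)) \<longlonglongrightarrow> 0"
      unfolding y_def using tendsto_of_real[OF LIMSEQ_inverse_real_of_nat, where 'a=complex] by simp
    have "w \<longlonglongrightarrow> of_real (1 - 2 * 0)"
      unfolding w_def using LIMSEQ_Suc[OF LIMSEQ_inverse_real_of_nat] by (intro tendsto_intros)
    then have w_lim: "w \<longlonglongrightarrow> 1" by simp
    show "AE x in L. (\<lambda>n. k n x) \<longlonglongrightarrow> indicator A x / 2"
    proof (rule AE_I2)
      fix x :: "'n \<Rightarrow> real"
      show "(\<lambda>n. k n x) \<longlonglongrightarrow> indicator A x / 2"
      proof (cases "x \<in> A")
        case True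
        have "k n x = 1 / 2 + inverse (y n) / 2" for n
        proof -
          have s: "complex_of_nat (Suc (Suc n)) \<noteq> 0" "complex_of_nat (Suc n) \<noteq> 0"
            by (simp_all del: of_nat_Suc)
          have gen: "1 / (1 - (1 - 2 * inverse a) * cnj 1) = a / 2" for a :: complex
            by (cases "a = 0") (simp_all add: field_simps)
          have "cauchy_kernel (w n) (x j) = 1 / (1 - (1 - 2 * inverse (complex_of_nat (Suc (Suc n)))) * cnj 1)"
            using True unfolding cauchy_kernel_def A_def w_def by (simp del: of_nat_Suc)
          then have "cauchy_kernel (w n) (x j) = complex_of_nat (Suc (Suc n)) / 2"
            unfolding gen .
          also have "\<dots> = (1 + y n) / 2" unfolding y_def by simp
          finally show ?thesis unfolding k_def using y(1)[of n] by (simp add: field_simps)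
        qed
        then have "(\<lambda>n. k n x) \<longlonglongrightarrow> 1 / 2 + 0 / 2"
          using inv_lim by (simp only:) (intro tendsto_intros; simp)
        then show ?thesis using True by simp
      next
        case False
        then have "1 - 1 * cnj (circle_pt (x j)) \<noteq> 0"
          unfolding A_def by (metis (mono_tags) complex_cnj_cnj complex_cnj_one eq_iff_diff_eq_0 mem_Collect_eq mult_1)
        then have "(\<lambda>n. 1 / (1 - w n * cnj (circle_pt (x j))) * inverse (y n))
            \<longlonglongrightarrow> 1 / (1 - 1 * cnj (circle_pt (x j))) * 0"
          using w_lim inv_lim by (intro tendsto_intros) auto
        moreover have "k n x = 1 / (1 - w n * cnj (circle_pt (x j))) * inverse (y n)" for n
          unfolding k_def cauchy_kernel_def by (rule divide_inverse)
        ultimately show ?thesis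
          using False by (simp only:) simp
      qed
    qed
  qed auto
  also have "(\<integral>x. indicator A x / 2 \<partial>L) = (\<integral>x. complex_of_real (indicator A x / 2) \<partial>L)"
    by (rule Bochner_Integration.integral_cong) (auto split: split_indicator)
  also have "\<dots> = complex_of_real (measure L A) / 2"
    unfolding integral_complex_of_real using A by simp
  finally have lim1: "(\<lambda>n. \<integral>x. k n x \<partial>L) \<longlonglongrightarrow> complex_of_real (measure L A) / 2" .
  have eq: "of_real c * (\<integral>x. k n x \<partial>L)
      = (f (upd_comp (vec \<i>) j (\<i> * y n)) / (\<i> * y n)) / 2 - b / (2 * \<i>) * inverse (y n)" for n
  proof -
    let ?z = "upd_comp (vec \<i>) j (\<i> * y n) :: complex ^ 'n"
    have zu: "?z \<in> upper_poly" unfolding upper_poly_def upd_comp_def y_def by (auto simp del: of_nat_Suc)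
    have "(\<Prod>l\<in>UNIV. cauchy_kernel (cayley_inv (?z $ l)) (x l)) = cauchy_kernel (w n) (x j)" for x :: "'n \<Rightarrow> real"
      by (subst prod.remove[of _ j])
        (auto simp: upd_comp_def wy cayley_inv_def[of \<i>] cauchy_kernel_def[of 0] intro!: prod.neutral)
    then have "of_real c * (\<integral>x. cauchy_kernel (w n) (x j) \<partial>L) = (f ?z - b) / (2 * \<i>)"
      using rep[OF zu] by simp
    moreover have "(\<integral>x. k n x \<partial>L) = (\<integral>x. cauchy_kernel (w n) (x j) \<partial>L) / y n"
      unfolding k_def by simp
    ultimately have "of_real c * (\<integral>x. k n x \<partial>L) = (f ?z - b) / (2 * \<i>) / y n"
      by simp
    then show ?thesis using y(1)[of n] by (simp add: field_simps)
  qed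
  have "(\<lambda>n. (f (upd_comp (vec \<i>) j (\<i> * y n)) / (\<i> * y n)) / 2 - b / (2 * \<i>) * inverse (y n))
     \<longlonglongrightarrow> 0 / 2 - b / (2 * \<i>) * 0"
  proof (intro tendsto_intros)
    show "(\<lambda>n. f (upd_comp (vec \<i>) j (\<i> * y n)) / (\<i> * y n)) \<longlonglongrightarrow> 0"
      using nontangential_upper_imaginary_axis[OF growth] unfolding y_def .
    show "(\<lambda>n. inverse (y n)) \<longlonglongrightarrow> 0"
      unfolding y_def using tendsto_of_real[OF LIMSEQ_inverse_real_of_nat, where 'a=complex] by simp
  qed simp
  then have "(\<lambda>n. of_real c * (\<integral>x. k n x \<partial>L)) \<longlonglongrightarrow> 0" unfolding eq by simp
  moreover have "(\<lambda>n. of_real c * (\<integral>x. k n x \<partial>L)) \<longlonglongrightarrow> of_real c * (complex_of_real (measure L A) / 2)"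
    by (intro tendsto_intros lim1)
  ultimately have "of_real c * (complex_of_real (measure L A) / 2) = 0"
    using LIMSEQ_unique by blast
  then show ?thesis unfolding A_def by (auto simp: of_real_eq_0_iff)
qed

text \<open>The inverse Cayley transform of the boundary point \<open>circle_pt x\<close>; the junk value at integers \<open>x\<close>
  is harmless because the representing measure does not charge them.\<close>

definition neg_cot :: "real \<Rightarrow> real" where
  "neg_cot x = - (cos (pi * x) / sin (pi * x))"

lemma circle_pt_eq_one: "sin (pi * x) = 0 \<Longrightarrow> circle_pt x = 1"
  unfolding circle_pt_def
  using cos_double_sin[of "pi * x"] sin_double[of "pi * x"]
  by (simp add: complex_eq_iff mult.assoc)

text \<open>With the half-angle point \<open>E = cis (pi * x)\<close> one has
  \<open>circle_pt x = E * E\<close> and \<open>neg_cot x - \<i> = - E / sin (pi * x)\<close>. Both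
  kernels reduce to the same fraction, using \<open>E * E' = 1\<close>.\<close>

lemma szego_neg_cot:
  assumes s: "sin (pi * x) \<noteq> 0" and z: "0 < Im z"
  shows "szego z (neg_cot x) = cauchy_kernel (cayley_inv z) x"
proof -
  define S where "S = complex_of_real (sin (pi * x))"
  define C where "C = complex_of_real (cos (pi * x))"
  define E where "E = C + \<i> * S"
  define E' where "E' = C - \<i> * S"
  have S: "S \<noteq> 0" unfolding S_def using s by simp
  have "C\<^sup>2 + S\<^sup>2 = 1"
    unfolding C_def S_def of_real_power[symmetric] of_real_add[symmetric] by simp
  then have EE: "E * E' = 1"
    unfolding E_def E'_def by (simp add: algebra_simps power2_eq_square)
  have "circle_pt x = cis (pi * x) * cis (pi * x)"
    unfolding circle_pt_def cis_mult by (simp add: algebra_simps)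
  also have "cis (pi * x) = E"
    unfolding E_def C_def S_def by (simp add: complex_eq_iff)
  finally have "circle_pt x = E * E" .
  moreover have "cnj E = E'" unfolding E_def E'_def C_def S_def by simp
  ultimately have cc: "cnj (circle_pt x) = E' * E'" by simp
  have zi: "z + \<i> \<noteq> 0" using z by (auto simp: complex_eq_iff)
  have zn: "C + z * S \<noteq> 0"
  proof
    assume "C + z * S = 0"
    then have "Im z * sin (pi * x) = 0"
      unfolding C_def S_def by (simp add: complex_eq_iff)
    then show False using s z by simp
  qed
  have E: "E \<noteq> 0" using EE by auto
  have t: "complex_of_real (neg_cot x) = - (C / S)"
    unfolding neg_cot_def C_def S_def by simp
  have "szego z (neg_cot x) = (z + \<i>) * E / (2 * \<i> * (C + z * S))"
  proof -
    have "- (C / S) - \<i> = - (E / S)" "- (C / S) - z = - ((C + z * S) / S)"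
      unfolding E_def using S by (simp_all add: field_simps)
    then show ?thesis unfolding szego_def t using S by simp
  qed
  also have "\<dots> = cauchy_kernel (cayley_inv z) x"
  proof -
    have "(1 - cayley_inv z * (E' * E')) * ((z + \<i>) * E) = (z + \<i>) * E - (z - \<i>) * E' * (E * E')"
    proof -
      have w: "cayley_inv z * (z + \<i>) = z - \<i>"
        unfolding cayley_inv_def using zi by simp
      have "(1 - cayley_inv z * (E' * E')) * ((z + \<i>) * E)
          = (z + \<i>) * E - (cayley_inv z * (z + \<i>)) * E' * (E * E')"
        by (subst left_diff_distrib) (simp only: mult_1_left mult_ac)
      then show ?thesis unfolding w .
    qed
    also have "\<dots> = 2 * \<i> * (C + z * S)"
      unfolding EE unfolding E_def E'_def by (simp add: algebra_simps)
    finally have "1 - cayley_inv z * (E' * E') = 2 * \<i> * (C + z * S) / ((z + \<i>) * E)"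
      using zi E by (simp add: eq_divide_eq)
    then show ?thesis unfolding cauchy_kernel_def cc by simp
  qed
  finally show ?thesis .
qed

text \<open>The torus measure is pushed forward by the inverse Cayley transform and multiplied by
  the reciprocal of the Cauchy weight. At the point with all components i every kernel is 1, so
  there the formula reads \<open>a\<close> plus i times the mass of the weighted measure over
  \<open>pi ^ n\<close>; this dictates \<open>a = Re f\<close> and mass
  \<open>pi ^ n * Im f\<close>.\<close>

lemma representing_triple:
  fixes f :: "complex ^ 'n \<Rightarrow> complex"
  assumes holo: "holomorphic_sv f upper_poly" and Im: "\<And>z. z \<in> upper_poly \<Longrightarrow> 0 \<le> Im (f z)"
    and growth: "\<And>j. nontangential_upper (\<lambda>w. f (upd_comp (vec \<i>) j w) / w) 0"
  obtains \<mu> where "has_triple f (Re (f (vec \<i>))) 0 \<mu>"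
proof -
  define c where "c = Im (f (vec \<i>))"
  have viu: "(vec \<i> :: complex ^ 'n) \<in> upper_poly" unfolding upper_poly_def by simp
  have c: "0 \<le> c" unfolding c_def using Im[OF viu] .
  obtain L :: "('n \<Rightarrow> real) measure" where L: "prob_space L" "sets L = sets borel"
    and repC: "\<And>z. z \<in> upper_poly \<Longrightarrow> of_real c * (\<integral>x. (\<Prod>l\<in>UNIV. cauchy_kernel (cayley_inv (z $ l)) (x l)) \<partial>L)
       = (f z - cnj (f (vec \<i>))) / (2 * \<i>)"
    and repP: "\<And>z. z \<in> upper_poly \<Longrightarrow> of_real c * (\<integral>x. (\<Prod>l\<in>UNIV. poisson_kernel (cayley_inv (z $ l)) (x l)) \<partial>L)
       = of_real (Im (f z))"
    unfolding c_def
  proof (rule torus_representation[OF holo Im])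
    fix L :: "('n \<Rightarrow> real) measure"
    assume 1: "prob_space L" "sets L = sets borel"
      and 2: "\<And>z. z \<in> upper_poly \<Longrightarrow> of_real (Im (f (vec \<i>))) * (\<integral>x. (\<Prod>l\<in>UNIV. cauchy_kernel (cayley_inv (z $ l)) (x l)) \<partial>L)
       = (f z - cnj (f (vec \<i>))) / (2 * \<i>)"
      and 3: "\<And>z. z \<in> upper_poly \<Longrightarrow> of_real (Im (f (vec \<i>))) * (\<integral>x. (\<Prod>l\<in>UNIV. poisson_kernel (cayley_inv (z $ l)) (x l)) \<partial>L)
       = of_real (Im (f z))"
    show thesis by (rule that[OF 1 2[folded c_def] 3[folded c_def]])
  qed
  interpret L: prob_space L by (rule L(1))
  have coord [measurable]: "(\<lambda>x :: 'n \<Rightarrow> real. x j) \<in> borel_measurable borel" for j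
    by (intro borel_measurable_continuous_onI continuous_on_product_coordinates)
  define T :: "('n \<Rightarrow> real) \<Rightarrow> real ^ 'n" where "T x = (\<chi> j. neg_cot (x j))" for x
  have "T \<in> borel_measurable borel"
  proof (rule borel_measurable_euclidean_space[THEN iffD2], rule ballI)
    fix b :: "real ^ 'n" assume "b \<in> Basis"
    then obtain j where b: "b = axis j 1" by (auto simp: Basis_vec_def)
    have "(\<lambda>x. neg_cot (x j)) \<in> borel_measurable borel" unfolding neg_cot_def by measurable
    then show "(\<lambda>x. T x \<bullet> b) \<in> borel_measurable borel"
      unfolding T_def b by (simp add: inner_axis)
  qed
  then have Tm [measurable]: "T \<in> borel_measurable L"
    using measurable_cong_sets[OF L(2) refl] by blast
  define C where "C = c * pi ^ CARD('n)"
  have C: "0 \<le> C" unfolding C_def using c by simp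
  \<comment> \<open>Chosen so that multiplication by the Cauchy weight leaves the constant
    \<open>C\<close>: the weighted measure is just \<open>C\<close> times the push-forward of
    \<open>L\<close>.\<close>
  define V where "V t = C * (\<Prod>l\<in>UNIV. 1 + (t $ l)\<^sup>2)" for t :: "real ^ 'n"
  have Vm [measurable]: "V \<in> borel_measurable borel"
  proof -
    have [measurable]: "(\<lambda>t. t $ j) \<in> borel_measurable (borel :: (real ^ 'n) measure)" for j
      by (intro borel_measurable_continuous_onI continuous_intros)
    show ?thesis unfolding V_def by measurable
  qed
  have V0: "0 \<le> V t" for t unfolding V_def using C by (intro mult_nonneg_nonneg prod_nonneg) auto
  define \<mu> where "\<mu> = density (distr L borel T) (\<lambda>t. ennreal (V t))"
  have sets: "sets \<mu> = sets borel" unfolding \<mu>_def by simp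
  have VW: "V t * cauchy_weight t = C" for t
  proof -
    have "(1 + (t $ l)\<^sup>2) * (1 / (1 + (t $ l)\<^sup>2)) = 1" for l
      using zero_le_power2[of "t $ l"] by (simp add: add_nonneg_eq_0_iff)
    then show ?thesis
      unfolding V_def cauchy_weight_def by (simp add: mult.assoc prod.distrib[symmetric])
  qed
  have W: "weighted \<mu> = density (distr L borel T) (\<lambda>t. ennreal C)"
  proof -
    have "weighted \<mu> = density (distr L borel T) (\<lambda>t. ennreal (V t) * ennreal (cauchy_weight t))"
      unfolding weighted_def \<mu>_def by (rule density_density_eq) measurable
    then show ?thesis
      using V0 by (simp add: ennreal_mult'[symmetric] cauchy_weight_nonneg VW)
  qed
  have int_W: "(\<integral>t. g t \<partial>weighted \<mu>) = of_real C * (\<integral>x. g (T x) \<partial>L)"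
    if g: "g \<in> borel_measurable borel" for g :: "real ^ 'n \<Rightarrow> complex"
  proof -
    have "(\<integral>t. g t \<partial>weighted \<mu>) = (\<integral>t. C *\<^sub>R g t \<partial>distr L borel T)"
      unfolding W using g C by (subst integral_density) auto
    also have "\<dots> = (\<integral>x. C *\<^sub>R g (T x) \<partial>L)"
      using g by (subst integral_distr) auto
    finally show ?thesis by (simp add: scaleR_conv_of_real)
  qed
  have emW: "emeasure (weighted \<mu>) UNIV = ennreal C"
  proof -
    have "emeasure (distr L borel T) UNIV = 1"
      by (subst emeasure_distr) (auto simp: L.emeasure_space_1)
    then show ?thesis unfolding W by (subst emeasure_density) auto
  qed
  have growth\<mu>: "growth_condition \<mu>"
  proof -
    have cm: "(\<lambda>t. ennreal (cauchy_weight t)) \<in> borel_measurable \<mu>"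
      using measurable_compose[OF cauchy_weight_measurable measurable_ennreal]
        measurable_cong_sets[OF sets refl] by blast
    have "space \<mu> = UNIV" using sets_eq_imp_space_eq[OF sets] by simp
    then have "(\<integral>\<^sup>+ t. ennreal (cauchy_weight t) \<partial>\<mu>) = emeasure (weighted \<mu>) UNIV"
      unfolding weighted_def using cm by (subst emeasure_density) (auto simp: sets)
    then show ?thesis unfolding growth_condition_def cauchy_weight_def[symmetric] emW by simp
  qed
  \<comment> \<open>\<open>G\<close> is arbitrary so that the Cauchy products and the integrand of
    the Nevanlinna condition are carried over by one argument. If \<open>c\<close> is 0, both sides
    vanish; otherwise almost no point has a coordinate at infinity, and elsewhere the kernels
    agree.\<close>
  have transfer: "(\<integral>t. G (\<lambda>l. szego (z $ l) (t $ l)) \<partial>weighted \<mu>)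
      = of_real C * (\<integral>x. G (\<lambda>l. cauchy_kernel (cayley_inv (z $ l)) (x l)) \<partial>L)"
    if z: "z \<in> upper_poly" and meas: "(\<lambda>t. G (\<lambda>l. szego (z $ l) (t $ l))) \<in> borel_measurable borel"
      and meas': "(\<lambda>x. G (\<lambda>l. cauchy_kernel (cayley_inv (z $ l)) (x l))) \<in> borel_measurable borel"
    for G :: "('n \<Rightarrow> complex) \<Rightarrow> complex" and z
  proof (cases "c = 0")
    case True
    then show ?thesis unfolding int_W[OF meas] C_def by simp
  next
    case False
    have "AE x in L. circle_pt (x j) \<noteq> 1" for j
    proof -
      have "closed {x :: 'n \<Rightarrow> real. circle_pt (x j) = 1}"
        by (rule closed_circle_pt_eq_one)
      then have A: "{x. circle_pt (x j) = 1} \<in> sets L" using L(2) by simp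
      have "c * measure L {x. circle_pt (x j) = 1} = 0"
        by (rule no_mass_at_infinity[OF L repC growth])
      then have "emeasure L {x. circle_pt (x j) = 1} = 0"
        using False by (simp add: L.emeasure_eq_measure)
      then show ?thesis using A by (intro AE_I[of _ _ "{x. circle_pt (x j) = 1}"]) auto
    qed
    then have "AE x in L. \<forall>j. circle_pt (x j) \<noteq> 1"
      by (simp add: AE_all_countable)
    then have "AE x in L. G (\<lambda>l. szego (z $ l) (T x $ l)) = G (\<lambda>l. cauchy_kernel (cayley_inv (z $ l)) (x l))"
    proof (rule AE_mp, intro AE_I2 impI)
      fix x :: "'n \<Rightarrow> real" assume "\<forall>j. circle_pt (x j) \<noteq> 1"
      then have "sin (pi * x l) \<noteq> 0" for l using circle_pt_eq_one by blast
      moreover have "0 < Im (z $ l)" for l using z unfolding upper_poly_def by simp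
      ultimately have "(\<lambda>l. szego (z $ l) (T x $ l)) = (\<lambda>l. cauchy_kernel (cayley_inv (z $ l)) (x l))"
        unfolding T_def by (simp add: szego_neg_cot)
      then show "G (\<lambda>l. szego (z $ l) (T x $ l)) = G (\<lambda>l. cauchy_kernel (cayley_inv (z $ l)) (x l))" by simp
    qed
    then have "(\<integral>x. G (\<lambda>l. szego (z $ l) (T x $ l)) \<partial>L)
       = (\<integral>x. G (\<lambda>l. cauchy_kernel (cayley_inv (z $ l)) (x l)) \<partial>L)"
      using measurable_compose[OF Tm meas] meas' measurable_cong_sets[OF L(2) refl]
      by (intro integral_cong_AE) blast+
    then show ?thesis unfolding int_W[OF meas] by simp
  qed
  have disc: "norm (cayley_inv (z $ l)) < 1" if "z \<in> upper_poly" for z :: "complex ^ 'n" and l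
    using that norm_cayley_inv_less unfolding upper_poly_def by simp
  have bk: "bounded_borel (\<lambda>x :: 'n \<Rightarrow> real. cauchy_kernel w (x l))" if "norm w < 1" for w l
    unfolding bounded_borel_def
    using norm_cauchy_kernel_le[OF that]
      measurable_compose[OF coord borel_measurable_continuous_onI[OF continuous_cauchy_kernel[OF that]]]
    by blast
  have bs: "bounded_borel (\<lambda>t :: real ^ 'n. szego (z $ l) (t $ l))" if "z \<in> upper_poly" for z l
    using that upper_poly_subset_off_real off_real_Im by (intro bounded_borel_szego) blast
  note bi = bounded_borel_prod bounded_borel_diff bounded_borel_add bounded_borel_cnj bounded_borel_const
  have bm: "g \<in> borel_measurable borel" if "bounded_borel g" for g :: "'a :: topological_space \<Rightarrow> complex"
    using that unfolding bounded_borel_def by simp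
  have prod: "(\<integral>t. (\<Prod>l\<in>UNIV. szego (z $ l) (t $ l)) \<partial>weighted \<mu>)
      = of_real pi ^ CARD('n) * ((f z - cnj (f (vec \<i>))) / (2 * \<i>))" if z: "z \<in> upper_poly" for z
    unfolding repC[OF z, symmetric] C_def
    using transfer[OF z, of "\<lambda>s. \<Prod>l\<in>UNIV. s l"]
    by (simp add: C_def bm bounded_borel_prod bs[OF z] bk[OF disc[OF z]])
  have Cm: "of_real (measure (weighted \<mu>) UNIV) = of_real pi ^ CARD('n) * complex_of_real (Im (f (vec \<i>)))"
    using emW C unfolding measure_def C_def c_def by simp
  have nev: "f z = nev_formula (Re (f (vec \<i>))) 0 \<mu> z" if z: "z \<in> upper_poly" for z
  proof -
    have "nev_formula (Re (f (vec \<i>))) 0 \<mu> z = of_real (Re (f (vec \<i>)))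
        + \<i> / of_real pi ^ CARD('n) * (2 * (of_real pi ^ CARD('n) * ((f z - cnj (f (vec \<i>))) / (2 * \<i>)))
          - of_real pi ^ CARD('n) * of_real (Im (f (vec \<i>))))"
      using z upper_poly_subset_off_real
      by (subst nev_formula_szego[OF sets growth\<mu>]) (auto simp: prod[OF z] Cm)
    also have "\<dots> = of_real (Re (f (vec \<i>))) + (f z - cnj (f (vec \<i>))) - \<i> * of_real (Im (f (vec \<i>)))"
      by (simp add: field_simps)
    also have "\<dots> = f z" by (simp add: complex_eq_iff)
    finally show ?thesis ..
  qed
  have nevcond: "nevanlinna_condition \<mu>"
    unfolding nevanlinna_condition_iff[OF sets growth\<mu>]
  proof
    fix z :: "complex ^ 'n" assume z: "z \<in> upper_poly"
    note bs' = bs[OF z] and bk' = bk[OF disc[OF z]]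
    define P where "P x = (\<Prod>l\<in>UNIV. poisson_kernel (cayley_inv (z $ l)) (x l))" for x
    define Q where "Q x = (\<Prod>l\<in>UNIV. cauchy_kernel (cayley_inv (z $ l)) (x l))" for x
    have PQ: "bounded_borel P" "bounded_borel Q"
      unfolding P_def Q_def poisson_kernel_def by (intro bi bk')+
    have "(\<integral>t. (\<Prod>j\<in>UNIV. szego (z $ j) (t $ j) + cnj (szego (z $ j) (t $ j)) - 1)
       - (\<Prod>j\<in>UNIV. szego (z $ j) (t $ j)) - (\<Prod>j\<in>UNIV. cnj (szego (z $ j) (t $ j))) + 1
       \<partial>weighted \<mu>) = of_real C * (\<integral>x. P x - Q x - (\<Prod>l\<in>UNIV. cnj (cauchy_kernel (cayley_inv (z $ l)) (x l))) + 1 \<partial>L)"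
      unfolding P_def Q_def poisson_kernel_def
      by (rule transfer[OF z, of "\<lambda>s. (\<Prod>j\<in>UNIV. s j + cnj (s j) - 1) - (\<Prod>j\<in>UNIV. s j) - (\<Prod>j\<in>UNIV. cnj (s j)) + 1"];
          intro bm bi bs' bk')
    also have "(\<lambda>x. P x - Q x - (\<Prod>l\<in>UNIV. cnj (cauchy_kernel (cayley_inv (z $ l)) (x l))) + 1) = (\<lambda>x. P x - Q x - cnj (Q x) + 1)"
      unfolding Q_def by simp
    also have "(\<integral>x. P x - Q x - cnj (Q x) + 1 \<partial>L) = (\<integral>x. P x \<partial>L) - (\<integral>x. Q x \<partial>L) - cnj (\<integral>x. Q x \<partial>L) + 1"
    proof -
      have i: "integrable L P" "integrable L Q" "integrable L (\<lambda>x. cnj (Q x))"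
        by (intro bounded_borel_integrable[OF L.finite_measure_axioms L(2)] PQ bounded_borel_cnj)+
      show ?thesis using i L.prob_space by simp
    qed
    also have "of_real C * \<dots> = of_real pi ^ CARD('n) * (of_real c * (\<integral>x. P x \<partial>L)
        - of_real c * (\<integral>x. Q x \<partial>L) - cnj (of_real c * (\<integral>x. Q x \<partial>L)) + of_real c)"
      unfolding C_def by (simp add: algebra_simps)
    \<comment> \<open>Poisson products give \<open>Im (f z)\<close>. The Cauchy products together
      with their conjugate give \<open>Im (f z) + Im (f (vec \<i>))\<close>, and the total mass
      \<open>c\<close> restores the second summand.\<close>
    also have "of_real c * (\<integral>x. P x \<partial>L) - of_real c * (\<integral>x. Q x \<partial>L)
        - cnj (of_real c * (\<integral>x. Q x \<partial>L)) + of_real c = 0"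
      unfolding P_def Q_def repP[OF z] repC[OF z] unfolding c_def
      by (simp add: complex_eq_iff Re_divide Im_divide power2_eq_square field_simps)
    finally show "(\<integral>t. (\<Prod>j\<in>UNIV. szego (z $ j) (t $ j) + cnj (szego (z $ j) (t $ j)) - 1)
       - (\<Prod>j\<in>UNIV. szego (z $ j) (t $ j)) - (\<Prod>j\<in>UNIV. cnj (szego (z $ j) (t $ j))) + 1
       \<partial>weighted \<mu>) = 0" by simp
  qed
  have "has_triple f (Re (f (vec \<i>))) 0 \<mu>"
    unfolding has_triple_def using sets growth\<mu> nevcond nev by simp
  then show thesis by (rule that)
qed

theorem theorem3p3:
  fixes f :: "complex ^ 'n \<Rightarrow> complex"
  assumes holo: "holomorphic_sv f off_real"
    and growth_upper: "\<And>j z. z \<in> off_real \<Longrightarrow>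
           nontangential_upper (\<lambda>w. f (upd_comp z j w) / w) 0"
    and growth_lower: "\<And>j z. z \<in> off_real \<Longrightarrow>
           nontangential_lower (\<lambda>w. f (upd_comp z j w) / w) 0"
  shows "(\<exists>h. herglotz_nevanlinna h \<and> is_symmetric_extension h f) \<longleftrightarrow>
         (\<forall>z\<in>upper_poly. Im (f z) \<ge> 0) \<and>
         (\<forall>z\<in>off_real.
            f z = (\<Sum>B | B \<noteq> {}. (-1) ^ (card B + 1) * cnj (f (Psi B (vec \<i>) z)))) \<and>
         variable_non_dependence f"
  unfolding symmetry_formula_def[symmetric]
proof
  assume "\<exists>h. herglotz_nevanlinna h \<and> is_symmetric_extension h f"
  then show "(\<forall>z\<in>upper_poly. Im (f z) \<ge> 0) \<and> symmetry_formula f \<and> variable_non_dependence f"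
    using symmetric_extension_properties[OF growth_upper] by blast
next
  assume *: "(\<forall>z\<in>upper_poly. Im (f z) \<ge> 0) \<and> symmetry_formula f \<and> variable_non_dependence f"
  have vi: "(vec \<i> :: complex ^ 'n) \<in> off_real" by (simp add: off_real_Im)
  have holo': "holomorphic_sv f upper_poly"
    by (rule holomorphic_sv_subset[OF holo upper_poly_subset_off_real])
  obtain \<mu> where tr: "has_triple f (Re (f (vec \<i>))) 0 \<mu>"
    by (rule representing_triple[OF holo' _ growth_upper[OF vi]]) (use * in auto)
  then have \<mu>: "sets \<mu> = sets borel" "growth_condition \<mu>" "nevanlinna_condition \<mu>"
    and f: "\<And>z. z \<in> upper_poly \<Longrightarrow> f z = nev_formula (Re (f (vec \<i>))) 0 \<mu> z"
    unfolding has_triple_def by auto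
  have "f z = nev_formula (Re (f (vec \<i>))) 0 \<mu> z" if "z \<in> off_real" for z
    using * by (intro symmetric_nondependent_eq[OF _ nev_formula_symmetry[OF \<mu>(1,2)] _
        nev_formula_nondependence[OF \<mu>] f that]) blast+
  \<comment> \<open>\<open>f\<close> itself serves as \<open>h\<close>, since only its values on the
    upper poly-half-plane count in that role.\<close>
  then have "is_symmetric_extension f f"
    using tr unfolding is_symmetric_extension_def by blast
  moreover have "herglotz_nevanlinna f"
    using holo' * unfolding herglotz_nevanlinna_def by blast
  ultimately show "\<exists>h. herglotz_nevanlinna h \<and> is_symmetric_extension h f" by blast
qed

end
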